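(* Let $E$ be a finite directed graph without sinks and sources in which every loop has an exit, and such that the relative commutant $\mathcal F_E'\cap C^*(E)$ of $\mathcal F_E$ in $C^*(E)$ is trivial (equal to $\mathbb C1$). Then every element of infinite order in $\mathfrak{GR}_E$ has infinite order in $\mathrm{Out}(C^*(E))$ as well.
   Context: A directed graph $E=(E^0,E^1,r,s)$ has vertex set $E^0$, edge set $E^1$, and range and source maps $r,s:E^1\to E^0$; it is finite if $E^0$ and $E^1$ are finite. $C^*(E)$ is the universal $C^*$-algebra generated by mutually orthogonal projections $P_v$ ($v\in E^0$) and partial isometries $S_e$ ($e\in E^1$) with $S_e^*S_e=P_{r(e)}$, $S_e^*S_f=0$ for $e\ne f$, $S_eS_e^*\le P_{s(e)}$, and $P_v=\sum_{s(e)=v}S_eS_e^*$ whenever $v$ emits finitely many and at least one edge. A path of length $k\ge1$ is $\mu=(\mu_1,\ldots,\mu_k)$ with $\mu_j\in E^1$ and $r(\mu_j)=s(\mu_{j+1})$; vertices are the paths of length $0$; put $|\mu|$ for the length, $s(\mu)=s(\mu_1)$, $r(\mu)=r(\mu_k)$, $S_\mu=S_{\mu_1}\cdots S_{\mu_k}$, $S_v=P_v$. A sink is a vertex emitting no edges; a source is a vertex receiving no edges. A loop is a path $\mu$ of length at least $1$ with $s(\mu)=r(\mu)$; it has an exit if some $s(\mu_j)$ emits at least two distinct edges. $\mathcal F_E$ (the core AF-subalgebra) is the fixed-point algebra of the gauge action $\gamma_z(S_e)=zS_e$, $\gamma_z(P_v)=P_v$, $z\in U(1)$. $\mathcal U_E$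 is the group of unitaries in $C^*(E)$ commuting with all $P_v$. For $u\in\mathcal U_E$, $\lambda_u$ is the unital $*$-endomorphism of $C^*(E)$ with $\lambda_u(S_e)=uS_e$, $\lambda_u(P_v)=P_v$. For $K\subseteq\mathcal U_E$, $\lambda(K)^{-1}=\{\lambda_u\in\mathrm{Aut}(C^*(E)):u\in K\}$. $\mathcal P_E^k$ is the group of unitaries in $C^*(E)$ of the form $\sum S_\alpha S_\beta^*$ (finite sum) with $|\alpha|=|\beta|=k$, and $\mathcal P_E=\bigcup_{k\ge0}\mathcal P_E^k$. $\Gamma_E$ is the group of automorphisms of $C^*(E)$ induced by automorphisms $\alpha$ of the graph $E$ via $S_e\mapsto S_{\alpha(e)}$, $P_v\mapsto P_{\alpha(v)}$. $\mathfrak{GR}_E$ is the subgroup of $\mathrm{Aut}(C^*(E))$ generated by $\lambda(\mathcal P_E\cap\mathcal U_E)^{-1}\cup\Gamma_E$. $\mathrm{Out}(C^*(E))=\mathrm{Aut}(C^*(E))/\mathrm{Inn}(C^*(E))$, where $\mathrm{Inn}(C^*(E))=\{\mathrm{Ad}(w):w\in C^*(E)\text{ unitary}\}$ and $\mathrm{Ad}(w)(x)=wxw^*$. *)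

theory Defs
  imports
    "HOL-Analysis.Abstract_Metric_Spaces"
    "HOL-Algebra.Algebra"
    "Graph_Theory.Arc_Walk"
begin

section \<open>C*-algebras\<close>

definition complex_field :: "complex ring" where
  "complex_field = \<lparr>carrier = UNIV, monoid.mult = (*), one = 1, ring.zero = 0, add = (+)\<rparr>"

record 'a cstar = "(complex, 'a) module" +
  adj :: "'a \<Rightarrow> 'a"
  cnorm :: "'a \<Rightarrow> real"

text \<open>Cut off outside the carrier, because \<open>Metric_space\<close> demands symmetry everywhere.\<close>
definition cmetric :: "('a, 'm) cstar_scheme \<Rightarrow> 'a \<Rightarrow> 'a \<Rightarrow> real" where
  "cmetric A x y = (if x \<in> carrier A \<and> y \<in> carrier A then cnorm A (x \<ominus>\<^bsub>A\<^esub> y) else 0)"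

text \<open>Not necessarily unital; the field \<open>one\<close> of the record plays no role here.\<close>
locale cstar_algebra = module complex_field A for A :: "('a, 'm) cstar_scheme" (structure) +
  assumes mult_closed: "\<lbrakk>x \<in> carrier A; y \<in> carrier A\<rbrakk> \<Longrightarrow> x \<otimes> y \<in> carrier A"
    and mult_assoc: "\<lbrakk>x \<in> carrier A; y \<in> carrier A; z \<in> carrier A\<rbrakk>
          \<Longrightarrow> (x \<otimes> y) \<otimes> z = x \<otimes> (y \<otimes> z)"
    and mult_distr_l: "\<lbrakk>x \<in> carrier A; y \<in> carrier A; z \<in> carrier A\<rbrakk>
          \<Longrightarrow> (x \<oplus> y) \<otimes> z = x \<otimes> z \<oplus> y \<otimes> z"
    and mult_distr_r: "\<lbrakk>x \<in> carrier A; y \<in> carrier A; z \<in> carrier A\<rbrakk>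
          \<Longrightarrow> z \<otimes> (x \<oplus> y) = z \<otimes> x \<oplus> z \<otimes> y"
    and smult_mult_l: "\<lbrakk>x \<in> carrier A; y \<in> carrier A\<rbrakk> \<Longrightarrow> (c \<odot> x) \<otimes> y = c \<odot> (x \<otimes> y)"
    and smult_mult_r: "\<lbrakk>x \<in> carrier A; y \<in> carrier A\<rbrakk> \<Longrightarrow> x \<otimes> (c \<odot> y) = c \<odot> (x \<otimes> y)"
    and adj_closed: "x \<in> carrier A \<Longrightarrow> adj A x \<in> carrier A"
    and adj_adj: "x \<in> carrier A \<Longrightarrow> adj A (adj A x) = x"
    and adj_add: "\<lbrakk>x \<in> carrier A; y \<in> carrier A\<rbrakk> \<Longrightarrow> adj A (x \<oplus> y) = adj A x \<oplus> adj A y"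
    and adj_smult: "x \<in> carrier A \<Longrightarrow> adj A (c \<odot> x) = cnj c \<odot> adj A x"
    and adj_mult: "\<lbrakk>x \<in> carrier A; y \<in> carrier A\<rbrakk> \<Longrightarrow> adj A (x \<otimes> y) = adj A y \<otimes> adj A x"
    and cnorm_nonneg: "x \<in> carrier A \<Longrightarrow> 0 \<le> cnorm A x"
    and cnorm_eq_0: "x \<in> carrier A \<Longrightarrow> cnorm A x = 0 \<longleftrightarrow> x = \<zero>"
    and cnorm_triangle:
          "\<lbrakk>x \<in> carrier A; y \<in> carrier A\<rbrakk> \<Longrightarrow> cnorm A (x \<oplus> y) \<le> cnorm A x + cnorm A y"
    and cnorm_smult: "x \<in> carrier A \<Longrightarrow> cnorm A (c \<odot> x) = cmod c * cnorm A x"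
    and cnorm_mult:
          "\<lbrakk>x \<in> carrier A; y \<in> carrier A\<rbrakk> \<Longrightarrow> cnorm A (x \<otimes> y) \<le> cnorm A x * cnorm A y"
    and cstar_identity: "x \<in> carrier A \<Longrightarrow> cnorm A (adj A x \<otimes> x) = (cnorm A x)\<^sup>2"
    and complete: "Metric_space.mcomplete (carrier A) (cmetric A)"

text \<open>
  For finite \<open>E\<close> the algebra \<open>C*(E)\<close> is automatically unital, with unit \<open>\<Sum>\<^sub>v P\<^sub>v\<close>; requiring it to be
  a \<open>unital_cstar_algebra\<close> only says that the field \<open>one\<close> holds this unit.
\<close>
locale unital_cstar_algebra = cstar_algebra + monoid A

lemma (in cstar_algebra) metric_space: "Metric_space (carrier A) (cmetric A)"
proof
  have neg: "cnorm A (\<ominus> x) = cnorm A x" if "x \<in> carrier A" for x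
  proof -
    have "(- 1) \<odot> x = \<ominus> x"
    proof -
      have "(- 1) \<odot> x \<oplus> x = ((- 1) \<odot> x) \<oplus> (1 \<odot> x)"
        using smult_one[OF that] by (simp add: complex_field_def)
      also have "\<dots> = (- 1 + 1) \<odot> x"
        using smult_l_distr[of "- 1" 1 x] that by (simp add: complex_field_def)
      also have "\<dots> = \<zero>"
        using smult_l_null[OF that] by (simp add: complex_field_def)
      finally show ?thesis
        using that smult_closed[of "- 1" x]
        by (simp add: complex_field_def M.minus_equality)
    qed
    then show ?thesis
      using cnorm_smult[OF that, of "- 1"] by simp
  qed
  fix x y
  show "0 \<le> cmetric A x y"
    by (simp add: cmetric_def cnorm_nonneg)
  show "cmetric A x y = cmetric A y x"
  proof (cases "x \<in> carrier A \<and> y \<in> carrier A")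
    case True
    then have "y \<ominus> x = \<ominus> (x \<ominus> y)"
      by (simp add: a_minus_def M.minus_add M.a_comm)
    with True show ?thesis
      using neg[of "x \<ominus> y"] by (simp add: cmetric_def)
  qed (auto simp: cmetric_def)
next
  fix x y
  assume xy: "x \<in> carrier A" "y \<in> carrier A"
  have "x = y" if "x \<oplus> \<ominus> y = \<zero>"
    using M.minus_equality[OF that] xy by simp
  moreover have "cmetric A x y = 0 \<longleftrightarrow> x \<oplus> \<ominus> y = \<zero>"
    using xy by (simp add: cmetric_def cnorm_eq_0 a_minus_def)
  ultimately show "cmetric A x y = 0 \<longleftrightarrow> x = y"
    using xy by (auto simp: M.r_neg)
next
  fix x y z
  assume xyz: "x \<in> carrier A" "y \<in> carrier A" "z \<in> carrier A"
  then have decomp: "x \<ominus> z = (x \<ominus> y) \<oplus> (y \<ominus> z)"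
    by (simp add: a_minus_def M.a_assoc M.r_neg1)
  have "cnorm A (x \<ominus> z) \<le> cnorm A (x \<ominus> y) + cnorm A (y \<ominus> z)"
    by (subst decomp, rule cnorm_triangle) (use xyz in simp_all)
  with xyz show "cmetric A x z \<le> cmetric A x y + cmetric A y z"
    by (simp add: cmetric_def)
qed

definition star_hom ::
    "('a, 'm) cstar_scheme \<Rightarrow> ('b, 'n) cstar_scheme \<Rightarrow> ('a \<Rightarrow> 'b) set" where
  "star_hom A B = {f \<in> carrier A \<rightarrow> carrier B.
     (\<forall>x\<in>carrier A. \<forall>y\<in>carrier A. f (x \<oplus>\<^bsub>A\<^esub> y) = f x \<oplus>\<^bsub>B\<^esub> f y) \<and>
     (\<forall>x\<in>carrier A. \<forall>y\<in>carrier A. f (x \<otimes>\<^bsub>A\<^esub> y) = f x \<otimes>\<^bsub>B\<^esub> f y) \<and>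
     (\<forall>c. \<forall>x\<in>carrier A. f (c \<odot>\<^bsub>A\<^esub> x) = c \<odot>\<^bsub>B\<^esub> f x) \<and>
     (\<forall>x\<in>carrier A. f (adj A x) = adj B (f x))}"

definition closed_star_subalgebra :: "('a, 'm) cstar_scheme \<Rightarrow> 'a set \<Rightarrow> bool" where
  "closed_star_subalgebra A B \<longleftrightarrow>
     B \<subseteq> carrier A \<and> \<zero>\<^bsub>A\<^esub> \<in> B \<and>
     (\<forall>x\<in>B. \<forall>y\<in>B. x \<oplus>\<^bsub>A\<^esub> y \<in> B \<and> x \<otimes>\<^bsub>A\<^esub> y \<in> B) \<and>
     (\<forall>c. \<forall>x\<in>B. c \<odot>\<^bsub>A\<^esub> x \<in> B) \<and> (\<forall>x\<in>B. adj A x \<in> B) \<and>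
     closedin (Metric_space.mtopology (carrier A) (cmetric A)) B"

definition cstar_le :: "('a, 'm) cstar_scheme \<Rightarrow> 'a \<Rightarrow> 'a \<Rightarrow> bool" where
  "cstar_le A x y \<longleftrightarrow> (\<exists>z\<in>carrier A. y \<ominus>\<^bsub>A\<^esub> x = adj A z \<otimes>\<^bsub>A\<^esub> z)"

definition projections :: "('a, 'm) cstar_scheme \<Rightarrow> 'a set" where
  "projections A = {p \<in> carrier A. adj A p = p \<and> p \<otimes>\<^bsub>A\<^esub> p = p}"

definition partial_isometries :: "('a, 'm) cstar_scheme \<Rightarrow> 'a set" where
  "partial_isometries A = {s \<in> carrier A. adj A s \<otimes>\<^bsub>A\<^esub> s \<in> projections A}"

definition unitaries :: "('a, 'm) cstar_scheme \<Rightarrow> 'a set" where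
  "unitaries A =
     {u \<in> carrier A. adj A u \<otimes>\<^bsub>A\<^esub> u = \<one>\<^bsub>A\<^esub> \<and> u \<otimes>\<^bsub>A\<^esub> adj A u = \<one>\<^bsub>A\<^esub>}"

definition relative_commutant :: "('a, 'm) cstar_scheme \<Rightarrow> 'a set \<Rightarrow> 'a set" where
  "relative_commutant A B = {x \<in> carrier A. \<forall>y\<in>B. x \<otimes>\<^bsub>A\<^esub> y = y \<otimes>\<^bsub>A\<^esub> x}"


subsection \<open>Automorphisms\<close>

definition cstar_auto :: "('a, 'm) cstar_scheme \<Rightarrow> ('a \<Rightarrow> 'a) set" where
  "cstar_auto A = star_hom A A \<inter> Bij (carrier A)"

definition aut_group :: "('a, 'm) cstar_scheme \<Rightarrow> ('a \<Rightarrow> 'a) monoid" where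
  "aut_group A = BijGroup (carrier A) \<lparr>carrier := cstar_auto A\<rparr>"

definition Ad :: "('a, 'm) cstar_scheme \<Rightarrow> 'a \<Rightarrow> 'a \<Rightarrow> 'a" where
  "Ad A w = (\<lambda>x\<in>carrier A. w \<otimes>\<^bsub>A\<^esub> x \<otimes>\<^bsub>A\<^esub> adj A w)"

definition inn :: "('a, 'm) cstar_scheme \<Rightarrow> ('a \<Rightarrow> 'a) set" where
  "inn A = Ad A ` unitaries A"

definition out_group :: "('a, 'm) cstar_scheme \<Rightarrow> ('a \<Rightarrow> 'a) set monoid" where
  "out_group A = aut_group A Mod inn A"

lemma mult_aut_group:
  "\<lbrakk>f \<in> cstar_auto A; g \<in> cstar_auto A\<rbrakk> \<Longrightarrow> f \<otimes>\<^bsub>aut_group A\<^esub> g = compose (carrier A) f g"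
  by (simp add: aut_group_def BijGroup_def cstar_auto_def)

context cstar_algebra
begin

lemma subgroup_cstar_auto: "subgroup (cstar_auto A) (BijGroup (carrier A))"
proof (rule group.subgroupI[OF group_BijGroup])
  show "cstar_auto A \<subseteq> carrier (BijGroup (carrier A))"
    by (auto simp: cstar_auto_def BijGroup_def)
  have "(\<lambda>x\<in>carrier A. x) \<in> cstar_auto A"
    using smult_closed
    by (auto simp: cstar_auto_def star_hom_def id_Bij mult_closed adj_closed complex_field_def)
  then show "cstar_auto A \<noteq> {}" by blast
next
  fix f assume f: "f \<in> cstar_auto A"
  then have fB: "f \<in> Bij (carrier A)" and fh: "f \<in> star_hom A A"
    by (auto simp: cstar_auto_def)
  let ?g = "\<lambda>x\<in>carrier A. inv_into (carrier A) f x"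
  have inv: "inv\<^bsub>BijGroup (carrier A)\<^esub> f = ?g"
    by (rule inv_BijGroup[OF fB])
  have g_closed: "?g x \<in> carrier A" if "x \<in> carrier A" for x
    using Bij_inv_into_mem[OF fB that] that by simp
  have fg: "f (?g x) = x" if "x \<in> carrier A" for x
    using fB that bij_betw_inv_into_right[of f "carrier A" "carrier A" x] by (simp add: Bij_def)
  have gf: "?g (f x) = x" if "x \<in> carrier A" for x
    using fB that by (auto simp: Bij_def bij_betw_inv_into_left bij_betw_apply)
  have sc: "c \<odot> x \<in> carrier A" if "x \<in> carrier A" for c x
    using smult_closed that by (simp add: complex_field_def)
  have g_eqI: "?g y = x" if "x \<in> carrier A" "f x = y" for x y
    using gf[OF that(1)] that(2) by blast
  have hom: "f (x \<oplus> y) = f x \<oplus> f y" "f (x \<otimes> y) = f x \<otimes> f y" "f (c \<odot> x) = c \<odot> f x"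
      "f (adj A x) = adj A (f x)"
    if "x \<in> carrier A" "y \<in> carrier A" for x y c
    using fh that unfolding star_hom_def by blast+
  have "?g \<in> star_hom A A"
    unfolding star_hom_def
  proof (intro CollectI conjI ballI allI)
    show "?g \<in> carrier A \<rightarrow> carrier A" by (rule funcsetI) (rule g_closed)
  next
    fix x y assume xy: "x \<in> carrier A" "y \<in> carrier A"
    note g = g_closed[OF xy(1)] g_closed[OF xy(2)]
    show "?g (x \<oplus> y) = ?g x \<oplus> ?g y"
      by (rule g_eqI[OF M.a_closed[OF g]]) (simp only: hom(1)[OF g] fg xy)
    show "?g (x \<otimes> y) = ?g x \<otimes> ?g y"
      by (rule g_eqI[OF mult_closed[OF g]]) (simp only: hom(2)[OF g] fg xy)
  next
    fix c x assume x: "x \<in> carrier A"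
    note g = g_closed[OF x]
    show "?g (c \<odot> x) = c \<odot> ?g x"
      by (rule g_eqI[OF sc[OF g]]) (simp only: hom(3)[OF g g] fg x)
  next
    fix x assume x: "x \<in> carrier A"
    note g = g_closed[OF x]
    show "?g (adj A x) = adj A (?g x)"
      by (rule g_eqI[OF adj_closed[OF g]]) (simp only: hom(4)[OF g g] fg x)
  qed
  with restrict_inv_into_Bij[OF fB] inv
  show "inv\<^bsub>BijGroup (carrier A)\<^esub> f \<in> cstar_auto A"
    by (simp add: cstar_auto_def)
next
  fix f g assume fg: "f \<in> cstar_auto A" "g \<in> cstar_auto A"
  then have h: "f \<in> star_hom A A" "g \<in> star_hom A A"
    by (auto simp: cstar_auto_def)
  have hom: "h (x \<oplus> y) = h x \<oplus> h y" "h (x \<otimes> y) = h x \<otimes> h y"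
    if "h \<in> star_hom A A" "x \<in> carrier A" "y \<in> carrier A" for h x y
    using that unfolding star_hom_def by blast+
  have hom': "h (c \<odot> x) = c \<odot> h x" "h (adj A x) = adj A (h x)" "h x \<in> carrier A"
    if "h \<in> star_hom A A" "x \<in> carrier A" for h x c
    using that unfolding star_hom_def by blast+
  have sc: "c \<odot> x \<in> carrier A" if "x \<in> carrier A" for c x
    using smult_closed that by (simp add: complex_field_def)
  have "compose (carrier A) f g \<in> star_hom A A"
    unfolding star_hom_def
    by (intro CollectI conjI ballI allI funcsetI)
      (simp_all add: compose_def hom[OF h(1)] hom[OF h(2)] hom'[OF h(1)] hom'[OF h(2)]
        mult_closed adj_closed sc)
  with fg show "f \<otimes>\<^bsub>BijGroup (carrier A)\<^esub> g \<in> cstar_auto A"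
    by (simp add: cstar_auto_def BijGroup_def compose_Bij)
qed

lemma group_aut_group: "group (aut_group A)"
  unfolding aut_group_def
  by (rule subgroup.subgroup_is_group[OF subgroup_cstar_auto group_BijGroup])

end

context unital_cstar_algebra
begin

lemma adj_one: "adj A \<one> = \<one>"
proof -
  have "adj A (adj A \<one> \<otimes> \<one>) = adj A \<one> \<otimes> adj A (adj A \<one>)"
    by (rule adj_mult) (simp_all add: adj_closed)
  then show ?thesis
    by (simp add: adj_adj adj_closed)
qed

lemma auto_one:
  assumes "f \<in> cstar_auto A"
  shows "f \<one> = \<one>"
proof (rule one_unique)
  show "f \<one> \<in> carrier A"
    using assms by (auto simp: cstar_auto_def star_hom_def)
next
  fix y assume "y \<in> carrier A"
  then obtain x where x: "x \<in> carrier A" "y = f x"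
    using assms by (auto simp: cstar_auto_def Bij_def bij_betw_def)
  have "f (\<one> \<otimes> x) = f \<one> \<otimes> f x"
    using assms x(1) one_closed unfolding cstar_auto_def star_hom_def by blast
  then show "f \<one> \<otimes> y = y" using x by simp
qed

lemma unitaries_closed:
  shows "u \<in> unitaries A \<Longrightarrow> w \<in> unitaries A \<Longrightarrow> u \<otimes> w \<in> unitaries A"
    and "u \<in> unitaries A \<Longrightarrow> adj A u \<in> unitaries A"
    and "\<one> \<in> unitaries A"
proof -
  assume u: "u \<in> unitaries A" and w: "w \<in> unitaries A"
  have c: "u \<in> carrier A" "w \<in> carrier A" "adj A u \<in> carrier A" "adj A w \<in> carrier A"
    using u w by (auto simp: unitaries_def adj_closed)
  have "adj A (u \<otimes> w) \<otimes> (u \<otimes> w) = adj A w \<otimes> ((adj A u \<otimes> u) \<otimes> w)"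
    using c by (simp add: adj_mult m_assoc)
  moreover have "(u \<otimes> w) \<otimes> adj A (u \<otimes> w) = u \<otimes> ((w \<otimes> adj A w) \<otimes> adj A u)"
    using c by (simp add: adj_mult m_assoc)
  ultimately show "u \<otimes> w \<in> unitaries A"
    using u w c by (simp add: unitaries_def)
qed (auto simp: unitaries_def adj_closed adj_adj adj_one)

lemma Ad_compose:
  assumes "u \<in> carrier A" "w \<in> carrier A"
  shows "compose (carrier A) (Ad A u) (Ad A w) = Ad A (u \<otimes> w)"
  using assms by (auto simp: compose_def Ad_def adj_mult adj_closed m_assoc intro!: restrict_ext)

lemma Ad_one: "Ad A \<one> = (\<lambda>x\<in>carrier A. x)"
  by (auto simp: Ad_def adj_one intro!: restrict_ext)

lemma Ad_in_auto:
  assumes u: "u \<in> unitaries A"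
  shows "Ad A u \<in> cstar_auto A"
proof -
  have c: "u \<in> carrier A" "adj A u \<in> carrier A"
    and uu: "adj A u \<otimes> u = \<one>" "u \<otimes> adj A u = \<one>"
    using u by (auto simp: unitaries_def adj_closed)
  have cancel: "adj A u \<otimes> (u \<otimes> x) = x" if "x \<in> carrier A" for x
    using c uu that m_assoc[of "adj A u" u x] by simp
  have sc: "a \<odot> x \<in> carrier A" if "x \<in> carrier A" for a x
    using smult_closed that by (simp add: complex_field_def)
  have "bij_betw (Ad A u) (carrier A) (carrier A)"
  proof (rule bij_betw_byWitness[where f' = "Ad A (adj A u)"])
    have 1: "compose (carrier A) (Ad A (adj A u)) (Ad A u) = (\<lambda>x\<in>carrier A. x)"
      and 2: "compose (carrier A) (Ad A u) (Ad A (adj A u)) = (\<lambda>x\<in>carrier A. x)"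
      using c uu by (simp_all add: Ad_compose Ad_one)
    show "\<forall>x\<in>carrier A. Ad A (adj A u) (Ad A u x) = x"
      proof
      fix x assume "x \<in> carrier A"
      then show "Ad A (adj A u) (Ad A u x) = x"
        using fun_cong[OF 1, of x] by (simp add: compose_def)
    qed
    show "\<forall>x\<in>carrier A. Ad A u (Ad A (adj A u) x) = x"
      proof
      fix x assume "x \<in> carrier A"
      then show "Ad A u (Ad A (adj A u) x) = x"
        using fun_cong[OF 2, of x] by (simp add: compose_def)
    qed
  qed (use c in \<open>auto simp: Ad_def adj_closed\<close>)
  moreover have "Ad A u \<in> extensional (carrier A)"
    by (simp add: Ad_def)
  moreover have "Ad A u \<in> star_hom A A"
    unfolding star_hom_def
  proof (intro CollectI conjI ballI allI)
    show "Ad A u \<in> carrier A \<rightarrow> carrier A"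
      using c by (simp add: Ad_def)
  next
    fix x y assume xy: "x \<in> carrier A" "y \<in> carrier A"
    show "Ad A u (x \<oplus> y) = Ad A u x \<oplus> Ad A u y"
      using c xy by (simp add: Ad_def mult_distr_l mult_distr_r)
    show "Ad A u (x \<otimes> y) = Ad A u x \<otimes> Ad A u y"
      using c xy by (simp add: Ad_def m_assoc cancel)
  next
    fix a x assume "x \<in> carrier A"
    then show "Ad A u (a \<odot> x) = a \<odot> Ad A u x"
      using c sc by (simp add: Ad_def smult_mult_l smult_mult_r)
  next
    fix x assume "x \<in> carrier A"
    then show "Ad A u (adj A x) = adj A (Ad A u x)"
      using c by (simp add: Ad_def adj_mult adj_adj adj_closed m_assoc)
  qed
  ultimately show ?thesis
    by (simp add: cstar_auto_def Bij_def)
qed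

lemma inn_normal: "inn A \<lhd> aut_group A"
proof -
  interpret G: group "aut_group A" by (rule group_aut_group)
  have car: "carrier (aut_group A) = cstar_auto A"
    by (simp add: aut_group_def)
  have one: "\<one>\<^bsub>aut_group A\<^esub> = Ad A \<one>"
    by (simp add: aut_group_def BijGroup_def Ad_one)
  have mult: "Ad A u \<otimes>\<^bsub>aut_group A\<^esub> Ad A w = Ad A (u \<otimes> w)"
    if "u \<in> unitaries A" "w \<in> unitaries A" for u w
    using that by (simp add: mult_aut_group Ad_in_auto) (simp add: Ad_compose unitaries_def)
  have inv: "inv\<^bsub>aut_group A\<^esub> Ad A u = Ad A (adj A u)" if u: "u \<in> unitaries A" for u
  proof (rule G.inv_equality)
    show "Ad A (adj A u) \<otimes>\<^bsub>aut_group A\<^esub> Ad A u = \<one>\<^bsub>aut_group A\<^esub>"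
      using mult[OF unitaries_closed(2)[OF u] u] u one by (simp add: unitaries_def)
  qed (use u in \<open>simp_all add: car Ad_in_auto unitaries_closed\<close>)
  have sub: "subgroup (inn A) (aut_group A)"
  proof (rule G.subgroupI)
    show "inn A \<subseteq> carrier (aut_group A)"
      by (auto simp: inn_def car Ad_in_auto)
    show "inn A \<noteq> {}"
      using unitaries_closed(3) by (auto simp: inn_def)
  qed (auto simp: inn_def inv mult unitaries_closed)
  show ?thesis
  proof (rule G.normal_invI[OF sub])
    fix f g assume f: "f \<in> carrier (aut_group A)" and "g \<in> inn A"
    then obtain u where u: "u \<in> unitaries A" and g: "g = Ad A u"
      by (auto simp: inn_def)
    have fa: "f \<in> cstar_auto A" using f car by simp
    then have fh: "f \<in> star_hom A A" by (simp add: cstar_auto_def)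
    have uc: "u \<in> carrier A" using u by (simp add: unitaries_def)
    have fu: "f u \<in> unitaries A"
    proof -
      have "f (adj A u \<otimes> u) = adj A (f u) \<otimes> f u" "f (u \<otimes> adj A u) = f u \<otimes> adj A (f u)"
        using fh uc adj_closed[OF uc] by (auto simp: star_hom_def)
      then show ?thesis
        using u auto_one[OF fa] fh by (auto simp: unitaries_def star_hom_def)
    qed
    have "f \<otimes>\<^bsub>aut_group A\<^esub> g = Ad A (f u) \<otimes>\<^bsub>aut_group A\<^esub> f"
    proof -
      have "compose (carrier A) f (Ad A u) = compose (carrier A) (Ad A (f u)) f"
        using fh uc by (auto simp: compose_def Ad_def star_hom_def adj_closed Pi_iff
            intro!: restrict_ext)
      then show ?thesis
        using fa u fu by (simp add: g mult_aut_group Ad_in_auto)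
    qed
    moreover have "Ad A (f u) \<in> carrier (aut_group A)"
      using fu car Ad_in_auto by simp
    ultimately have "f \<otimes>\<^bsub>aut_group A\<^esub> g \<otimes>\<^bsub>aut_group A\<^esub> inv\<^bsub>aut_group A\<^esub> f = Ad A (f u)"
      using f by (simp add: G.m_assoc)
    then show "f \<otimes>\<^bsub>aut_group A\<^esub> g \<otimes>\<^bsub>aut_group A\<^esub> inv\<^bsub>aut_group A\<^esub> f \<in> inn A"
      using fu by (auto simp: inn_def)
  qed
qed

lemma group_out_group: "group (out_group A)"
  unfolding out_group_def by (rule normal.factorgroup_is_group[OF inn_normal])

end



section \<open>Graph C*-algebras\<close>

text \<open>
  The source map of a graph is \<open>tail\<close>, its range map is \<open>head\<close>. Neither \<open>fin_digraph\<close>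
  nor \<open>wf_digraph\<close> forbids parallel edges or edges from a vertex to itself.
\<close>

definition no_sinks :: "('v, 'e) pre_digraph \<Rightarrow> bool" where
  "no_sinks E \<longleftrightarrow> (\<forall>v\<in>verts E. out_arcs E v \<noteq> {})"

definition no_sources :: "('v, 'e) pre_digraph \<Rightarrow> bool" where
  "no_sources E \<longleftrightarrow> (\<forall>v\<in>verts E. in_arcs E v \<noteq> {})"

text \<open>Loops are closed walks of positive length; they may revisit vertices and edges.\<close>
definition every_loop_has_exit :: "('v, 'e) pre_digraph \<Rightarrow> bool" where
  "every_loop_has_exit E \<longleftrightarrow>
     (\<forall>u \<mu>. pre_digraph.awalk E u \<mu> u \<and> \<mu> \<noteq> [] \<longrightarrow>
        (\<exists>a\<in>set \<mu>. \<exists>e\<in>out_arcs E (tail E a). \<exists>f\<in>out_arcs E (tail E a). e \<noteq> f))"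

definition ck_family ::
    "('v, 'e) pre_digraph \<Rightarrow> ('a, 'm) cstar_scheme \<Rightarrow> ('v \<Rightarrow> 'a) \<Rightarrow> ('e \<Rightarrow> 'a) \<Rightarrow> bool" where
  "ck_family E A P S \<longleftrightarrow>
     (\<forall>v\<in>verts E. P v \<in> projections A) \<and>
     (\<forall>v\<in>verts E. \<forall>w\<in>verts E. v \<noteq> w \<longrightarrow> P v \<otimes>\<^bsub>A\<^esub> P w = \<zero>\<^bsub>A\<^esub>) \<and>
     (\<forall>e\<in>arcs E. S e \<in> partial_isometries A) \<and>
     (\<forall>e\<in>arcs E. adj A (S e) \<otimes>\<^bsub>A\<^esub> S e = P (head E e)) \<and>
     (\<forall>e\<in>arcs E. \<forall>f\<in>arcs E. e \<noteq> f \<longrightarrow> adj A (S e) \<otimes>\<^bsub>A\<^esub> S f = \<zero>\<^bsub>A\<^esub>) \<and>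
     (\<forall>e\<in>arcs E. cstar_le A (S e \<otimes>\<^bsub>A\<^esub> adj A (S e)) (P (tail E e))) \<and>
     (\<forall>v\<in>verts E. finite (out_arcs E v) \<and> out_arcs E v \<noteq> {} \<longrightarrow>
        P v = (\<Oplus>\<^bsub>A\<^esub>e\<in>out_arcs E v. S e \<otimes>\<^bsub>A\<^esub> adj A (S e)))"

text \<open>
  \<open>graph_cstar_algebra E A P S\<close>: the C*-algebra \<open>A\<close> with generators \<open>P\<close>, \<open>S\<close> is \<open>C*(E)\<close>.
  HOL cannot quantify over the type of the target \<open>B\<close>, so \<open>B\<close> ranges over all C*-algebras whose
  carrier is a subset of the type \<open>'a\<close> underlying \<open>A\<close>. For countable \<open>E\<close> nothing is lost:
  every Cuntz-Krieger \<open>E\<close>-family lives in the separable C*-algebra it generates, which has at most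
  continuum many elements, and a nonzero \<open>A\<close> already has at least that many. (If \<open>'a\<close> is too
  small to hold \<open>C*(E)\<close>, the only possible \<open>A\<close> is zero, with a trivial automorphism group.)
  Homomorphisms are taken extensional so that uniqueness is meaningful.
\<close>
locale graph_cstar_algebra = cstar_algebra A
  for E :: "('v, 'e) pre_digraph" and A :: "'a cstar" (structure)
    and P :: "'v \<Rightarrow> 'a" and S :: "'e \<Rightarrow> 'a" +
  assumes family: "ck_family E A P S"
    and generated: "\<And>B. \<lbrakk>closed_star_subalgebra A B; P ` verts E \<subseteq> B; S ` arcs E \<subseteq> B\<rbrakk>
          \<Longrightarrow> B = carrier A"
    and universal: "\<And>(B :: 'a cstar) Q T. \<lbrakk>cstar_algebra B; ck_family E B Q T\<rbrakk> \<Longrightarrow>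
          \<exists>!f. f \<in> star_hom A B \<and> f \<in> extensional (carrier A) \<and>
               (\<forall>v\<in>verts E. f (P v) = Q v) \<and> (\<forall>e\<in>arcs E. f (S e) = T e)"

text \<open>The endomorphism of \<open>C*(E)\<close> given by \<open>P v \<mapsto> Q v\<close>, \<open>S e \<mapsto> T e\<close>.\<close>
definition graph_endo ::
    "('v, 'e) pre_digraph \<Rightarrow> 'a cstar \<Rightarrow> ('v \<Rightarrow> 'a) \<Rightarrow> ('e \<Rightarrow> 'a) \<Rightarrow> ('v \<Rightarrow> 'a) \<Rightarrow> ('e \<Rightarrow> 'a) \<Rightarrow>
     'a \<Rightarrow> 'a" where
  "graph_endo E A P S Q T =
     (THE f. f \<in> star_hom A A \<and> f \<in> extensional (carrier A) \<and>
             (\<forall>v\<in>verts E. f (P v) = Q v) \<and> (\<forall>e\<in>arcs E. f (S e) = T e))"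

definition gauge ::
    "('v, 'e) pre_digraph \<Rightarrow> 'a cstar \<Rightarrow> ('v \<Rightarrow> 'a) \<Rightarrow> ('e \<Rightarrow> 'a) \<Rightarrow> complex \<Rightarrow> 'a \<Rightarrow> 'a" where
  "gauge E A P S z = graph_endo E A P S P (\<lambda>e. z \<odot>\<^bsub>A\<^esub> S e)"

definition core ::
    "('v, 'e) pre_digraph \<Rightarrow> 'a cstar \<Rightarrow> ('v \<Rightarrow> 'a) \<Rightarrow> ('e \<Rightarrow> 'a) \<Rightarrow> 'a set" where
  "core E A P S = {x \<in> carrier A. \<forall>z. cmod z = 1 \<longrightarrow> gauge E A P S z x = x}"

definition U_group ::
    "('v, 'e) pre_digraph \<Rightarrow> 'a cstar \<Rightarrow> ('v \<Rightarrow> 'a) \<Rightarrow> 'a set" where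
  "U_group E A P = {u \<in> unitaries A. \<forall>v\<in>verts E. u \<otimes>\<^bsub>A\<^esub> P v = P v \<otimes>\<^bsub>A\<^esub> u}"

definition lam ::
    "('v, 'e) pre_digraph \<Rightarrow> 'a cstar \<Rightarrow> ('v \<Rightarrow> 'a) \<Rightarrow> ('e \<Rightarrow> 'a) \<Rightarrow> 'a \<Rightarrow> 'a \<Rightarrow> 'a" where
  "lam E A P S u = graph_endo E A P S P (\<lambda>e. u \<otimes>\<^bsub>A\<^esub> S e)"

text \<open>Despite the traditional notation \<open>\<lambda>(K)\<^sup>-\<^sup>1\<close>, this is the set of invertible \<open>\<lambda>\<^sub>u\<close>, \<open>u \<in> K\<close>.\<close>
definition lam_inv ::
    "('v, 'e) pre_digraph \<Rightarrow> 'a cstar \<Rightarrow> ('v \<Rightarrow> 'a) \<Rightarrow> ('e \<Rightarrow> 'a) \<Rightarrow> 'a set \<Rightarrow> ('a \<Rightarrow> 'a) set" where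
  "lam_inv E A P S K = lam E A P S ` K \<inter> cstar_auto A"

text \<open>
  A path is a pair \<open>(u, \<mu>)\<close> of its source and its list of edges; the paths of length 0 are
  \<open>(v, [])\<close> for vertices \<open>v\<close>.
\<close>
definition paths :: "('v, 'e) pre_digraph \<Rightarrow> nat \<Rightarrow> ('v \<times> 'e list) set" where
  "paths E k = {(u, \<mu>). length \<mu> = k \<and> (\<exists>v. pre_digraph.awalk E u \<mu> v)}"

fun S_path :: "'a cstar \<Rightarrow> ('v \<Rightarrow> 'a) \<Rightarrow> ('e \<Rightarrow> 'a) \<Rightarrow> 'v \<times> 'e list \<Rightarrow> 'a" where
  "S_path A P S (u, []) = P u"
| "S_path A P S (u, [e]) = S e"
| "S_path A P S (u, e # f # \<mu>) = S e \<otimes>\<^bsub>A\<^esub> S_path A P S (u, f # \<mu>)"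

definition perm_unitaries ::
    "('v, 'e) pre_digraph \<Rightarrow> 'a cstar \<Rightarrow> ('v \<Rightarrow> 'a) \<Rightarrow> ('e \<Rightarrow> 'a) \<Rightarrow> nat \<Rightarrow> 'a set" where
  "perm_unitaries E A P S k =
     {u \<in> unitaries A. \<exists>J \<subseteq> paths E k \<times> paths E k. finite J \<and>
        u = (\<Oplus>\<^bsub>A\<^esub>p\<in>J. S_path A P S (fst p) \<otimes>\<^bsub>A\<^esub> adj A (S_path A P S (snd p)))}"

definition graph_auto ::
    "('v, 'e) pre_digraph \<Rightarrow> (('v \<Rightarrow> 'v) \<times> ('e \<Rightarrow> 'e)) set" where
  "graph_auto E = {(a, b). bij_betw a (verts E) (verts E) \<and> bij_betw b (arcs E) (arcs E) \<and>
     (\<forall>e\<in>arcs E. tail E (b e) = a (tail E e) \<and> head E (b e) = a (head E e))}"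

definition Gamma ::
    "('v, 'e) pre_digraph \<Rightarrow> 'a cstar \<Rightarrow> ('v \<Rightarrow> 'a) \<Rightarrow> ('e \<Rightarrow> 'a) \<Rightarrow> ('a \<Rightarrow> 'a) set" where
  "Gamma E A P S = (\<lambda>(a, b). graph_endo E A P S (P \<circ> a) (S \<circ> b)) ` graph_auto E"

text \<open>Elements of infinite order in this and other groups are those with \<open>group.ord\<close> equal to 0.\<close>
definition GR ::
    "('v, 'e) pre_digraph \<Rightarrow> 'a cstar \<Rightarrow> ('v \<Rightarrow> 'a) \<Rightarrow> ('e \<Rightarrow> 'a) \<Rightarrow> ('a \<Rightarrow> 'a) monoid" where
  "GR E A P S = subgroup_generated (aut_group A)
     (lam_inv E A P S ((\<Union>k. perm_unitaries E A P S k) \<inter> U_group E A P) \<union> Gamma E A P S)"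

end

theory Submission
  imports Defs "HOL-Analysis.Urysohn"
begin

text \<open>
  The point is that an automorphism in \<open>GR\<close> which is inner has finite order; applied to a power of
  \<open>\<alpha>\<close> this gives the theorem.

  Every element of \<open>GR\<close> commutes with the gauge action and permutes the set \<open>Natural\<close> of
  combinations, with natural coefficients, of the matrix units \<open>S\<^sub>\<alpha> S\<^sub>\<beta>\<^sup>*\<close> with \<open>|\<alpha>| = |\<beta>|\<close>
  (\<open>GR_localized\<close>). For the generators, mapping \<open>Natural\<close> into itself is a computation; mapping
  it onto itself needs an argument. Here enters a rigidity of natural coefficients: they can be
  recovered from their squares, so an element \<open>x\<close> of \<open>Natural\<close> is determined by the map
  \<open>q \<mapsto> x q x\<^sup>*\<close> on the diagonal projections (\<open>eq_if_conjugation_eq\<close>). An element of the core which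
  normalizes the diagonal has the same action on it as some element of \<open>Natural\<close>
  (\<open>normalizer_combinatorial_part\<close>), and \<open>inverse_Natural\<close> follows.

  Now let \<open>Ad(w)\<close> belong to \<open>GR\<close>. Since it commutes with the gauge action, \<open>w\<^sup>* \<gamma>\<^sub>z(w)\<close> is
  central, hence a scalar, for every \<open>z\<close>. Thus \<open>w\<close> is an eigenvector of the gauge action, and close to
  a combination of matrix units \<open>S\<^sub>\<alpha> S\<^sub>\<beta>\<^sup>*\<close> with fixed lengths \<open>|\<alpha>| = a\<close> and \<open>|\<beta>| = b\<close>
  (\<open>eigenvector_approx\<close>); this combination is obtained by averaging over roots of unity, which does not
  increase norms because unital endomorphisms are contractive
  (\<open>unital_star_hom_contractive\<close>). Moreover \<open>w\<close> normalizes the diagonal, and such a unitary can only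
  permute the cylinder projections: it maps those of length \<open>b + i\<close> to those of length \<open>a + i\<close>, for
  every \<open>i\<close>. If \<open>a \<noteq> b\<close>, the number of nonzero cylinders of a given length is bounded and the diagonal
  contains only finitely many projections. If \<open>a = b\<close>, the first \<open>a\<close> edges of a path are permuted and the
  rest of the path is unchanged. In both cases a power of \<open>Ad(w)\<close> fixes all diagonal projections
  (\<open>unitary_normalizer_periodic\<close>). By the rigidity of \<open>Natural\<close> that power fixes every matrix unit in
  the core and so the core itself. Hence the same power of \<open>w\<close> lies in the relative commutant of the
  core, which is trivial, and the power of \<open>Ad(w)\<close> is the identity (\<open>inner_localized_periodic\<close>).
\<close>

section \<open>Sums of roots of unity, squares and permutations\<close>

lemma sum_roots_of_unity:
  fixes k :: int and N :: nat
  assumes "\<bar>k\<bar> < int N"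
  shows "(\<Sum>j<N. cis (2 * pi * real j * of_int k / real N)) = (if k = 0 then of_nat N else 0)"
proof (cases "k = 0")
  case False
  define \<omega> where "\<omega> = cis (2 * pi * of_int k / real N)"
  have N: "N > 0" using assms by simp
  have "cis (2 * pi * real j * of_int k / real N) = \<omega> ^ j" for j
    unfolding \<omega>_def Complex.DeMoivre by (simp add: algebra_simps)
  then have "(\<Sum>j<N. cis (2 * pi * real j * of_int k / real N)) = (\<Sum>j<N. \<omega> ^ j)" by simp
  also have "\<dots> = 0"
  proof -
    have "\<omega> ^ N = cis (2 * pi * of_int k)"
      unfolding \<omega>_def Complex.DeMoivre using N by simp
    also have "\<dots> = 1" by (simp add: cis_multiple_2pi)
    finally have "\<omega> ^ N = 1" .
    moreover have "\<omega> \<noteq> 1"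
    proof
      assume "\<omega> = 1"
      then have "cos (2 * pi * of_int k / real N) = 1" by (simp add: \<omega>_def complex_eq_iff)
      then obtain n :: int where "2 * pi * of_int k / real N = of_int n * 2 * pi"
        by (auto simp: cos_one_2pi_int)
      then have "of_int k = (of_int n * real N :: real)" using N by (simp add: field_simps)
      then have "k = n * int N" by (metis of_int_eq_iff of_int_mult of_int_of_nat_eq)
      then show False using assms False by (auto simp: abs_mult)
    qed
    ultimately show ?thesis by (simp add: sum_gp_strict)
  qed
  finally show ?thesis using False by simp
qed simp

lemma nat_sum_squares_eq:
  fixes n :: "'i \<Rightarrow> nat"
  assumes "finite I" "i \<in> I" "(\<Sum>j\<in>I. n j * n j) = n i"
  shows "n i \<le> 1" "\<And>j. \<lbrakk>j \<in> I; j \<noteq> i\<rbrakk> \<Longrightarrow> n j = 0"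
proof -
  have *: "n i * n i + (\<Sum>j\<in>I - {i}. n j * n j) = n i"
    using assms by (simp add: sum.remove)
  have sq: "n i \<le> n i * n i" by (cases "n i") auto
  then have "n i * n i = n i" "(\<Sum>j\<in>I - {i}. n j * n j) = 0" using * by linarith+
  then show "n i \<le> 1" "\<And>j. \<lbrakk>j \<in> I; j \<noteq> i\<rbrakk> \<Longrightarrow> n j = 0" using assms(1) by auto
qed

lemma inj_on_finite_periodic:
  assumes Y: "finite Y" "f ` Y \<subseteq> Y" "inj_on f Y"
  obtains M where "M > 0" "\<forall>x\<in>Y. (f ^^ M) x = x"
proof -
  have maps: "(f ^^ n) x \<in> Y" if "x \<in> Y" for n x
    using that Y(2) by (induct n) auto
  have inj: "inj_on (f ^^ n) Y" for n
  proof (induct n)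
    case (Suc n)
    then show ?case using Y(3) maps by (auto simp: inj_on_def)
  qed simp
  have "\<not> inj (\<lambda>n. restrict (f ^^ n) Y)"
  proof
    assume "inj (\<lambda>n. restrict (f ^^ n) Y)"
    moreover have "range (\<lambda>n. restrict (f ^^ n) Y) \<subseteq> (\<Pi>\<^sub>E x\<in>Y. Y)" using maps by auto
    moreover have "finite (\<Pi>\<^sub>E x\<in>Y. Y)" using Y(1) by (intro finite_PiE) auto
    ultimately show False using finite_subset range_inj_infinite by blast
  qed
  then obtain i j where ij: "i < j" "restrict (f ^^ i) Y = restrict (f ^^ j) Y"
    unfolding inj_def by (metis linorder_neqE_nat)
  have "(f ^^ (j - i)) x = x" if x: "x \<in> Y" for x
  proof -
    have "(f ^^ i) ((f ^^ (j - i)) x) = (f ^^ (i + (j - i))) x" by (simp add: funpow_add)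
    also have "\<dots> = (f ^^ i) x" using ij x by (metis le_add_diff_inverse less_imp_le restrict_apply')
    finally show ?thesis using inj[of i] maps[OF x] x by (auto dest: inj_onD)
  qed
  then show thesis using that[of "j - i"] ij(1) by simp
qed


section \<open>Unital C*-algebras\<close>

sublocale unital_cstar_algebra \<subseteq> A: ring A
  by unfold_locales (auto simp: mult_distr_l mult_distr_r)

context unital_cstar_algebra
begin

subsection \<open>Scalars and the involution\<close>

abbreviation star ("(_\<^sup>\<star>)" [1000] 999) where "x\<^sup>\<star> \<equiv> adj A x"

declare adj_closed [simp, intro] adj_adj [simp] adj_one [simp]

lemma smult_closed' [simp, intro]: "x \<in> carrier A \<Longrightarrow> c \<odot> x \<in> carrier A"
  using smult_closed[of c x] by (simp add: complex_field_def)

lemma smult_smult: "x \<in> carrier A \<Longrightarrow> c \<odot> (d \<odot> x) = (c * d) \<odot> x"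
  using smult_assoc1[of c d x] by (simp add: complex_field_def)

lemma smult_add_left: "x \<in> carrier A \<Longrightarrow> (c + d) \<odot> x = c \<odot> x \<oplus> d \<odot> x"
  using smult_l_distr[of c d x] by (simp add: complex_field_def)

lemma smult_add_right:
  "\<lbrakk>x \<in> carrier A; y \<in> carrier A\<rbrakk> \<Longrightarrow> c \<odot> (x \<oplus> y) = c \<odot> x \<oplus> c \<odot> y"
  using smult_r_distr[of c x y] by (simp add: complex_field_def)

lemma one_smult [simp]: "x \<in> carrier A \<Longrightarrow> 1 \<odot> x = x"
  using smult_one[of x] by (simp add: complex_field_def)

lemma zero_smult [simp]: "x \<in> carrier A \<Longrightarrow> 0 \<odot> x = \<zero>"
  using smult_l_null[of x] by (simp add: complex_field_def)

lemma smult_zero [simp]: "c \<odot> \<zero> = \<zero>"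
  using smult_r_null[of c] by (simp add: complex_field_def)

lemma minus_one_smult: "x \<in> carrier A \<Longrightarrow> (- 1) \<odot> x = \<ominus> x"
proof -
  assume x: "x \<in> carrier A"
  have "(- 1) \<odot> x \<oplus> 1 \<odot> x = \<zero>" using smult_add_left[OF x, of "-1" 1] x by simp
  then show ?thesis using x by (simp add: M.minus_equality)
qed

lemma uminus_smult: "x \<in> carrier A \<Longrightarrow> (- c) \<odot> x = \<ominus> (c \<odot> x)"
  using minus_one_smult[of "c \<odot> x"] by (simp add: smult_smult)

lemma smult_uminus: "x \<in> carrier A \<Longrightarrow> c \<odot> (\<ominus> x) = \<ominus> (c \<odot> x)"
  using smult_smult[of x c "- 1"] by (simp add: minus_one_smult uminus_smult)

lemma smult_diff_left: "x \<in> carrier A \<Longrightarrow> (c - d) \<odot> x = c \<odot> x \<ominus> d \<odot> x"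
  using smult_add_left[of x c "- d"] by (simp add: uminus_smult a_minus_def)

lemma smult_diff_right:
  "\<lbrakk>x \<in> carrier A; y \<in> carrier A\<rbrakk> \<Longrightarrow> c \<odot> (x \<ominus> y) = c \<odot> x \<ominus> c \<odot> y"
  by (simp add: a_minus_def smult_add_right smult_uminus)

lemma adj_zero [simp]: "\<zero>\<^sup>\<star> = \<zero>"
  using adj_smult[of \<zero> 0] by simp

lemma adj_minus: "x \<in> carrier A \<Longrightarrow> (\<ominus> x)\<^sup>\<star> = \<ominus> (x\<^sup>\<star>)"
  using adj_smult[of x "- 1"] by (simp add: minus_one_smult)

lemma adj_diff: "\<lbrakk>x \<in> carrier A; y \<in> carrier A\<rbrakk> \<Longrightarrow> (x \<ominus> y)\<^sup>\<star> = x\<^sup>\<star> \<ominus> y\<^sup>\<star>"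
  by (simp add: a_minus_def adj_add adj_minus)

lemma adj_finsum:
  assumes "finite I" "\<And>i. i \<in> I \<Longrightarrow> f i \<in> carrier A"
  shows "(\<Oplus>i\<in>I. f i)\<^sup>\<star> = (\<Oplus>i\<in>I. (f i)\<^sup>\<star>)"
  using assms by (induct I rule: finite_induct) (simp_all add: Pi_def adj_add)

lemma diff_eq_zero_iff: "\<lbrakk>x \<in> carrier A; y \<in> carrier A\<rbrakk> \<Longrightarrow> x \<ominus> y = \<zero> \<longleftrightarrow> x = y"
  by (simp add: A.r_right_minus_eq)

lemma diff_self [simp]: "x \<in> carrier A \<Longrightarrow> x \<ominus> x = \<zero>"
  by (simp add: a_minus_def M.r_neg)

lemma zero_diff [simp]: "x \<in> carrier A \<Longrightarrow> \<zero> \<ominus> x = \<ominus> x"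
  by (simp add: a_minus_def)

lemma mult_diff_distrib:
  assumes "x \<in> carrier A" "y \<in> carrier A" "z \<in> carrier A"
  shows "(x \<ominus> y) \<otimes> z = x \<otimes> z \<ominus> y \<otimes> z" "z \<otimes> (x \<ominus> y) = z \<otimes> x \<ominus> z \<otimes> y"
  using assms by algebra+


subsection \<open>The norm\<close>

lemma cnorm_zero [simp]: "cnorm A \<zero> = 0"
  by (simp add: cnorm_eq_0)

lemma cnorm_minus [simp]: "x \<in> carrier A \<Longrightarrow> cnorm A (\<ominus> x) = cnorm A x"
  using cnorm_smult[of x "- 1"] by (simp add: minus_one_smult)

lemma cnorm_diff_commute:
  "\<lbrakk>x \<in> carrier A; y \<in> carrier A\<rbrakk> \<Longrightarrow> cnorm A (x \<ominus> y) = cnorm A (y \<ominus> x)"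
  using cnorm_minus[of "x \<ominus> y"] by (simp add: a_minus_def M.minus_add M.a_comm)

lemma cnorm_triangle_diff:
  assumes "x \<in> carrier A" "y \<in> carrier A" "z \<in> carrier A"
  shows "cnorm A (x \<ominus> z) \<le> cnorm A (x \<ominus> y) + cnorm A (y \<ominus> z)"
proof -
  have "x \<ominus> z = (x \<ominus> y) \<oplus> (y \<ominus> z)" using assms by algebra
  then show ?thesis using cnorm_triangle[of "x \<ominus> y" "y \<ominus> z"] assms by simp
qed

lemma cnorm_diff_triangle:
  assumes "x \<in> carrier A" "y \<in> carrier A"
  shows "cnorm A (x \<ominus> y) \<le> cnorm A x + cnorm A y"
  using cnorm_triangle[of x "\<ominus> y"] assms by (simp add: a_minus_def)

lemma cnorm_reverse_triangle:
  assumes "x \<in> carrier A" "y \<in> carrier A"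
  shows "cnorm A x \<le> cnorm A y + cnorm A (x \<ominus> y)"
proof -
  have "x = y \<oplus> (x \<ominus> y)" using assms by algebra
  then show ?thesis using cnorm_triangle[of y "x \<ominus> y"] assms by simp
qed

lemma cnorm_finsum_le:
  assumes "finite I" "\<And>i. i \<in> I \<Longrightarrow> f i \<in> carrier A"
  shows "cnorm A (\<Oplus>i\<in>I. f i) \<le> (\<Sum>i\<in>I. cnorm A (f i))"
  using assms
proof (induct I rule: finite_induct)
  case (insert i I)
  then have "cnorm A (f i \<oplus> (\<Oplus>i\<in>I. f i)) \<le> cnorm A (f i) + (\<Sum>i\<in>I. cnorm A (f i))"
    by (intro order_trans[OF cnorm_triangle]) auto
  with insert show ?case by (simp add: Pi_def)
qed simp

lemma cnorm_adj [simp]: "x \<in> carrier A \<Longrightarrow> cnorm A (x\<^sup>\<star>) = cnorm A x"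
proof -
  have le: "cnorm A x \<le> cnorm A (x\<^sup>\<star>)" if x: "x \<in> carrier A" for x
  proof (cases "cnorm A x = 0")
    case False
    have "(cnorm A x)\<^sup>2 \<le> cnorm A (x\<^sup>\<star>) * cnorm A x"
      using cstar_identity[OF x] cnorm_mult[of "x\<^sup>\<star>" x] x by simp
    then show ?thesis using False cnorm_nonneg[OF x] by (simp add: power2_eq_square)
  qed (simp add: x cnorm_nonneg)
  assume "x \<in> carrier A"
  then show ?thesis using le[of x] le[of "x\<^sup>\<star>"] by simp
qed

lemma adj_mult_self_eq_zero: "\<lbrakk>x \<in> carrier A; x\<^sup>\<star> \<otimes> x = \<zero>\<rbrakk> \<Longrightarrow> x = \<zero>"
  using cstar_identity[of x] by (simp add: cnorm_eq_0)

lemma eq_zero_if_arbitrarily_small: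
  assumes "x \<in> carrier A" "\<And>\<epsilon>. \<epsilon> > 0 \<Longrightarrow> cnorm A x \<le> C * \<epsilon>"
  shows "x = \<zero>"
proof (rule ccontr)
  assume "x \<noteq> \<zero>"
  then have pos: "cnorm A x > 0" using assms(1) cnorm_nonneg[of x] cnorm_eq_0[of x] by linarith
  have "cnorm A x \<le> C * (cnorm A x / (2 * (\<bar>C\<bar> + 1)))"
    by (rule assms(2)) (use pos in simp)
  also have "\<dots> \<le> (\<bar>C\<bar> + 1) * (cnorm A x / (2 * (\<bar>C\<bar> + 1)))"
    by (rule mult_right_mono) (use pos in auto)
  also have "\<dots> = cnorm A x / 2" by (simp add: field_simps)
  finally show False using pos by simp
qed


subsection \<open>Projections and unitaries\<close>

lemma projectionsD:
  assumes "p \<in> projections A"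
  shows "p \<in> carrier A" "p\<^sup>\<star> = p" "p \<otimes> p = p"
  using assms by (auto simp: projections_def)

lemma cnorm_projection:
  assumes "p \<in> projections A"
  shows "cnorm A p = 0 \<or> cnorm A p = 1"
  using cstar_identity[of p] projectionsD[OF assms] by (auto simp: power2_eq_square)

lemma cnorm_projection_le:
  assumes "p \<in> projections A"
  shows "cnorm A p \<le> 1"
  using cnorm_projection[OF assms] by auto

lemma projection_eq_zero:
  assumes "p \<in> projections A" "cnorm A p < 1"
  shows "p = \<zero>"
  using cnorm_projection[OF assms(1)] assms(2) cnorm_eq_0[OF projectionsD(1)[OF assms(1)]] by auto

lemma cnorm_partial_isometry_le:
  assumes "v \<in> carrier A" "v\<^sup>\<star> \<otimes> v \<in> projections A"
  shows "cnorm A v \<le> 1"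
proof -
  have "(cnorm A v)\<^sup>2 \<le> 1"
    using cnorm_projection_le[OF assms(2)] cstar_identity[OF assms(1)] by simp
  then show ?thesis using power2_le_imp_le[of "cnorm A v" 1] by simp
qed

lemma one_projection: "\<one> \<in> projections A"
  by (simp add: projections_def)

lemma partial_isometry_mult_initial:
  assumes v: "v \<in> carrier A" and p: "v\<^sup>\<star> \<otimes> v = p" "p \<in> projections A"
  shows "v \<otimes> p = v"
proof -
  note c = projectionsD[OF p(2)]
  let ?x = "v \<ominus> v \<otimes> p"
  have "v\<^sup>\<star> \<otimes> (v \<otimes> p) = (v\<^sup>\<star> \<otimes> v) \<otimes> p" by (rule m_assoc[symmetric]) (use v c in auto)
  then have "v\<^sup>\<star> \<otimes> (v \<otimes> p) = p" unfolding p(1) c(3) .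
  then have 0: "v\<^sup>\<star> \<otimes> ?x = \<zero>" using v c(1) p(1) by (simp add: mult_diff_distrib)
  have "?x\<^sup>\<star> \<otimes> ?x = (v\<^sup>\<star> \<ominus> p \<otimes> v\<^sup>\<star>) \<otimes> ?x"
    using v c by (simp add: adj_diff adj_mult)
  also have "\<dots> = v\<^sup>\<star> \<otimes> ?x \<ominus> p \<otimes> (v\<^sup>\<star> \<otimes> ?x)"
    using v c(1) by (simp only: mult_diff_distrib(1) m_assoc adj_closed m_closed M.minus_closed)
  also have "\<dots> = \<zero>" unfolding 0 using c(1) by simp
  finally have "?x = \<zero>" by (rule adj_mult_self_eq_zero[rotated]) (use v c(1) in simp)
  then show ?thesis using v c(1) by (simp add: diff_eq_zero_iff)
qed

lemma projection_diff:
  assumes p: "p \<in> projections A" and q: "q \<in> projections A" and pq: "p \<otimes> q = q" "q \<otimes> p = q"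
  shows "p \<ominus> q \<in> projections A"
proof -
  note c = projectionsD[OF p] projectionsD[OF q]
  have "(p \<ominus> q) \<otimes> (p \<ominus> q) = (p \<otimes> p \<ominus> p \<otimes> q) \<ominus> (q \<otimes> p \<ominus> q \<otimes> q)" using c(1,4) by algebra
  also have "\<dots> = p \<ominus> q" using c pq by (simp add: a_minus_def M.r_neg)
  finally show ?thesis using c by (simp add: projections_def adj_diff)
qed

lemma projection_mult:
  assumes p: "p \<in> projections A" and q: "q \<in> projections A" and pq: "p \<otimes> q = q \<otimes> p"
  shows "p \<otimes> q \<in> projections A"
proof -
  note c = projectionsD[OF p] projectionsD[OF q]
  have "p \<otimes> q \<otimes> (p \<otimes> q) = p \<otimes> (q \<otimes> p) \<otimes> q" using c(1,4) by (simp add: m_assoc)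
  also have "\<dots> = (p \<otimes> p) \<otimes> (q \<otimes> q)" unfolding pq[symmetric] using c(1,4) by (simp add: m_assoc)
  finally have "p \<otimes> q \<otimes> (p \<otimes> q) = p \<otimes> q" unfolding c(3,6) .
  moreover have "(p \<otimes> q)\<^sup>\<star> = p \<otimes> q" unfolding adj_mult[OF c(1,4)] c(2,5) by (rule pq[symmetric])
  ultimately show ?thesis using m_closed[OF c(1,4)] unfolding projections_def by blast
qed

text \<open>Distinct commuting projections are at distance 1: \<open>p - p q\<close> is a projection, and it equals
  \<open>p (p - q)\<close>.\<close>
lemma commuting_projections_close:
  assumes p: "p \<in> projections A" and q: "q \<in> projections A" and pq: "p \<otimes> q = q \<otimes> p"
    and close: "cnorm A (p \<ominus> q) < 1"
  shows "p = q"
proof -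
  have half: "p = p \<otimes> q"
    if p: "p \<in> projections A" and q: "q \<in> projections A" and pq: "p \<otimes> q = q \<otimes> p"
      and close: "cnorm A (p \<ominus> q) < 1" for p q
  proof -
    note c = projectionsD[OF p] projectionsD[OF q]
    have 1: "p \<otimes> (p \<ominus> q) = p \<ominus> p \<otimes> q" using c by (simp add: mult_diff_distrib)
    have 2: "p \<otimes> (p \<otimes> q) = p \<otimes> q" using m_assoc[OF c(1,1,4)] unfolding c(3) by simp
    moreover have "p \<otimes> q \<otimes> p = p \<otimes> q" unfolding m_assoc[OF c(1,4,1)] pq[symmetric] by (rule 2)
    ultimately have "p \<ominus> p \<otimes> q \<in> projections A"
      by (intro projection_diff p projection_mult q pq)
    moreover have "cnorm A (p \<ominus> p \<otimes> q) < 1"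
      using cnorm_mult[of p "p \<ominus> q"] c 1 cnorm_projection_le[OF p] close
        mult_mono[of "cnorm A p" 1 "cnorm A (p \<ominus> q)" "cnorm A (p \<ominus> q)"] cnorm_nonneg[of "p \<ominus> q"]
      by simp
    ultimately have "p \<ominus> p \<otimes> q = \<zero>" by (rule projection_eq_zero)
    then show ?thesis using diff_eq_zero_iff[of p "p \<otimes> q"] c(1,4) by blast
  qed
  show ?thesis
    using half[OF p q pq close] half[OF q p pq[symmetric]] pq close
      cnorm_diff_commute[OF projectionsD(1)[OF p] projectionsD(1)[OF q]] by metis
qed

text \<open>The spectrum of a projection below \<open>p\<close>, taken in the corner of \<open>p\<close>, is contained in \<open>{0, 1}\<close>,
  and it is all of \<open>{0, 1}\<close> unless the projection is 0 or \<open>p\<close>; no scalar has distance below \<open>1/2\<close>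
  from both points.\<close>
lemma projection_near_scalar:
  assumes p: "p \<in> projections A" and r: "r \<in> projections A" and rp: "r \<otimes> p = r" "p \<otimes> r = r"
    and close: "cnorm A (r \<ominus> c \<odot> p) < 1 / 2"
  shows "r = \<zero> \<or> r = p"
proof (rule ccontr)
  assume neg: "\<not> ?thesis"
  note c = projectionsD[OF p] projectionsD[OF r]
  have x: "r \<ominus> c \<odot> p \<in> carrier A" using c by simp
  have le: "cnorm A (s \<otimes> (r \<ominus> c \<odot> p)) < 1 / 2" if s: "s \<in> projections A" for s
    using cnorm_mult[OF projectionsD(1)[OF s] x] cnorm_projection_le[OF s] close
      mult_right_mono[of "cnorm A s" 1 "cnorm A (r \<ominus> c \<odot> p)"] cnorm_nonneg[OF x] by simp
  have "r \<otimes> (r \<ominus> c \<odot> p) = (1 - c) \<odot> r"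
    using c rp by (simp add: mult_diff_distrib smult_mult_r smult_diff_left)
  moreover have "cnorm A r = 1" using cnorm_projection[OF r] cnorm_eq_0[of r] c neg by auto
  ultimately have 1: "cmod (1 - c) < 1 / 2" using le[OF r] c by (simp add: cnorm_smult)
  have pr: "p \<ominus> r \<in> projections A" using p r rp by (intro projection_diff) auto
  have sr: "(p \<ominus> r) \<otimes> r = \<zero>" and sp: "(p \<ominus> r) \<otimes> p = p \<ominus> r"
    using c(1,3,4,6) rp by (simp_all add: mult_diff_distrib(1))
  have "(p \<ominus> r) \<otimes> (r \<ominus> c \<odot> p) = (p \<ominus> r) \<otimes> r \<ominus> c \<odot> ((p \<ominus> r) \<otimes> p)"
    using c(1,4) by (simp add: mult_diff_distrib(2) smult_mult_r)
  also have "\<dots> = \<ominus> (c \<odot> (p \<ominus> r))" unfolding sr sp using c(1,4) by simp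
  finally have "cnorm A (\<ominus> (c \<odot> (p \<ominus> r))) < 1 / 2" using le[OF pr] by (simp only:)
  then have 2: "cnorm A (c \<odot> (p \<ominus> r)) < 1 / 2" using c(1,4) by simp
  have "cnorm A (p \<ominus> r) = 1"
    using cnorm_projection[OF pr] cnorm_eq_0[of "p \<ominus> r"] diff_eq_zero_iff[of p r] c neg by auto
  then have "cmod c < 1 / 2" using 2 c by (simp add: cnorm_smult)
  then show False using 1 norm_triangle_ineq[of "1 - c" c] by simp
qed

lemma add_diff_cancel_right: "\<lbrakk>x \<in> carrier A; y \<in> carrier A\<rbrakk> \<Longrightarrow> (x \<oplus> y) \<ominus> y = x"
  by (simp add: a_minus_def M.a_assoc M.r_neg)

lemma smult_cancel:
  assumes "x \<in> carrier A" "x \<noteq> \<zero>" "c \<odot> x = d \<odot> x"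
  shows "c = d"
proof -
  have "(c - d) \<odot> x = \<zero>" using assms(1,3) by (simp add: smult_diff_left)
  then have "cmod (c - d) * cnorm A x = 0" using cnorm_smult[OF assms(1), of "c - d"] by simp
  then show ?thesis using assms(2) cnorm_eq_0[OF assms(1)] by simp
qed

lemma cnorm_compress_le:
  assumes "p \<in> projections A" "q \<in> projections A" "x \<in> carrier A"
  shows "cnorm A (p \<otimes> x \<otimes> q) \<le> cnorm A x"
proof -
  note c = projectionsD(1)[OF assms(1)] projectionsD(1)[OF assms(2)] assms(3)
  have "cnorm A (p \<otimes> x \<otimes> q) \<le> cnorm A p * cnorm A x * cnorm A q"
    using cnorm_mult[of "p \<otimes> x" q] cnorm_mult[of p x] c cnorm_nonneg[of q]
      mult_right_mono[of "cnorm A (p \<otimes> x)" "cnorm A p * cnorm A x" "cnorm A q"] by simp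
  also have "\<dots> \<le> 1 * cnorm A x * 1"
    by (intro mult_mono) (use cnorm_projection_le assms c cnorm_nonneg in auto)
  finally show ?thesis by simp
qed

lemma cnorm_mult_diff_le:
  assumes c: "x \<in> carrier A" "x' \<in> carrier A" "y \<in> carrier A" "y' \<in> carrier A"
  shows "cnorm A (x \<otimes> y \<ominus> x' \<otimes> y')
    \<le> cnorm A x * cnorm A (y \<ominus> y') + cnorm A (x \<ominus> x') * cnorm A y'"
proof -
  have "cnorm A (x \<otimes> y \<ominus> x' \<otimes> y')
      \<le> cnorm A (x \<otimes> y \<ominus> x \<otimes> y') + cnorm A (x \<otimes> y' \<ominus> x' \<otimes> y')"
    by (rule cnorm_triangle_diff) (use c in auto)
  also have "x \<otimes> y \<ominus> x \<otimes> y' = x \<otimes> (y \<ominus> y')" using c by (simp add: mult_diff_distrib(2))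
  also have "x \<otimes> y' \<ominus> x' \<otimes> y' = (x \<ominus> x') \<otimes> y'" using c by (simp add: mult_diff_distrib(1))
  also have "cnorm A (x \<otimes> (y \<ominus> y')) + cnorm A ((x \<ominus> x') \<otimes> y')
      \<le> cnorm A x * cnorm A (y \<ominus> y') + cnorm A (x \<ominus> x') * cnorm A y'"
    by (intro add_mono cnorm_mult) (use c in auto)
  finally show ?thesis .
qed

text \<open>The bound is \<open>1/8 + 9/8 \<cdot> 1/8\<close>, where \<open>9/8\<close> bounds the norm of \<open>m\<close>.\<close>
lemma conjugates_close:
  assumes z: "z \<in> carrier A" "cnorm A z \<le> 1" and m: "m \<in> carrier A" "cnorm A (z \<ominus> m) < 1 / 8"
    and q: "q \<in> projections A"
  shows "cnorm A (z \<otimes> q \<otimes> z\<^sup>\<star> \<ominus> m \<otimes> q \<otimes> m\<^sup>\<star>) \<le> 17 / 64"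
proof -
  note c = z(1) m(1) projectionsD(1)[OF q]
  have q1: "cnorm A q \<le> 1" by (rule cnorm_projection_le[OF q])
  have mn: "cnorm A m \<le> 9 / 8"
    using cnorm_reverse_triangle[of m z] cnorm_diff_commute[of z m] c z(2) m(2) by simp
  have zq: "cnorm A (z \<otimes> q) \<le> 1"
    using cnorm_mult[of z q] mult_mono[OF z(2) q1] c cnorm_nonneg by fastforce
  have "z \<otimes> q \<ominus> m \<otimes> q = (z \<ominus> m) \<otimes> q" using c by (simp add: mult_diff_distrib)
  then have zmq: "cnorm A (z \<otimes> q \<ominus> m \<otimes> q) \<le> 1 / 8"
    using cnorm_mult[of "z \<ominus> m" q] mult_mono[OF less_imp_le[OF m(2)] q1] c cnorm_nonneg by fastforce
  have zm: "cnorm A (z\<^sup>\<star> \<ominus> m\<^sup>\<star>) \<le> 1 / 8"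
    using cnorm_adj[of "z \<ominus> m"] c m(2) by (simp add: adj_diff)
  have "cnorm A (z \<otimes> q \<otimes> z\<^sup>\<star> \<ominus> m \<otimes> q \<otimes> m\<^sup>\<star>)
      \<le> cnorm A (z \<otimes> q) * cnorm A (z\<^sup>\<star> \<ominus> m\<^sup>\<star>) + cnorm A (z \<otimes> q \<ominus> m \<otimes> q) * cnorm A (m\<^sup>\<star>)"
    by (rule cnorm_mult_diff_le) (use c in auto)
  also have "\<dots> \<le> 1 * (1 / 8) + (1 / 8) * (9 / 8)"
    by (intro add_mono mult_mono zq zm zmq) (use mn c cnorm_nonneg in auto)
  finally show ?thesis by simp
qed

subsection \<open>Closures\<close>

definition approximable :: "'a set \<Rightarrow> 'a set" where
  "approximable B = {x \<in> carrier A. \<forall>\<epsilon>>0. \<exists>y\<in>B. cnorm A (x \<ominus> y) < \<epsilon>}"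

lemma approximableD:
  assumes "x \<in> approximable B" "\<epsilon> > 0"
  obtains y where "y \<in> B" "cnorm A (x \<ominus> y) < \<epsilon>"
  using assms by (auto simp: approximable_def)

lemma approximableI:
  assumes "x \<in> carrier A" "0 \<le> C" "\<And>\<epsilon>. \<epsilon> > 0 \<Longrightarrow> \<exists>y\<in>B. cnorm A (x \<ominus> y) \<le> C * \<epsilon>"
  shows "x \<in> approximable B"
  unfolding approximable_def
proof (intro CollectI conjI allI impI)
  fix \<epsilon> :: real assume \<epsilon>: "\<epsilon> > 0"
  then obtain y where y: "y \<in> B" "cnorm A (x \<ominus> y) \<le> C * (\<epsilon> / (C + 1))"
    using assms(3)[of "\<epsilon> / (C + 1)"] assms(2) by auto
  have "C * (\<epsilon> / (C + 1)) < \<epsilon>" using \<epsilon> assms(2) by (simp add: field_simps)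
  then show "\<exists>y\<in>B. cnorm A (x \<ominus> y) < \<epsilon>" using y by force
qed (rule assms(1))

lemma closedin_if_approximable_subset:
  assumes "B \<subseteq> carrier A" "approximable B \<subseteq> B"
  shows "closedin (Metric_space.mtopology (carrier A) (cmetric A)) B"
proof -
  interpret Metric_space "carrier A" "cmetric A" by (rule metric_space)
  have "\<exists>r>0. disjnt B (mball x r)" if "x \<in> carrier A - B" for x
  proof -
    have xA: "x \<in> carrier A" using that by simp
    have "x \<notin> approximable B" using that assms(2) by blast
    then obtain r where r: "r > 0" "\<forall>y\<in>B. \<not> cnorm A (x \<ominus> y) < r"
      using xA unfolding approximable_def by blast
    then have "disjnt B (mball x r)" by (auto simp: disjnt_iff cmetric_def)
    then show ?thesis using r(1) by blast
  qed
  then show ?thesis using assms(1) by (simp add: closedin_metric)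
qed

lemma approximable_idem:
  assumes "B \<subseteq> carrier A"
  shows "approximable (approximable B) \<subseteq> approximable B"
proof
  fix x assume x: "x \<in> approximable (approximable B)"
  then have xc: "x \<in> carrier A" by (simp add: approximable_def)
  show "x \<in> approximable B"
  proof (rule approximableI[of _ 2])
    fix \<epsilon> :: real assume "\<epsilon> > 0"
    obtain y where y: "y \<in> approximable B" "cnorm A (x \<ominus> y) < \<epsilon>"
      using approximableD[OF x \<open>\<epsilon> > 0\<close>] .
    obtain z where z: "z \<in> B" "cnorm A (y \<ominus> z) < \<epsilon>" using approximableD[OF y(1) \<open>\<epsilon> > 0\<close>] .
    have "cnorm A (x \<ominus> z) \<le> cnorm A (x \<ominus> y) + cnorm A (y \<ominus> z)"
      by (rule cnorm_triangle_diff) (use xc y z assms in \<open>auto simp: approximable_def\<close>)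
    with y z show "\<exists>z\<in>B. cnorm A (x \<ominus> z) \<le> 2 * \<epsilon>" by (intro bexI[of _ z]) auto
  qed (use xc in auto)
qed

lemma closed_star_subalgebra_approximable:
  assumes B: "B \<subseteq> carrier A" "\<zero> \<in> B"
    and add: "\<And>x y. \<lbrakk>x \<in> B; y \<in> B\<rbrakk> \<Longrightarrow> x \<oplus> y \<in> B"
    and mult: "\<And>x y. \<lbrakk>x \<in> B; y \<in> B\<rbrakk> \<Longrightarrow> x \<otimes> y \<in> B"
    and smult: "\<And>c x. x \<in> B \<Longrightarrow> c \<odot> x \<in> B"
    and star: "\<And>x. x \<in> B \<Longrightarrow> x\<^sup>\<star> \<in> B"
  shows "closed_star_subalgebra A (approximable B)"
  unfolding closed_star_subalgebra_def
proof (intro conjI ballI allI)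
  note BA = subsetD[OF B(1)]
  have appA: "x \<in> carrier A" if "x \<in> approximable B" for x
    using that by (simp add: approximable_def)
  then show "approximable B \<subseteq> carrier A" by blast
  show "\<zero> \<in> approximable B" using B(2) by (auto simp: approximable_def intro!: bexI[of _ \<zero>])
  show "closedin (Metric_space.mtopology (carrier A) (cmetric A)) (approximable B)"
    by (rule closedin_if_approximable_subset) (auto simp: appA approximable_idem[OF B(1)])
  fix x assume x: "x \<in> approximable B"
  note xA = appA[OF x]
  show "x\<^sup>\<star> \<in> approximable B"
  proof (rule approximableI[of _ 1])
    fix \<epsilon> :: real assume "\<epsilon> > 0"
    obtain y where y: "y \<in> B" "cnorm A (x \<ominus> y) < \<epsilon>" using approximableD[OF x \<open>\<epsilon> > 0\<close>] .
    then show "\<exists>z\<in>B. cnorm A (x\<^sup>\<star> \<ominus> z) \<le> 1 * \<epsilon>"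
      using xA cnorm_adj[of "x \<ominus> y"]
      by (intro bexI[of _ "y\<^sup>\<star>"]) (auto simp: adj_diff BA star)
  qed (use xA in auto)
  fix c
  show "c \<odot> x \<in> approximable B"
  proof (rule approximableI[of _ "cmod c"])
    fix \<epsilon> :: real assume "\<epsilon> > 0"
    obtain y where y: "y \<in> B" "cnorm A (x \<ominus> y) < \<epsilon>" using approximableD[OF x \<open>\<epsilon> > 0\<close>] .
    have "cnorm A (c \<odot> x \<ominus> c \<odot> y) = cmod c * cnorm A (x \<ominus> y)"
      using xA BA[OF y(1)] by (simp flip: smult_diff_right add: cnorm_smult)
    then show "\<exists>z\<in>B. cnorm A (c \<odot> x \<ominus> z) \<le> cmod c * \<epsilon>"
      using y by (intro bexI[of _ "c \<odot> y"]) (auto simp: smult intro: mult_left_mono)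
  qed (use xA in auto)
next
  note BA = subsetD[OF B(1)]
  fix x y assume x: "x \<in> approximable B" and y: "y \<in> approximable B"
  then have A: "x \<in> carrier A" "y \<in> carrier A" by (auto simp: approximable_def)
  show "x \<oplus> y \<in> approximable B"
  proof (rule approximableI[of _ 2])
    fix \<epsilon> :: real assume "\<epsilon> > 0"
    obtain x' where x': "x' \<in> B" "cnorm A (x \<ominus> x') < \<epsilon>" using approximableD[OF x \<open>\<epsilon> > 0\<close>] .
    obtain y' where y': "y' \<in> B" "cnorm A (y \<ominus> y') < \<epsilon>" using approximableD[OF y \<open>\<epsilon> > 0\<close>] .
    note c = A BA[OF x'(1)] BA[OF y'(1)]
    have "(x \<oplus> y) \<ominus> (x' \<oplus> y') = (x \<ominus> x') \<oplus> (y \<ominus> y')" using c by algebra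
    then have "cnorm A ((x \<oplus> y) \<ominus> (x' \<oplus> y')) \<le> 2 * \<epsilon>"
      using cnorm_triangle[of "x \<ominus> x'" "y \<ominus> y'"] c x' y' by simp
    then show "\<exists>z\<in>B. cnorm A ((x \<oplus> y) \<ominus> z) \<le> 2 * \<epsilon>" using x' y' add by blast
  qed (use A in auto)
  show "x \<otimes> y \<in> approximable B"
  proof (rule approximableI[of _ "cnorm A x + cnorm A y + 1"])
    fix \<epsilon> :: real assume \<epsilon>: "\<epsilon> > 0"
    define \<delta> where "\<delta> = min \<epsilon> 1"
    have \<delta>: "\<delta> > 0" "\<delta> \<le> \<epsilon>" "\<delta> \<le> 1" using \<epsilon> by (auto simp: \<delta>_def)
    obtain x' where x': "x' \<in> B" "cnorm A (x \<ominus> x') < \<delta>" using approximableD[OF x \<delta>(1)] .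
    obtain y' where y': "y' \<in> B" "cnorm A (y \<ominus> y') < \<delta>" using approximableD[OF y \<delta>(1)] .
    note c = A BA[OF x'(1)] BA[OF y'(1)]
    have "cnorm A y' \<le> cnorm A y + 1"
      using cnorm_reverse_triangle[of y' y] cnorm_diff_commute[of y y'] c y' \<delta> by simp
    then have "cnorm A x * cnorm A (y \<ominus> y') + cnorm A (x \<ominus> x') * cnorm A y'
        \<le> cnorm A x * \<epsilon> + \<epsilon> * (cnorm A y + 1)"
      by (intro add_mono mult_mono) (use x' y' \<delta> c \<epsilon> in \<open>auto intro: cnorm_nonneg\<close>)
    then have "cnorm A (x \<otimes> y \<ominus> x' \<otimes> y') \<le> (cnorm A x + cnorm A y + 1) * \<epsilon>"
      using cnorm_mult_diff_le[of x x' y y'] c by (simp add: algebra_simps)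
    then show "\<exists>z\<in>B. cnorm A ((x \<otimes> y) \<ominus> z) \<le> (cnorm A x + cnorm A y + 1) * \<epsilon>"
      using x' y' mult by blast
  qed (use A in \<open>auto simp: cnorm_nonneg\<close>)
qed


subsection \<open>Unital endomorphisms are contractive\<close>

text \<open>The element \<open>b = \<surd>(1 - a\<^sup>2)\<close> without functional calculus: write \<open>b = 1 - y\<close>; then
  \<open>y\<close> is a fixed point of \<open>F y = (a\<^sup>2 + y\<^sup>2) / 2\<close>, which is a contraction on a small ball.\<close>
lemma exists_complementary_square:
  assumes a: "a \<in> carrier A" "a\<^sup>\<star> = a" "cnorm A a < 1"
  obtains b where "b \<in> carrier A" "b\<^sup>\<star> = b" "a \<otimes> b = b \<otimes> a" "a \<otimes> a \<oplus> b \<otimes> b = \<one>"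
proof -
  define s where "s = (cnorm A a)\<^sup>2"
  \<comment> \<open>The fixed point of \<open>t \<mapsto> (s + t\<^sup>2) / 2\<close>; it is the radius of the ball and the contraction factor.\<close>
  define \<rho> where "\<rho> = 1 - sqrt (1 - s)"
  have s: "0 \<le> s" "s < 1" using a cnorm_nonneg[of a] by (auto simp: s_def power_less_one_iff)
  then have \<rho>: "\<rho> < 1" "0 \<le> \<rho>" by (auto simp: \<rho>_def)
  have "(1 - \<rho>)\<^sup>2 = 1 - s" using s by (simp add: \<rho>_def)
  then have fix_\<rho>: "s + \<rho> * \<rho> = 2 * \<rho>" by (simp add: power2_eq_square algebra_simps)
  have aa: "cnorm A (a \<otimes> a) = s" using cstar_identity[of a] a by (simp add: s_def)
  define M where "M = {y \<in> carrier A. y\<^sup>\<star> = y \<and> a \<otimes> y = y \<otimes> a \<and> cnorm A y \<le> \<rho>}"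
  define F where "F y = (1/2) \<odot> (a \<otimes> a \<oplus> y \<otimes> y)" for y
  have MA: "M \<subseteq> carrier A" by (auto simp: M_def)
  have FM: "F y \<in> M" if "y \<in> M" for y
  proof -
    from that have y: "y \<in> carrier A" "y\<^sup>\<star> = y" and comm: "a \<otimes> y = y \<otimes> a" and le: "cnorm A y \<le> \<rho>"
      by (auto simp: M_def)
    have "a \<otimes> (y \<otimes> y) = y \<otimes> y \<otimes> a"
    proof -
      have "a \<otimes> (y \<otimes> y) = a \<otimes> y \<otimes> y" using a y by (simp add: m_assoc)
      also have "\<dots> = y \<otimes> (a \<otimes> y)" unfolding comm using a(1) y(1) by (simp add: m_assoc comm)
      also have "\<dots> = y \<otimes> y \<otimes> a" unfolding comm using a(1) y(1) m_assoc[of y y a] by simp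
      finally show ?thesis .
    qed
    then have "a \<otimes> F y = F y \<otimes> a"
      using a(1) y(1) by (simp add: F_def smult_mult_l smult_mult_r mult_distr_l mult_distr_r m_assoc)
    moreover have "(F y)\<^sup>\<star> = F y"
      using a y by (simp add: F_def adj_smult adj_add adj_mult)
    moreover have "cnorm A (F y) \<le> \<rho>"
    proof -
      have "cnorm A (a \<otimes> a \<oplus> y \<otimes> y) \<le> s + cnorm A y * cnorm A y"
        using cnorm_triangle[of "a \<otimes> a" "y \<otimes> y"] cnorm_mult[of y y] a y aa by simp
      also have "\<dots> \<le> s + \<rho> * \<rho>"
        by (intro add_left_mono mult_mono le \<rho> cnorm_nonneg y)
      finally show ?thesis using fix_\<rho> a y by (simp add: F_def cnorm_smult)
    qed
    ultimately show ?thesis using a y by (simp add: M_def F_def)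
  qed
  interpret Submetric "carrier A" "cmetric A" M
    using metric_space MA by (simp add: Submetric_def Submetric_axioms_def)
  have "approximable M \<subseteq> M"
  proof
    fix x assume x: "x \<in> approximable M"
    then have xA: "x \<in> carrier A" by (simp add: approximable_def)
    have 1: "x\<^sup>\<star> \<ominus> x = \<zero>"
    proof (rule eq_zero_if_arbitrarily_small[of _ 2])
      fix \<epsilon> :: real assume "\<epsilon> > 0"
      obtain y where y: "y \<in> M" "cnorm A (x \<ominus> y) < \<epsilon>" using approximableD[OF x \<open>\<epsilon> > 0\<close>] .
      then have c: "y \<in> carrier A" "y\<^sup>\<star> = y" by (auto simp: M_def)
      have "cnorm A (x\<^sup>\<star> \<ominus> x) \<le> cnorm A (x\<^sup>\<star> \<ominus> y) + cnorm A (y \<ominus> x)"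
        by (rule cnorm_triangle_diff) (use c xA in auto)
      also have "cnorm A (x\<^sup>\<star> \<ominus> y) = cnorm A (x \<ominus> y)"
        using cnorm_adj[of "x \<ominus> y"] c xA by (simp add: adj_diff)
      finally show "cnorm A (x\<^sup>\<star> \<ominus> x) \<le> 2 * \<epsilon>" using y cnorm_diff_commute[OF xA c(1)] by simp
    qed (use xA in simp)
    have 2: "a \<otimes> x \<ominus> x \<otimes> a = \<zero>"
    proof (rule eq_zero_if_arbitrarily_small[of _ 2])
      fix \<epsilon> :: real assume "\<epsilon> > 0"
      obtain y where y: "y \<in> M" "cnorm A (x \<ominus> y) < \<epsilon>" using approximableD[OF x \<open>\<epsilon> > 0\<close>] .
      then have c: "y \<in> carrier A" "a \<otimes> y = y \<otimes> a" by (auto simp: M_def)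
      have "cnorm A (a \<otimes> x \<ominus> x \<otimes> a) \<le> cnorm A (a \<otimes> x \<ominus> a \<otimes> y) + cnorm A (a \<otimes> y \<ominus> x \<otimes> a)"
        by (rule cnorm_triangle_diff) (use c a xA in auto)
      also have "\<dots> = cnorm A (a \<otimes> (x \<ominus> y)) + cnorm A ((y \<ominus> x) \<otimes> a)"
        using c(1) a(1) xA by (simp add: mult_diff_distrib c(2))
      also have "\<dots> \<le> cnorm A a * cnorm A (x \<ominus> y) + cnorm A (y \<ominus> x) * cnorm A a"
        by (intro add_mono cnorm_mult) (use c a xA in auto)
      also have "\<dots> \<le> 1 * \<epsilon> + \<epsilon> * 1"
        using y cnorm_diff_commute[OF xA c(1)] a \<open>\<epsilon> > 0\<close>
        by (intro add_mono mult_mono cnorm_nonneg) (use c xA in auto)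
      finally show "cnorm A (a \<otimes> x \<ominus> x \<otimes> a) \<le> 2 * \<epsilon>" by simp
    qed (use xA a in simp)
    have 3: "cnorm A x \<le> \<rho>"
    proof (rule field_le_epsilon)
      fix \<epsilon> :: real assume "\<epsilon> > 0"
      obtain y where y: "y \<in> M" "cnorm A (x \<ominus> y) < \<epsilon>" using approximableD[OF x \<open>\<epsilon> > 0\<close>] .
      then show "cnorm A x \<le> \<rho> + \<epsilon>" using cnorm_reverse_triangle[OF xA, of y] by (auto simp: M_def)
    qed
    show "x \<in> M" using 1 2 3 xA a by (simp add: M_def diff_eq_zero_iff)
  qed
  then have "sub.mcomplete"
    by (intro closedin_mcomplete_imp_mcomplete closedin_if_approximable_subset MA complete)
  moreover have "M \<noteq> {}"
    using a(1) \<rho> by (auto simp: M_def intro!: exI[of _ \<zero>])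
  moreover have "cmetric A (F x) (F y) \<le> \<rho> * cmetric A x y" if "x \<in> M" "y \<in> M" for x y
  proof -
    have c: "x \<in> carrier A" "y \<in> carrier A" and le: "cnorm A x \<le> \<rho>" "cnorm A y \<le> \<rho>"
      using that by (auto simp: M_def)
    have "F x \<ominus> F y = (1/2) \<odot> ((a \<otimes> a \<oplus> x \<otimes> x) \<ominus> (a \<otimes> a \<oplus> y \<otimes> y))"
      unfolding F_def using a c by (simp add: smult_diff_right)
    also have "(a \<otimes> a \<oplus> x \<otimes> x) \<ominus> (a \<otimes> a \<oplus> y \<otimes> y) = x \<otimes> x \<ominus> y \<otimes> y"
      using a(1) c by algebra
    finally have "cnorm A (F x \<ominus> F y) = cnorm A (x \<otimes> x \<ominus> y \<otimes> y) / 2"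
      using c by (simp add: cnorm_smult)
    moreover have "cnorm A x * cnorm A (x \<ominus> y) + cnorm A (x \<ominus> y) * cnorm A y
        \<le> \<rho> * cnorm A (x \<ominus> y) + cnorm A (x \<ominus> y) * \<rho>"
      by (intro add_mono mult_mono order_refl le cnorm_nonneg \<rho>) (use c in auto)
    ultimately show ?thesis
      using cnorm_mult_diff_le[of x y x y] c a by (simp add: cmetric_def F_def algebra_simps)
  qed
  moreover have "F \<in> M \<rightarrow> M" using FM by blast
  ultimately obtain y where yM: "y \<in> M" and fix_y: "F y = y"
    using sub.Banach_fixedpoint_thm[of F \<rho>] \<rho>(1) by blast
  from yM have y: "y \<in> carrier A" "y\<^sup>\<star> = y" and comm: "a \<otimes> y = y \<otimes> a" by (auto simp: M_def)
  have "2 \<odot> F y = a \<otimes> a \<oplus> y \<otimes> y" using a(1) y(1) by (simp add: F_def smult_smult)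
  moreover have "2 \<odot> y = y \<oplus> y" using smult_add_left[of y 1 1] y by simp
  ultimately have "a \<otimes> a \<oplus> y \<otimes> y = y \<oplus> y" unfolding fix_y by simp
  then have aay: "a \<otimes> a = y \<oplus> y \<ominus> y \<otimes> y"
    using a(1) y(1) M.add.inv_solve_right[of "a \<otimes> a" "y \<oplus> y" "y \<otimes> y"] by (simp add: a_minus_def)
  show thesis
  proof
    show "\<one> \<ominus> y \<in> carrier A" using y by simp
    show "(\<one> \<ominus> y)\<^sup>\<star> = \<one> \<ominus> y" using y by (simp add: adj_diff)
    show "a \<otimes> (\<one> \<ominus> y) = (\<one> \<ominus> y) \<otimes> a" using a y comm by (simp add: mult_diff_distrib)
    show "a \<otimes> a \<oplus> (\<one> \<ominus> y) \<otimes> (\<one> \<ominus> y) = \<one>"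
    proof -
      have "(\<one> \<ominus> y) \<otimes> (\<one> \<ominus> y) = \<one> \<ominus> y \<ominus> (y \<ominus> y \<otimes> y)"
        using y(1) by (simp add: mult_diff_distrib(1)) (simp add: mult_diff_distrib(2))
      moreover have "y \<oplus> y \<ominus> y \<otimes> y \<oplus> (\<one> \<ominus> y \<ominus> (y \<ominus> y \<otimes> y)) = \<one>" using y(1) by algebra
      ultimately show ?thesis unfolding aay by simp
    qed
  qed
qed

text \<open>A self-adjoint \<open>a\<close> of norm below 1 is the real part of the unitary
  \<open>a + i \<surd>(1 - a\<^sup>2)\<close>. Its image is the real part of a unitary too, hence of norm at most 1. The
  C*-identity reduces the general case to this one.\<close>
lemma unital_star_hom_contractive:
  assumes f: "f \<in> star_hom A A" and f1: "f \<one> = \<one>" and x: "x \<in> carrier A"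
  shows "cnorm A (f x) \<le> cnorm A x"
proof -
  have fc: "f x \<in> carrier A" if "x \<in> carrier A" for x using f that by (auto simp: star_hom_def)
  have hom: "f (x \<oplus> y) = f x \<oplus> f y" "f (x \<otimes> y) = f x \<otimes> f y" "f (c \<odot> x) = c \<odot> f x"
      "f (x\<^sup>\<star>) = (f x)\<^sup>\<star>"
    if "x \<in> carrier A" "y \<in> carrier A" for x y c
    using f that unfolding star_hom_def by blast+
  have le1: "cnorm A (f a) \<le> 1" if a: "a \<in> carrier A" "a\<^sup>\<star> = a" "cnorm A a < 1" for a
  proof -
    obtain b where b: "b \<in> carrier A" "b\<^sup>\<star> = b" "a \<otimes> b = b \<otimes> a" "a \<otimes> a \<oplus> b \<otimes> b = \<one>"
      using exists_complementary_square[OF a] .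
    define h where "h = f a"
    define k where "k = f b"
    have hk: "h \<in> carrier A" "k \<in> carrier A" "h\<^sup>\<star> = h" "k\<^sup>\<star> = k"
      using a b by (auto simp: h_def k_def fc simp flip: hom(4))
    have comm: "h \<otimes> k = k \<otimes> h"
      using b(3) hom(2)[OF a(1) b(1)] hom(2)[OF b(1) a(1)] by (simp add: h_def k_def)
    have sq: "h \<otimes> h \<oplus> k \<otimes> k = \<one>"
    proof -
      have "f (a \<otimes> a \<oplus> b \<otimes> b) = h \<otimes> h \<oplus> k \<otimes> k" using a b(1) by (simp add: h_def k_def hom)
      then show ?thesis unfolding b(4) f1 by simp
    qed
    define u where "u = h \<oplus> \<i> \<odot> k"
    have u: "u \<in> carrier A" "u\<^sup>\<star> = h \<oplus> (- \<i>) \<odot> k"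
      using hk by (simp_all add: u_def adj_add adj_smult)
    have "u\<^sup>\<star> \<otimes> u = h \<otimes> h \<oplus> \<i> \<odot> (h \<otimes> k) \<oplus> ((- \<i>) \<odot> (k \<otimes> h) \<oplus> k \<otimes> k)"
      unfolding u(2) unfolding u_def using hk(1,2)
      by (simp add: mult_distr_l mult_distr_r smult_mult_l smult_mult_r smult_smult smult_add_right M.a_ac)
    also have "\<dots> = (h \<otimes> h \<oplus> k \<otimes> k) \<oplus> (\<i> \<odot> (h \<otimes> k) \<oplus> (- \<i>) \<odot> (h \<otimes> k))"
      unfolding comm using hk(1,2) by (simp add: M.a_ac)
    also have "\<dots> = \<one>"
      unfolding sq using hk(1,2) by (simp flip: smult_add_left)
    finally have "u\<^sup>\<star> \<otimes> u \<in> projections A" using one_projection by simp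
    then have "cnorm A u \<le> 1" by (rule cnorm_partial_isometry_le[OF u(1)])
    moreover have "h = (1/2) \<odot> (u \<oplus> u\<^sup>\<star>)"
    proof -
      have "u \<oplus> u\<^sup>\<star> = (h \<oplus> h) \<oplus> (\<i> \<odot> k \<oplus> (- \<i>) \<odot> k)"
        unfolding u(2) unfolding u_def using hk(1,2) by (simp add: M.a_ac)
      also have "\<dots> = 2 \<odot> h"
        using hk(1,2) smult_add_left[of h 1 1] by (simp flip: smult_add_left)
      finally show ?thesis using hk(1) by (simp add: smult_smult)
    qed
    moreover have "cnorm A (u \<oplus> u\<^sup>\<star>) \<le> cnorm A u + cnorm A u"
      using cnorm_triangle[of u "u\<^sup>\<star>"] u(1) by simp
    ultimately have "cnorm A h \<le> 1" using u(1) by (simp add: cnorm_smult)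
    then show ?thesis by (simp add: h_def)
  qed
  have sa: "cnorm A (f a) \<le> cnorm A a" if a: "a \<in> carrier A" "a\<^sup>\<star> = a" for a
  proof (rule field_le_epsilon)
    fix \<epsilon> :: real assume \<epsilon>: "\<epsilon> > 0"
    define t where "t = cnorm A a + \<epsilon>"
    have t: "t > 0" "cnorm A a < t" using \<epsilon> cnorm_nonneg[OF a(1)] by (auto simp: t_def)
    have mod: "cmod (complex_of_real (1 / t)) = 1 / t" using t by (simp only: norm_of_real) simp
    have "cnorm A (f (complex_of_real (1 / t) \<odot> a)) \<le> 1"
    proof (rule le1)
      show "cnorm A (complex_of_real (1 / t) \<odot> a) < 1"
        unfolding cnorm_smult[OF a(1)] mod using t by simp
    qed (use a in \<open>auto simp: adj_smult\<close>)
    then have "1 / t * cnorm A (f a) \<le> 1"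
      unfolding hom(3)[OF a(1) a(1)] cnorm_smult[OF fc[OF a(1)]] mod .
    then show "cnorm A (f a) \<le> cnorm A a + \<epsilon>"
      unfolding t_def[symmetric] using t by (simp add: field_simps)
  qed
  have "(cnorm A (f x))\<^sup>2 = cnorm A (f (x\<^sup>\<star> \<otimes> x))"
    using x by (simp add: hom fc cstar_identity)
  also have "\<dots> \<le> cnorm A (x\<^sup>\<star> \<otimes> x)" by (rule sa) (use x in \<open>auto simp: adj_mult\<close>)
  also have "\<dots> = (cnorm A x)\<^sup>2" using x by (rule cstar_identity)
  finally show ?thesis using power2_le_imp_le cnorm_nonneg[OF x] by blast
qed

subsection \<open>Finite sums\<close>

lemma finsum_only:
  assumes "finite I" "i \<in> I" "f i \<in> carrier A" "\<And>j. \<lbrakk>j \<in> I; j \<noteq> i\<rbrakk> \<Longrightarrow> f j = \<zero>"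
  shows "(\<Oplus>j\<in>I. f j) = f i"
proof -
  have "(\<Oplus>j\<in>I. f j) = (\<Oplus>j\<in>I. if i = j then f j else \<zero>)"
    by (rule M.finsum_cong') (use assms in auto)
  also have "\<dots> = (\<Oplus>j\<in>I. if i = j then f i else \<zero>)"
    by (rule M.finsum_cong') (use assms in auto)
  also have "\<dots> = f i"
    using M.finsum_singleton[of i I "\<lambda>_. f i"] assms by simp
  finally show ?thesis .
qed

lemma finsum_zeroI: "(\<And>j. j \<in> I \<Longrightarrow> f j = \<zero>) \<Longrightarrow> (\<Oplus>j\<in>I. f j) = \<zero>"
  by (rule M.add.finprod_one_eqI) simp

lemma finsum_mult_left:
  "\<lbrakk>finite I; x \<in> carrier A; \<And>i. i \<in> I \<Longrightarrow> f i \<in> carrier A\<rbrakk>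
    \<Longrightarrow> x \<otimes> (\<Oplus>i\<in>I. f i) = (\<Oplus>i\<in>I. x \<otimes> f i)"
  by (rule A.finsum_rdistr) auto

lemma finsum_mult_right:
  "\<lbrakk>finite I; x \<in> carrier A; \<And>i. i \<in> I \<Longrightarrow> f i \<in> carrier A\<rbrakk>
    \<Longrightarrow> (\<Oplus>i\<in>I. f i) \<otimes> x = (\<Oplus>i\<in>I. f i \<otimes> x)"
  by (rule A.finsum_ldistr) auto

lemma finsum_smult_left:
  "\<lbrakk>finite I; x \<in> carrier A\<rbrakk> \<Longrightarrow> (\<Oplus>i\<in>I. c i \<odot> x) = (\<Sum>i\<in>I. c i) \<odot> x"
  by (induct I rule: finite_induct) (simp_all add: Pi_def smult_add_left)

lemma finsum_scalar_multiple:
  assumes "finite I" "m \<in> carrier A" "0 \<in> R" "\<And>c d. \<lbrakk>c \<in> R; d \<in> R\<rbrakk> \<Longrightarrow> c + d \<in> R"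
    and "\<And>i. i \<in> I \<Longrightarrow> \<exists>c\<in>R. f i = c \<odot> m"
  shows "\<exists>c\<in>R. (\<Oplus>i\<in>I. f i) = c \<odot> m"
proof -
  obtain c where c: "\<And>i. i \<in> I \<Longrightarrow> c i \<in> R" "\<And>i. i \<in> I \<Longrightarrow> f i = c i \<odot> m"
    using assms(5) by metis
  have "(\<Oplus>i\<in>I. f i) = (\<Oplus>i\<in>I. c i \<odot> m)"
    by (rule M.finsum_cong') (use c assms(2) in auto)
  also have "\<dots> = (\<Sum>i\<in>I. c i) \<odot> m" by (rule finsum_smult_left[OF assms(1,2)])
  finally have "(\<Oplus>i\<in>I. f i) = (\<Sum>i\<in>I. c i) \<odot> m" .
  moreover have "(\<Sum>i\<in>I. c i) \<in> R"
    using assms(1) c(1) by (induct I rule: finite_induct) (auto simp: assms(3,4))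
  ultimately show ?thesis by blast
qed

subsection \<open>Homomorphisms\<close>

lemma star_homD:
  assumes "f \<in> star_hom A A"
  shows "x \<in> carrier A \<Longrightarrow> f x \<in> carrier A"
    and "\<lbrakk>x \<in> carrier A; y \<in> carrier A\<rbrakk> \<Longrightarrow> f (x \<oplus> y) = f x \<oplus> f y"
    and "\<lbrakk>x \<in> carrier A; y \<in> carrier A\<rbrakk> \<Longrightarrow> f (x \<otimes> y) = f x \<otimes> f y"
    and "x \<in> carrier A \<Longrightarrow> f (c \<odot> x) = c \<odot> f x"
    and "x \<in> carrier A \<Longrightarrow> f (x\<^sup>\<star>) = (f x)\<^sup>\<star>"
  using assms unfolding star_hom_def by blast+

lemma star_hom_zero: "f \<in> star_hom A A \<Longrightarrow> f \<zero> = \<zero>"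
  using star_homD(1)[of f \<zero>] star_homD(4)[of f \<zero> 0] by simp

lemma star_hom_diff:
  assumes f: "f \<in> star_hom A A" and xy: "x \<in> carrier A" "y \<in> carrier A"
  shows "f (x \<ominus> y) = f x \<ominus> f y"
proof -
  have "f (x \<oplus> (- 1) \<odot> y) = f x \<oplus> (- 1) \<odot> f y" using xy by (simp add: star_homD[OF f])
  then show ?thesis using xy star_homD(1)[OF f] by (simp add: minus_one_smult a_minus_def)
qed

lemma star_hom_finsum:
  assumes f: "f \<in> star_hom A A" and "finite I" "\<And>i. i \<in> I \<Longrightarrow> g i \<in> carrier A"
  shows "f (\<Oplus>i\<in>I. g i) = (\<Oplus>i\<in>I. f (g i))"
  using assms(2,3)
  by (induct I rule: finite_induct) (simp_all add: Pi_def star_hom_zero[OF f] star_homD[OF f])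

lemma id_star_hom: "(\<lambda>x\<in>carrier A. x) \<in> star_hom A A"
  by (auto simp: star_hom_def)

lemma star_hom_compose:
  "\<lbrakk>f \<in> star_hom A A; g \<in> star_hom A A\<rbrakk> \<Longrightarrow> compose (carrier A) f g \<in> star_hom A A"
  unfolding star_hom_def[of A A] by (auto simp: compose_def star_homD Pi_iff)

subsection \<open>Automorphisms\<close>

lemma cstar_auto_inverse:
  assumes "f \<in> cstar_auto A"
  obtains g where "g \<in> cstar_auto A" "\<forall>x\<in>carrier A. f (g x) = x" "\<forall>x\<in>carrier A. g (f x) = x"
proof -
  have fB: "f \<in> Bij (carrier A)" using assms by (simp add: cstar_auto_def)
  then have bij: "bij_betw f (carrier A) (carrier A)" by (simp add: Bij_def)
  show thesis
  proof (rule that)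
    show "(\<lambda>x\<in>carrier A. inv_into (carrier A) f x) \<in> cstar_auto A"
      using subgroup.m_inv_closed[OF subgroup_cstar_auto assms] unfolding inv_BijGroup[OF fB] .
    show "\<forall>x\<in>carrier A. f ((\<lambda>x\<in>carrier A. inv_into (carrier A) f x) x) = x"
      using bij_betw_inv_into_right[OF bij] by simp
    show "\<forall>x\<in>carrier A. (\<lambda>x\<in>carrier A. inv_into (carrier A) f x) (f x) = x"
      using bij_betw_inv_into_left[OF bij] bij_betw_apply[OF bij] by simp
  qed
qed

lemma cstar_auto_hom: "f \<in> cstar_auto A \<Longrightarrow> f \<in> star_hom A A"
  by (simp add: cstar_auto_def)

lemma cstar_auto_extensional: "f \<in> cstar_auto A \<Longrightarrow> f \<in> extensional (carrier A)"
  by (simp add: cstar_auto_def Bij_def)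

lemma star_hom_projection:
  assumes f: "f \<in> star_hom A A" and p: "p \<in> projections A"
  shows "f p \<in> projections A"
  using star_homD(1)[OF f, of p] star_homD(3)[OF f, of p p] star_homD(5)[OF f, of p] projectionsD[OF p]
  by (simp add: projections_def)

lemma carrier_aut_group: "carrier (aut_group A) = cstar_auto A"
  by (simp add: aut_group_def)

lemma one_aut_group: "\<one>\<^bsub>aut_group A\<^esub> = (\<lambda>x\<in>carrier A. x)"
  by (simp add: aut_group_def BijGroup_def)

lemma aut_group_pow:
  assumes f: "f \<in> cstar_auto A" and x: "x \<in> carrier A"
  shows "(f [^]\<^bsub>aut_group A\<^esub> (n::nat)) x = (f ^^ n) x"
proof -
  interpret G: group "aut_group A" by (rule group_aut_group)
  show ?thesis
  using x
  proof (induct n arbitrary: x)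
    case (Suc n)
    have fn: "f [^]\<^bsub>aut_group A\<^esub> n \<in> cstar_auto A"
      using G.nat_pow_closed[of f n] f by (simp add: carrier_aut_group)
    have "f x \<in> carrier A" using star_homD(1)[OF cstar_auto_hom[OF f] Suc(2)] .
    then show ?case
      using Suc mult_aut_group[OF fn f] by (simp add: compose_def funpow_swap1)
  qed (simp add: one_aut_group)
qed

lemma Ad_power:
  assumes w: "w \<in> unitaries A"
  obtains u where "u \<in> unitaries A" "\<forall>x\<in>carrier A. (Ad A w ^^ n) x = Ad A u x"
proof -
  have "\<exists>u\<in>unitaries A. \<forall>x\<in>carrier A. (Ad A w ^^ n) x = Ad A u x"
  proof (induct n)
    case 0
    show ?case using unitaries_closed(3) by (intro bexI[of _ \<one>]) (simp_all add: Ad_one)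
  next
    case (Suc n)
    then obtain u where u: "u \<in> unitaries A" "\<forall>x\<in>carrier A. (Ad A w ^^ n) x = Ad A u x" by blast
    have "(Ad A w ^^ Suc n) x = Ad A (w \<otimes> u) x" if x: "x \<in> carrier A" for x
    proof -
      have "Ad A w (Ad A u x) = Ad A (w \<otimes> u) x"
        using fun_cong[OF Ad_compose[of w u], of x] w u(1) x by (simp add: unitaries_def compose_def)
      then show ?thesis using u(2) x by simp
    qed
    then show ?case using unitaries_closed(1)[OF w u(1)] by blast
  qed
  then show thesis using that by blast
qed

end


section \<open>Graph algebras\<close>

text \<open>The coefficient sets for combinations of matrix units: all complex numbers, or the natural
  numbers.\<close>
definition star_semiring :: "complex set \<Rightarrow> bool" where
  "star_semiring R \<longleftrightarrow> 0 \<in> R \<and> 1 \<in> R \<and> (\<forall>c\<in>R. \<forall>d\<in>R. c + d \<in> R \<and> c * d \<in> R) \<and> (\<forall>c\<in>R. cnj c \<in> R)"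

lemma star_semiring_UNIV: "star_semiring UNIV"
  by (simp add: star_semiring_def)

lemma star_semiring_Nats: "star_semiring \<nat>"
  using Nats_add Nats_mult by (auto simp: star_semiring_def elim: Nats_cases)

text \<open>Without sinks every vertex projection is the sum of the ranges of its outgoing edges, so the
  ranges of the paths of any fixed length add up to 1.\<close>
locale finite_graph_algebra =
  graph_cstar_algebra E A P S + unital_cstar_algebra A + fin_digraph E
  for E :: "('v, 'e) pre_digraph" and A :: "'a cstar" (structure) and P S +
  assumes no_sinks: "no_sinks E"
begin

subsection \<open>The generators\<close>

lemma P_projection: "v \<in> verts E \<Longrightarrow> P v \<in> projections A"
  using family by (simp add: ck_family_def)

lemma P_closed [simp]: "v \<in> verts E \<Longrightarrow> P v \<in> carrier A"
  using P_projection projectionsD by blast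

lemma P_star [simp]: "v \<in> verts E \<Longrightarrow> (P v)\<^sup>\<star> = P v"
  using P_projection projectionsD by blast

lemma P_idem [simp]: "v \<in> verts E \<Longrightarrow> P v \<otimes> P v = P v"
  using P_projection projectionsD by blast

lemma P_orthogonal: "\<lbrakk>v \<in> verts E; w \<in> verts E; v \<noteq> w\<rbrakk> \<Longrightarrow> P v \<otimes> P w = \<zero>"
  using family by (simp add: ck_family_def)

lemma S_closed [simp]: "e \<in> arcs E \<Longrightarrow> S e \<in> carrier A"
  using family by (auto simp: ck_family_def partial_isometries_def)

lemma S_star_S: "e \<in> arcs E \<Longrightarrow> (S e)\<^sup>\<star> \<otimes> S e = P (head E e)"
  using family by (simp add: ck_family_def)

lemma S_orthogonal: "\<lbrakk>e \<in> arcs E; f \<in> arcs E; e \<noteq> f\<rbrakk> \<Longrightarrow> (S e)\<^sup>\<star> \<otimes> S f = \<zero>"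
  using family by (simp add: ck_family_def)

lemma finite_out_arcs [simp]: "finite (out_arcs E v)"
  by (simp add: out_arcs_def)

lemma P_eq_sum: "v \<in> verts E \<Longrightarrow> P v = (\<Oplus>e\<in>out_arcs E v. S e \<otimes> (S e)\<^sup>\<star>)"
  using family no_sinks by (simp add: ck_family_def no_sinks_def)

lemma S_P_head: "e \<in> arcs E \<Longrightarrow> S e \<otimes> P (head E e) = S e"
  by (rule partial_isometry_mult_initial) (auto simp: S_star_S P_projection)

lemma P_tail_S: assumes "e \<in> arcs E" shows "P (tail E e) \<otimes> S e = S e"
proof -
  have "P (tail E e) \<otimes> S e = (\<Oplus>f\<in>out_arcs E (tail E e). S f \<otimes> (S f)\<^sup>\<star> \<otimes> S e)"
    unfolding P_eq_sum[OF tail_in_verts[OF assms]] by (rule finsum_mult_right) (use assms in auto)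
  also have "\<dots> = S e \<otimes> (S e)\<^sup>\<star> \<otimes> S e"
    by (rule finsum_only) (use assms in \<open>auto simp: m_assoc S_orthogonal\<close>)
  also have "\<dots> = S e"
    using assms by (simp add: m_assoc S_star_S S_P_head)
  finally show ?thesis .
qed

lemma P_S: "\<lbrakk>v \<in> verts E; e \<in> arcs E\<rbrakk> \<Longrightarrow> P v \<otimes> S e = (if v = tail E e then S e else \<zero>)"
proof -
  assume v: "v \<in> verts E" and e: "e \<in> arcs E"
  show ?thesis
  proof (cases "v = tail E e")
    case False
    have "P v \<otimes> S e = P v \<otimes> P (tail E e) \<otimes> S e" using v e by (simp add: m_assoc P_tail_S)
    then show ?thesis using False v e by (simp add: P_orthogonal)
  qed (use e P_tail_S in simp)
qed

lemma dense_if_contains_generators: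
  assumes "B \<subseteq> carrier A" "\<zero> \<in> B"
    and "\<And>x y. \<lbrakk>x \<in> B; y \<in> B\<rbrakk> \<Longrightarrow> x \<oplus> y \<in> B"
    and "\<And>x y. \<lbrakk>x \<in> B; y \<in> B\<rbrakk> \<Longrightarrow> x \<otimes> y \<in> B"
    and "\<And>c x. x \<in> B \<Longrightarrow> c \<odot> x \<in> B"
    and "\<And>x. x \<in> B \<Longrightarrow> x\<^sup>\<star> \<in> B"
    and PB: "P ` verts E \<subseteq> B" and SB: "S ` arcs E \<subseteq> B"
  shows "approximable B = carrier A"
proof (rule generated)
  show "closed_star_subalgebra A (approximable B)"
    by (rule closed_star_subalgebra_approximable) (use assms in auto)
  have "B \<subseteq> approximable B" using assms(1) by (auto simp: approximable_def intro!: bexI)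
  then show "P ` verts E \<subseteq> approximable B" "S ` arcs E \<subseteq> approximable B" using PB SB by auto
qed

text \<open>The sum of the vertex projections acts as a unit on the generators, hence on a dense set that
  comes arbitrarily close to 1.\<close>
lemma sum_P: "(\<Oplus>v\<in>verts E. P v) = \<one>"
proof -
  define p where "p = (\<Oplus>v\<in>verts E. P v)"
  have p: "p \<in> carrier A" by (simp add: p_def)
  have p_star: "p\<^sup>\<star> = p" unfolding p_def by (subst adj_finsum) (auto intro!: M.finsum_cong')
  have pP: "p \<otimes> P v = P v" if "v \<in> verts E" for v
  proof -
    have "p \<otimes> P v = (\<Oplus>w\<in>verts E. P w \<otimes> P v)" unfolding p_def using that by (simp add: finsum_mult_right)
    also have "\<dots> = P v \<otimes> P v" by (rule finsum_only) (use that P_orthogonal in auto)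
    finally show ?thesis using that by simp
  qed
  have "p \<otimes> p = (\<Oplus>v\<in>verts E. p \<otimes> P v)"
    using finsum_mult_left[of "verts E" p P] p by (simp add: p_def[symmetric])
  also have "\<dots> = p" unfolding p_def by (rule M.finsum_cong') (use pP p_def in auto)
  finally have proj: "p \<in> projections A" using p p_star by (simp add: projections_def)
  define B where "B = {x \<in> carrier A. p \<otimes> x = x \<and> x \<otimes> p = x}"
  have Pp: "P v \<otimes> p = P v" if "v \<in> verts E" for v
    using adj_mult[of p "P v"] pP[OF that] p p_star that by simp
  have "approximable B = carrier A"
  proof (rule dense_if_contains_generators)
    fix x y assume "x \<in> B" "y \<in> B"
    then have xy: "x \<in> carrier A" "y \<in> carrier A" "p \<otimes> x = x" "x \<otimes> p = x" "p \<otimes> y = y" "y \<otimes> p = y"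
      by (auto simp: B_def)
    then show "x \<oplus> y \<in> B" using p by (simp add: B_def mult_distr_l mult_distr_r)
    have "p \<otimes> (x \<otimes> y) = x \<otimes> y" using m_assoc[of p x y] p xy by simp
    moreover have "x \<otimes> y \<otimes> p = x \<otimes> y" using m_assoc[of x y p] p xy by simp
    ultimately show "x \<otimes> y \<in> B" using xy by (simp add: B_def)
  next
    fix c x assume "x \<in> B"
    then show "c \<odot> x \<in> B" using p by (simp add: B_def smult_mult_l smult_mult_r)
  next
    fix x assume "x \<in> B"
    then show "x\<^sup>\<star> \<in> B" using p p_star adj_mult[of p x] adj_mult[of x p] by (simp add: B_def)
  next
    show "P ` verts E \<subseteq> B" using pP Pp by (auto simp: B_def)
    have "p \<otimes> S e = S e" "S e \<otimes> p = S e" if e: "e \<in> arcs E" for e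
    proof -
      have "p \<otimes> S e = p \<otimes> P (tail E e) \<otimes> S e" using e p by (simp add: m_assoc P_tail_S)
      then show "p \<otimes> S e = S e" using e pP by (simp add: P_tail_S)
      have "S e \<otimes> p = S e \<otimes> P (head E e) \<otimes> p" using e by (simp add: S_P_head)
      also have "\<dots> = S e"
        using e p Pp[of "head E e"] m_assoc[of "S e" "P (head E e)" p] by (simp add: S_P_head)
      finally show "S e \<otimes> p = S e" .
    qed
    then show "S ` arcs E \<subseteq> B" by (auto simp: B_def)
  qed (use p in \<open>auto simp: B_def\<close>)
  have "p \<ominus> \<one> = \<zero>"
  proof (rule eq_zero_if_arbitrarily_small[of _ 2])
    fix \<epsilon> :: real assume "\<epsilon> > 0"
    have "\<one> \<in> approximable B" using \<open>approximable B = carrier A\<close> by simp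
    then obtain y where y: "y \<in> B" "cnorm A (\<one> \<ominus> y) < \<epsilon>" using \<open>\<epsilon> > 0\<close> by (rule approximableD)
    then have c: "y \<in> carrier A" "p \<otimes> y = y" by (auto simp: B_def)
    have "p \<ominus> \<one> = (p \<ominus> y) \<ominus> (\<one> \<ominus> y)" using p c(1) by algebra
    also have "p \<ominus> y = p \<otimes> (\<one> \<ominus> y)" using p c by (simp add: mult_diff_distrib)
    finally have "cnorm A (p \<ominus> \<one>) \<le> cnorm A (p \<otimes> (\<one> \<ominus> y)) + cnorm A (\<one> \<ominus> y)"
      using cnorm_diff_triangle[of "p \<otimes> (\<one> \<ominus> y)" "\<one> \<ominus> y"] p c(1) by simp
    also have "cnorm A (p \<otimes> (\<one> \<ominus> y)) \<le> 1 * cnorm A (\<one> \<ominus> y)"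
      using cnorm_mult[of p "\<one> \<ominus> y"] p c(1) cnorm_projection_le[OF proj] cnorm_nonneg[of "\<one> \<ominus> y"]
        mult_right_mono[of "cnorm A p" 1 "cnorm A (\<one> \<ominus> y)"] by simp
    finally show "cnorm A (p \<ominus> \<one>) \<le> 2 * \<epsilon>" using y by simp
  qed (use p in simp)
  then show ?thesis using p by (simp add: diff_eq_zero_iff p_def)
qed


subsection \<open>Paths\<close>

abbreviation path_range :: "'v \<times> 'e list \<Rightarrow> 'v" where
  "path_range \<alpha> \<equiv> awlast (fst \<alpha>) (snd \<alpha>)"

abbreviation T :: "'v \<times> 'e list \<Rightarrow> 'a" where
  "T \<equiv> S_path A P S"

text \<open>In the picture of the diagonal as functions on infinite paths, this is the indicator function of
  the cylinder set of the paths beginning with \<open>\<alpha>\<close>.\<close>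
definition cyl :: "'v \<times> 'e list \<Rightarrow> 'a" where
  "cyl \<alpha> = T \<alpha> \<otimes> (T \<alpha>)\<^sup>\<star>"

lemma paths_0: "paths E 0 = (\<lambda>v. (v, [])) ` verts E"
  by (auto simp: paths_def awalk_Nil_iff)

lemma paths_Suc_Cons:
  "(u, p) \<in> paths E (Suc k) \<longleftrightarrow>
    (\<exists>e q. p = e # q \<and> e \<in> arcs E \<and> u = tail E e \<and> (head E e, q) \<in> paths E k)"
  by (cases p) (auto simp: paths_def awalk_Cons_iff)

lemma paths_Suc_snoc:
  "(u, p) \<in> paths E (Suc k) \<longleftrightarrow>
    (\<exists>q e. p = q @ [e] \<and> (u, q) \<in> paths E k \<and> e \<in> arcs E \<and> tail E e = awlast u q)"
proof (cases p rule: rev_cases)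
  case (snoc q e)
  have "\<And>v. awalk u q v \<Longrightarrow> v = awlast u q" by auto
  then show ?thesis using snoc by (auto simp: paths_def awalk_Cons_iff awalk_Nil_iff)
qed (auto simp: paths_def)

lemma finite_paths [simp]: "finite (paths E k)"
proof (induct k)
  case (Suc k)
  have "paths E (Suc k) \<subseteq> (\<lambda>((u, q), e). (u, q @ [e])) ` (paths E k \<times> arcs E)"
  proof (clarify)
    fix u p assume "(u, p) \<in> paths E (Suc k)"
    then obtain q e where "p = q @ [e]" "(u, q) \<in> paths E k" "e \<in> arcs E"
      by (auto simp: paths_Suc_snoc)
    then show "(u, p) \<in> (\<lambda>((u, q), e). (u, q @ [e])) ` (paths E k \<times> arcs E)"
      by (intro image_eqI[of _ _ "((u, q), e)"]) auto
  qed
  then show ?case using Suc by (meson finite_SigmaI finite_arcs finite_imageI finite_subset)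
qed (simp add: paths_0)

lemma path_fst_in_verts: "(u, p) \<in> paths E k \<Longrightarrow> u \<in> verts E"
  by (auto simp: paths_def)

lemma path_range_in_verts [simp]: "\<alpha> \<in> paths E k \<Longrightarrow> path_range \<alpha> \<in> verts E"
  by (cases \<alpha>) (auto simp: paths_def)

lemma path_range_Cons: "(head E e, q) \<in> paths E k \<Longrightarrow> awlast (tail E e) (e # q) = awlast (head E e) q"
  by (auto simp: paths_def)

text \<open>\<open>S_path\<close> hands the source of the whole path down to its tail, where it matters only for the
  empty path.\<close>
lemma T_start_irrelevant: "p \<noteq> [] \<Longrightarrow> T (u, p) = T (v, p)"
  by (induct p rule: induct_list012) auto

lemma T_Cons:
  assumes "e \<in> arcs E"
  shows "T (u, e # q) = S e \<otimes> T (head E e, q)"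
  using assms S_P_head T_start_irrelevant[of q u "head E e"] by (cases q) auto

lemma T_closed [simp]: "\<alpha> \<in> paths E k \<Longrightarrow> T \<alpha> \<in> carrier A"
proof (induct k arbitrary: \<alpha>)
  case (Suc k)
  then show ?case by (cases \<alpha>) (auto simp: paths_Suc_Cons T_Cons)
qed (auto simp: paths_0)

lemma P_T: "\<lbrakk>v \<in> verts E; \<alpha> \<in> paths E k\<rbrakk> \<Longrightarrow> P v \<otimes> T \<alpha> = (if v = fst \<alpha> then T \<alpha> else \<zero>)"
proof (cases k)
  case 0
  assume "v \<in> verts E" "\<alpha> \<in> paths E k"
  then show ?thesis using 0 P_orthogonal by (auto simp: paths_0)
next
  case (Suc l)
  assume v: "v \<in> verts E" and "\<alpha> \<in> paths E k"
  then obtain e q where \<alpha>: "\<alpha> = (tail E e, e # q)" "e \<in> arcs E" "(head E e, q) \<in> paths E l"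
    using Suc by (cases \<alpha>) (auto simp: paths_Suc_Cons)
  then have "P v \<otimes> T \<alpha> = (P v \<otimes> S e) \<otimes> T (head E e, q)"
    using v by (simp add: T_Cons m_assoc)
  then show ?thesis using v \<alpha> by (simp add: P_S T_Cons)
qed

lemma T_snoc:
  "\<lbrakk>(u, q) \<in> paths E k; e \<in> arcs E; tail E e = awlast u q\<rbrakk> \<Longrightarrow> T (u, q @ [e]) = T (u, q) \<otimes> S e"
proof (induct k arbitrary: u q)
  case 0
  then show ?case by (auto simp: paths_0 P_S)
next
  case (Suc k)
  then obtain f r where q: "q = f # r" "f \<in> arcs E" "u = tail E f" "(head E f, r) \<in> paths E k"
    by (auto simp: paths_Suc_Cons)
  then have "T (head E f, r @ [e]) = T (head E f, r) \<otimes> S e"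
    using Suc path_range_Cons[OF q(4)] by auto
  then show ?case using q Suc(3) by (simp add: T_Cons m_assoc)
qed

lemma T_star_T:
  "\<lbrakk>\<alpha> \<in> paths E k; \<beta> \<in> paths E k\<rbrakk> \<Longrightarrow> (T \<alpha>)\<^sup>\<star> \<otimes> T \<beta> = (if \<alpha> = \<beta> then P (path_range \<alpha>) else \<zero>)"
proof (induct k arbitrary: \<alpha> \<beta>)
  case 0
  then obtain v w where "\<alpha> = (v, [])" "\<beta> = (w, [])" "v \<in> verts E" "w \<in> verts E"
    by (auto simp: paths_0)
  then show ?case using P_orthogonal[of v w] by simp
next
  case (Suc k)
  then obtain e q f r where \<alpha>: "\<alpha> = (tail E e, e # q)" "e \<in> arcs E" "(head E e, q) \<in> paths E k"
    and \<beta>: "\<beta> = (tail E f, f # r)" "f \<in> arcs E" "(head E f, r) \<in> paths E k"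
    by (cases \<alpha>, cases \<beta>) (auto simp: paths_Suc_Cons)
  have *: "(T \<alpha>)\<^sup>\<star> \<otimes> T \<beta> = (T (head E e, q))\<^sup>\<star> \<otimes> (((S e)\<^sup>\<star> \<otimes> S f) \<otimes> T (head E f, r))"
    using \<alpha> \<beta> by (simp add: T_Cons adj_mult m_assoc)
  show ?case
  proof (cases "e = f")
    case True
    then have "(T \<alpha>)\<^sup>\<star> \<otimes> T \<beta> = (T (head E e, q))\<^sup>\<star> \<otimes> T (head E e, r)"
      using * \<alpha> \<beta> by (simp add: S_star_S P_T[of _ _ k])
    also have "\<dots> = (if q = r then P (path_range (head E e, q)) else \<zero>)"
      using Suc(1)[of "(head E e, q)" "(head E e, r)"] True \<alpha> \<beta> by simp
    finally show ?thesis using True \<alpha> \<beta> path_range_Cons[OF \<alpha>(3)] by simp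
  next
    case False
    then show ?thesis using * \<alpha> \<beta> by (simp add: S_orthogonal)
  qed
qed

lemma T_star_T_self: "\<alpha> \<in> paths E k \<Longrightarrow> (T \<alpha>)\<^sup>\<star> \<otimes> T \<alpha> = P (path_range \<alpha>)"
  using T_star_T[of \<alpha> k \<alpha>] by simp

lemma T_P_range: "\<alpha> \<in> paths E k \<Longrightarrow> T \<alpha> \<otimes> P (path_range \<alpha>) = T \<alpha>"
  by (rule partial_isometry_mult_initial) (auto simp: T_star_T_self P_projection)

lemma cyl_closed [simp]: "\<alpha> \<in> paths E k \<Longrightarrow> cyl \<alpha> \<in> carrier A"
  by (simp add: cyl_def)

lemma cyl_T: "\<lbrakk>\<alpha> \<in> paths E k; \<beta> \<in> paths E k\<rbrakk> \<Longrightarrow> cyl \<alpha> \<otimes> T \<beta> = (if \<alpha> = \<beta> then T \<beta> else \<zero>)"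
  by (simp add: cyl_def m_assoc T_star_T T_P_range)

lemma cyl_star [simp]: "\<alpha> \<in> paths E k \<Longrightarrow> (cyl \<alpha>)\<^sup>\<star> = cyl \<alpha>"
  by (simp add: cyl_def adj_mult)

lemma T_star_cyl:
  "\<lbrakk>\<alpha> \<in> paths E k; \<beta> \<in> paths E k\<rbrakk> \<Longrightarrow> (T \<beta>)\<^sup>\<star> \<otimes> cyl \<alpha> = (if \<alpha> = \<beta> then (T \<beta>)\<^sup>\<star> else \<zero>)"
  using adj_mult[of "cyl \<alpha>" "T \<beta>"] cyl_T[of \<alpha> k \<beta>] by (auto split: if_splits)

lemma cyl_mult: "\<lbrakk>\<alpha> \<in> paths E k; \<beta> \<in> paths E k\<rbrakk> \<Longrightarrow> cyl \<alpha> \<otimes> cyl \<beta> = (if \<alpha> = \<beta> then cyl \<alpha> else \<zero>)"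
proof -
  assume \<alpha>: "\<alpha> \<in> paths E k" and \<beta>: "\<beta> \<in> paths E k"
  then have "cyl \<alpha> \<otimes> cyl \<beta> = (cyl \<alpha> \<otimes> T \<beta>) \<otimes> (T \<beta>)\<^sup>\<star>"
    unfolding cyl_def[of \<beta>] by (intro m_assoc[symmetric]) auto
  then show ?thesis using cyl_T[OF \<alpha> \<beta>] T_closed[OF \<beta>] by (simp add: cyl_def)
qed

lemma cyl_projection: "\<alpha> \<in> paths E k \<Longrightarrow> cyl \<alpha> \<in> projections A"
  using cyl_mult[of \<alpha> k \<alpha>] by (simp add: projections_def)

lemma sum_cyl_from:
  "v \<in> verts E \<Longrightarrow> (\<Oplus>\<alpha>\<in>{\<alpha> \<in> paths E k. fst \<alpha> = v}. cyl \<alpha>) = P v"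
proof (induct k arbitrary: v)
  case 0
  then have "{\<alpha> \<in> paths E 0. fst \<alpha> = v} = {(v, [])}" by (auto simp: paths_0)
  then show ?case using 0 by (simp add: cyl_def)
next
  case (Suc k)
  define Y where "Y e = {\<alpha> \<in> paths E k. fst \<alpha> = head E e}" for e
  define c where "c e \<alpha> = (tail E e, e # snd \<alpha>)" for e :: 'e and \<alpha> :: "'v \<times> 'e list"
  have Y: "finite (Y e)" "Y e \<subseteq> paths E k" for e by (auto simp: Y_def)
  have inj: "inj_on (c e) (Y e)" for e by (auto simp: inj_on_def c_def Y_def)
  have cyl_c: "cyl (c e \<alpha>) = S e \<otimes> cyl \<alpha> \<otimes> (S e)\<^sup>\<star>" if "e \<in> arcs E" "\<alpha> \<in> Y e" for e \<alpha>
    using that by (cases \<alpha>) (auto simp: c_def Y_def cyl_def T_Cons adj_mult m_assoc)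
  have c_path: "c e \<alpha> \<in> paths E (Suc k)" if "e \<in> arcs E" "\<alpha> \<in> Y e" for e \<alpha>
    using that by (cases \<alpha>) (auto simp: c_def Y_def paths_Suc_Cons)
  have "{\<alpha> \<in> paths E (Suc k). fst \<alpha> = v} = (\<Union>e\<in>out_arcs E v. c e ` Y e)"
    by (auto simp: paths_Suc_Cons c_def Y_def image_iff)
  then have "(\<Oplus>\<alpha>\<in>{\<alpha> \<in> paths E (Suc k). fst \<alpha> = v}. cyl \<alpha>) = (\<Oplus>\<alpha>\<in>(\<Union>e\<in>out_arcs E v. c e ` Y e). cyl \<alpha>)"
    by simp
  also have "\<dots> = (\<Oplus>e\<in>out_arcs E v. \<Oplus>\<alpha>\<in>c e ` Y e. cyl \<alpha>)"
    by (rule M.add.finprod_UN_disjoint) (use Y cyl_closed[OF c_path] in \<open>auto simp: c_def pairwise_def disjnt_iff\<close>)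
  also have "\<dots> = (\<Oplus>e\<in>out_arcs E v. S e \<otimes> (S e)\<^sup>\<star>)"
  proof (rule M.finsum_cong')
    fix e assume "e \<in> out_arcs E v"
    then have e: "e \<in> arcs E" by simp
    have "(\<Oplus>\<alpha>\<in>c e ` Y e. cyl \<alpha>) = (\<Oplus>\<alpha>\<in>Y e. cyl (c e \<alpha>))"
      by (rule M.finsum_reindex) (use inj e cyl_closed[OF c_path] in auto)
    also have "\<dots> = (\<Oplus>\<alpha>\<in>Y e. S e \<otimes> cyl \<alpha> \<otimes> (S e)\<^sup>\<star>)"
      by (rule M.finsum_cong') (use e Y in \<open>auto simp: cyl_c intro!: m_closed cyl_closed[of _ k]\<close>)
    also have "\<dots> = S e \<otimes> (\<Oplus>\<alpha>\<in>Y e. cyl \<alpha>) \<otimes> (S e)\<^sup>\<star>"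
    proof -
      have cA: "cyl \<alpha> \<in> carrier A" if "\<alpha> \<in> Y e" for \<alpha> using that Y(2) by (auto intro: cyl_closed)
      show ?thesis using e Y(1) cA by (simp add: finsum_mult_left finsum_mult_right)
    qed
    also have "\<dots> = S e \<otimes> (S e)\<^sup>\<star>"
      using Suc(1)[of "head E e"] e by (simp add: Y_def S_P_head)
    finally show "(\<Oplus>\<alpha>\<in>c e ` Y e. cyl \<alpha>) = S e \<otimes> (S e)\<^sup>\<star>" .
  qed auto
  also have "\<dots> = P v" using Suc(2) by (simp add: P_eq_sum)
  finally show ?case .
qed

lemma sum_cyl: "(\<Oplus>\<alpha>\<in>paths E k. cyl \<alpha>) = \<one>"
proof -
  have "paths E k = (\<Union>v\<in>verts E. {\<alpha> \<in> paths E k. fst \<alpha> = v})"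
    using path_fst_in_verts by auto
  then have "(\<Oplus>\<alpha>\<in>paths E k. cyl \<alpha>) = (\<Oplus>\<alpha>\<in>(\<Union>v\<in>verts E. {\<alpha> \<in> paths E k. fst \<alpha> = v}). cyl \<alpha>)"
    by simp
  also have "\<dots> = (\<Oplus>v\<in>verts E. \<Oplus>\<alpha>\<in>{\<alpha> \<in> paths E k. fst \<alpha> = v}. cyl \<alpha>)"
    by (rule M.add.finprod_UN_disjoint) (auto simp: pairwise_def disjnt_iff intro: cyl_closed)
  also have "\<dots> = (\<Oplus>v\<in>verts E. P v)"
    by (rule M.finsum_cong') (auto simp: sum_cyl_from)
  finally show ?thesis by (simp add: sum_P)
qed

text \<open>The cylinder projections of each level form a partition of unity, so an element is determined
  by its matrix blocks.\<close>
lemma sum_blocks: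
  assumes "x \<in> carrier A"
  shows "x = (\<Oplus>\<alpha>\<in>paths E a. \<Oplus>\<beta>\<in>paths E b. cyl \<alpha> \<otimes> x \<otimes> cyl \<beta>)"
proof -
  have "x = (\<Oplus>\<alpha>\<in>paths E a. cyl \<alpha>) \<otimes> x" using assms by (simp add: sum_cyl)
  also have "\<dots> = (\<Oplus>\<alpha>\<in>paths E a. cyl \<alpha> \<otimes> x)" using assms by (intro finsum_mult_right) auto
  also have "\<dots> = (\<Oplus>\<alpha>\<in>paths E a. \<Oplus>\<beta>\<in>paths E b. cyl \<alpha> \<otimes> x \<otimes> cyl \<beta>)"
  proof (rule M.finsum_cong')
    fix \<alpha> assume \<alpha>: "\<alpha> \<in> paths E a"
    have "cyl \<alpha> \<otimes> x = cyl \<alpha> \<otimes> x \<otimes> (\<Oplus>\<beta>\<in>paths E b. cyl \<beta>)" using assms \<alpha> by (simp add: sum_cyl)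
    also have "\<dots> = (\<Oplus>\<beta>\<in>paths E b. cyl \<alpha> \<otimes> x \<otimes> cyl \<beta>)"
      using assms \<alpha> by (intro finsum_mult_left) auto
    finally show "cyl \<alpha> \<otimes> x = (\<Oplus>\<beta>\<in>paths E b. cyl \<alpha> \<otimes> x \<otimes> cyl \<beta>)" .
  qed (use assms in \<open>auto intro!: M.finsum_closed\<close>)
  finally show ?thesis .
qed

lemma eq_if_blocks_eq:
  assumes "x \<in> carrier A" "y \<in> carrier A"
    and "\<And>\<alpha> \<beta>. \<lbrakk>\<alpha> \<in> paths E a; \<beta> \<in> paths E b\<rbrakk> \<Longrightarrow> cyl \<alpha> \<otimes> x \<otimes> cyl \<beta> = cyl \<alpha> \<otimes> y \<otimes> cyl \<beta>"
  shows "x = y"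
proof -
  have "(\<Oplus>\<alpha>\<in>paths E a. \<Oplus>\<beta>\<in>paths E b. cyl \<alpha> \<otimes> x \<otimes> cyl \<beta>)
      = (\<Oplus>\<alpha>\<in>paths E a. \<Oplus>\<beta>\<in>paths E b. cyl \<alpha> \<otimes> y \<otimes> cyl \<beta>)"
    by (intro M.finsum_cong' refl) (use assms in \<open>auto intro!: M.finsum_closed\<close>)
  then show ?thesis using sum_blocks[OF assms(1), where a = a and b = b] sum_blocks[OF assms(2), where a = a and b = b] by simp
qed

lemma eq_if_cyl_mult_eq:
  assumes "x \<in> carrier A" "y \<in> carrier A" "\<And>\<alpha>. \<alpha> \<in> paths E a \<Longrightarrow> cyl \<alpha> \<otimes> x = cyl \<alpha> \<otimes> y"
  shows "x = y"
  by (rule eq_if_blocks_eq[of _ _ a 0]) (use assms in auto)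

subsection \<open>Endomorphisms determined by generators\<close>

lemma graph_endo:
  assumes "ck_family E A Q R"
  shows "graph_endo E A P S Q R \<in> star_hom A A"
    and "graph_endo E A P S Q R \<in> extensional (carrier A)"
    and "v \<in> verts E \<Longrightarrow> graph_endo E A P S Q R (P v) = Q v"
    and "e \<in> arcs E \<Longrightarrow> graph_endo E A P S Q R (S e) = R e"
  using theI'[OF universal[OF cstar_algebra_axioms assms]] unfolding graph_endo_def by blast+

lemma star_hom_eqI:
  assumes "ck_family E A Q R"
    and "f \<in> star_hom A A" "f \<in> extensional (carrier A)"
    and "g \<in> star_hom A A" "g \<in> extensional (carrier A)"
    and "\<And>v. v \<in> verts E \<Longrightarrow> f (P v) = Q v" "\<And>e. e \<in> arcs E \<Longrightarrow> f (S e) = R e"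
    and "\<And>v. v \<in> verts E \<Longrightarrow> g (P v) = Q v" "\<And>e. e \<in> arcs E \<Longrightarrow> g (S e) = R e"
  shows "f = g"
  using universal[OF cstar_algebra_axioms assms(1)] assms(2-) by blast

text \<open>One construction covers the gauge automorphisms (\<open>u\<close> a scalar), the endomorphisms \<open>\<lambda>\<^sub>u\<close>
  (trivial \<open>a\<close> and \<open>b\<close>), and the graph automorphisms (\<open>u = 1\<close>).\<close>
lemma ck_family_twisted:
  assumes ab: "(a, b) \<in> graph_auto E" and u: "u \<in> U_group E A P"
    and Q: "\<And>v. v \<in> verts E \<Longrightarrow> Q v = P (a v)" and R: "\<And>e. e \<in> arcs E \<Longrightarrow> R e = u \<otimes> S (b e)"
  shows "ck_family E A Q R"
proof -
  have a: "bij_betw a (verts E) (verts E)" and b: "bij_betw b (arcs E) (arcs E)"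
    and tail: "\<And>e. e \<in> arcs E \<Longrightarrow> tail E (b e) = a (tail E e)"
    and head: "\<And>e. e \<in> arcs E \<Longrightarrow> head E (b e) = a (head E e)"
    using ab by (auto simp: graph_auto_def)
  have av: "a v \<in> verts E" if "v \<in> verts E" for v using a that by (rule bij_betw_apply)
  have be: "b e \<in> arcs E" if "e \<in> arcs E" for e using b that by (rule bij_betw_apply)
  have uA: "u \<in> carrier A" and uu: "u\<^sup>\<star> \<otimes> u = \<one>" "u \<otimes> u\<^sup>\<star> = \<one>"
    and uP: "\<And>v. v \<in> verts E \<Longrightarrow> u \<otimes> P v = P v \<otimes> u"
    using u by (auto simp: U_group_def unitaries_def)
  have RR: "(R e)\<^sup>\<star> \<otimes> R f = (S (b e))\<^sup>\<star> \<otimes> S (b f)" if "e \<in> arcs E" "f \<in> arcs E" for e f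
  proof -
    have "(R e)\<^sup>\<star> \<otimes> R f = (S (b e))\<^sup>\<star> \<otimes> ((u\<^sup>\<star> \<otimes> u) \<otimes> S (b f))"
      using that uA be by (simp add: R adj_mult m_assoc)
    then show ?thesis using that be by (simp add: uu)
  qed
  have head_proj: "(R e)\<^sup>\<star> \<otimes> R e = P (a (head E e))" if "e \<in> arcs E" for e
    using that RR be by (simp add: S_star_S head)
  have RA: "R e \<in> carrier A" if "e \<in> arcs E" for e using that uA be by (simp add: R)
  have le: "cstar_le A (R e \<otimes> (R e)\<^sup>\<star>) (Q (tail E e))" if e: "e \<in> arcs E" for e
  proof -
    \<comment> \<open>A subprojection is dominated because the difference is a projection, hence of the form \<open>z\<^sup>* z\<close>.\<close>
    let ?p = "P (a (tail E e))" and ?q = "R e \<otimes> (R e)\<^sup>\<star>"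
    have av': "a (tail E e) \<in> verts E" using av e by simp
    have pR: "?p \<otimes> R e = R e"
    proof -
      have "?p \<otimes> R e = (?p \<otimes> u) \<otimes> S (b e)" using e uA be av' by (simp add: R m_assoc)
      also have "\<dots> = u \<otimes> (?p \<otimes> S (b e))"
        unfolding uP[OF av', symmetric] using e uA be av' by (simp add: m_assoc)
      finally show ?thesis using e be P_tail_S[of "b e"] by (simp add: R tail)
    qed
    have RP: "R e \<otimes> P (a (head E e)) = R e"
      by (rule partial_isometry_mult_initial) (use e RA head_proj av P_projection in auto)
    have "?q \<otimes> ?q = R e \<otimes> ((R e)\<^sup>\<star> \<otimes> R e) \<otimes> (R e)\<^sup>\<star>" using RA[OF e] by (simp add: m_assoc)
    then have q: "?q \<in> projections A"
      using RA[OF e] RP head_proj[OF e] by (simp add: projections_def adj_mult)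
    have pq: "?p \<otimes> ?q = ?q" using pR RA[OF e] av' by (simp flip: m_assoc)
    moreover have "?q \<otimes> ?p = ?q"
      using adj_mult[of ?p ?q] pq RA[OF e] av' projectionsD[OF q] by simp
    ultimately have "?p \<ominus> ?q \<in> projections A" by (intro projection_diff P_projection q av')
    then have "?p \<ominus> ?q = (?p \<ominus> ?q)\<^sup>\<star> \<otimes> (?p \<ominus> ?q)" using projectionsD by metis
    then show ?thesis
      using av' RA[OF e] e unfolding cstar_le_def by (intro bexI[of _ "?p \<ominus> ?q"]) (auto simp: Q)
  qed
  have sum: "Q v = (\<Oplus>e\<in>out_arcs E v. R e \<otimes> (R e)\<^sup>\<star>)" if v: "v \<in> verts E" for v
  proof -
    have img: "out_arcs E (a v) = b ` out_arcs E v"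
    proof (intro Set.set_eqI iffI)
      fix f assume f: "f \<in> out_arcs E (a v)"
      then obtain e where e: "e \<in> arcs E" "f = b e" using b by (auto simp: bij_betw_def)
      then have "a (tail E e) = a v" using f tail by simp
      then have "tail E e = v" using a e v by (auto simp: bij_betw_def inj_on_def)
      then show "f \<in> b ` out_arcs E v" using e by auto
    qed (use tail be in auto)
    have inj: "inj_on b (out_arcs E v)" using b by (auto simp: bij_betw_def inj_on_def)
    have "P (a v) = (\<Oplus>f\<in>b ` out_arcs E v. S f \<otimes> (S f)\<^sup>\<star>)"
      using P_eq_sum[OF av[OF v]] by (simp add: img)
    also have "\<dots> = (\<Oplus>e\<in>out_arcs E v. S (b e) \<otimes> (S (b e))\<^sup>\<star>)"
      by (rule M.finsum_reindex) (use inj be in auto)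
    finally have sum: "(\<Oplus>e\<in>out_arcs E v. S (b e) \<otimes> (S (b e))\<^sup>\<star>) = P (a v)" by simp
    have "(\<Oplus>e\<in>out_arcs E v. R e \<otimes> (R e)\<^sup>\<star>)
        = (\<Oplus>e\<in>out_arcs E v. u \<otimes> (S (b e) \<otimes> (S (b e))\<^sup>\<star>) \<otimes> u\<^sup>\<star>)"
      by (rule M.finsum_cong') (use be uA in \<open>auto simp: R adj_mult m_assoc\<close>)
    also have "\<dots> = (\<Oplus>e\<in>out_arcs E v. u \<otimes> (S (b e) \<otimes> (S (b e))\<^sup>\<star>)) \<otimes> u\<^sup>\<star>"
      by (rule finsum_mult_right[symmetric]) (use be uA in auto)
    also have "(\<Oplus>e\<in>out_arcs E v. u \<otimes> (S (b e) \<otimes> (S (b e))\<^sup>\<star>)) = u \<otimes> P (a v)"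
      unfolding sum[symmetric] by (rule finsum_mult_left[symmetric]) (use be uA in auto)
    also have "u \<otimes> P (a v) \<otimes> u\<^sup>\<star> = P (a v) \<otimes> (u \<otimes> u\<^sup>\<star>)"
      unfolding uP[OF av[OF v]] using uA av[OF v] by (simp add: m_assoc)
    finally show ?thesis using uu av[OF v] v by (simp add: Q)
  qed
  have iso: "R e \<in> partial_isometries A" if "e \<in> arcs E" for e
    using RA that head_proj av P_projection by (simp add: partial_isometries_def)
  have orth: "(R e)\<^sup>\<star> \<otimes> R f = \<zero>" if "e \<in> arcs E" "f \<in> arcs E" "e \<noteq> f" for e f
  proof -
    have "b e \<noteq> b f" using b that by (auto simp: bij_betw_def inj_on_def)
    then show ?thesis using that RR be by (simp add: S_orthogonal)
  qed
  have Q_orth: "Q v \<otimes> Q w = \<zero>" if "v \<in> verts E" "w \<in> verts E" "v \<noteq> w" for v w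
  proof -
    have "a v \<noteq> a w" using a that by (auto simp: bij_betw_def inj_on_def)
    then show ?thesis using that av by (simp add: Q P_orthogonal)
  qed
  have Q_proj: "Q v \<in> projections A" if "v \<in> verts E" for v
    using that av by (simp add: Q P_projection)
  have init: "(R e)\<^sup>\<star> \<otimes> R e = Q (head E e)" if "e \<in> arcs E" for e
    using that head_proj by (simp add: Q)
  show ?thesis
    unfolding ck_family_def
    by (intro conjI ballI impI; (elim conjE)?; (rule Q_proj Q_orth iso init orth le sum; assumption))
qed

lemma id_graph_auto: "(id, id) \<in> graph_auto E"
  by (simp add: graph_auto_def)

lemma ck_family_gauge:
  assumes z: "cmod z = 1"
  shows "ck_family E A P (\<lambda>e. z \<odot> S e)"
proof (rule ck_family_twisted[OF id_graph_auto])
  have "cnj z * z = 1" "z * cnj z = 1"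
    using z complex_norm_square[of z] by (simp_all add: mult.commute)
  then show "z \<odot> \<one> \<in> U_group E A P"
    by (auto simp: U_group_def unitaries_def adj_smult smult_mult_l smult_mult_r smult_smult)
qed (auto simp: smult_mult_l)

abbreviation \<gamma> :: "complex \<Rightarrow> 'a \<Rightarrow> 'a" where "\<gamma> \<equiv> gauge E A P S"

lemma gauge_hom: "cmod z = 1 \<Longrightarrow> \<gamma> z \<in> star_hom A A"
  and gauge_extensional: "cmod z = 1 \<Longrightarrow> \<gamma> z \<in> extensional (carrier A)"
  and gauge_P: "\<lbrakk>cmod z = 1; v \<in> verts E\<rbrakk> \<Longrightarrow> \<gamma> z (P v) = P v"
  and gauge_S: "\<lbrakk>cmod z = 1; e \<in> arcs E\<rbrakk> \<Longrightarrow> \<gamma> z (S e) = z \<odot> S e"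
  unfolding gauge_def by (rule graph_endo[OF ck_family_gauge]; assumption)+

lemma gauge_closed [simp]: "\<lbrakk>cmod z = 1; x \<in> carrier A\<rbrakk> \<Longrightarrow> \<gamma> z x \<in> carrier A"
  by (rule star_homD(1)[OF gauge_hom])

lemma gauge_one: "cmod z = 1 \<Longrightarrow> \<gamma> z \<one> = \<one>"
proof -
  assume z: "cmod z = 1"
  have "\<gamma> z (\<Oplus>v\<in>verts E. P v) = (\<Oplus>v\<in>verts E. \<gamma> z (P v))"
    by (rule star_hom_finsum[OF gauge_hom[OF z]]) auto
  also have "\<dots> = (\<Oplus>v\<in>verts E. P v)" by (rule M.finsum_cong') (auto simp: gauge_P z)
  finally show ?thesis by (simp add: sum_P)
qed

lemma gauge_contractive: "\<lbrakk>cmod z = 1; x \<in> carrier A\<rbrakk> \<Longrightarrow> cnorm A (\<gamma> z x) \<le> cnorm A x"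
  by (rule unital_star_hom_contractive[OF gauge_hom gauge_one])

lemma gauge_gauge:
  assumes z: "cmod z = 1" and w: "cmod w = 1" and x: "x \<in> carrier A"
  shows "\<gamma> z (\<gamma> w x) = \<gamma> (z * w) x"
proof -
  have zw: "cmod (z * w) = 1" using z w by (simp add: norm_mult)
  have "compose (carrier A) (\<gamma> z) (\<gamma> w) = \<gamma> (z * w)"
    by (rule star_hom_eqI[OF ck_family_gauge[OF zw]])
      (use z w zw in \<open>auto simp: compose_eq gauge_P gauge_S star_homD(4)[OF gauge_hom] smult_smult
        mult.commute[of w z] gauge_hom gauge_extensional intro!: star_hom_compose\<close>)
  then show ?thesis using x by (metis compose_eq)
qed

lemma gauge_by_one: "x \<in> carrier A \<Longrightarrow> \<gamma> 1 x = x"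
proof -
  assume x: "x \<in> carrier A"
  have "\<gamma> 1 = (\<lambda>x\<in>carrier A. x)"
    by (rule star_hom_eqI[OF ck_family_gauge[of 1]])
      (auto simp: gauge_P gauge_S gauge_hom gauge_extensional id_star_hom)
  then show ?thesis using x by simp
qed


section \<open>Approximation by homogeneous elements\<close>

subsection \<open>Matrix units\<close>

definition mu :: "'v \<times> 'e list \<Rightarrow> 'v \<times> 'e list \<Rightarrow> 'a" where
  "mu \<alpha> \<beta> = T \<alpha> \<otimes> (T \<beta>)\<^sup>\<star>"

lemma mu_closed [simp]: "\<lbrakk>\<alpha> \<in> paths E a; \<beta> \<in> paths E b\<rbrakk> \<Longrightarrow> mu \<alpha> \<beta> \<in> carrier A"
  by (simp add: mu_def)

lemma mu_self: "mu \<alpha> \<alpha> = cyl \<alpha>"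
  by (simp add: mu_def cyl_def)

lemma mu_star: "\<lbrakk>\<alpha> \<in> paths E a; \<beta> \<in> paths E b\<rbrakk> \<Longrightarrow> (mu \<alpha> \<beta>)\<^sup>\<star> = mu \<beta> \<alpha>"
  by (simp add: mu_def adj_mult)

lemma mu_blocks:
  assumes "\<alpha> \<in> paths E a" "\<beta> \<in> paths E b" "\<alpha>' \<in> paths E a" "\<beta>' \<in> paths E b"
  shows "cyl \<alpha>' \<otimes> mu \<alpha> \<beta> \<otimes> cyl \<beta>' = (if \<alpha>' = \<alpha> \<and> \<beta>' = \<beta> then mu \<alpha> \<beta> else \<zero>)"
proof -
  have "cyl \<alpha>' \<otimes> mu \<alpha> \<beta> \<otimes> cyl \<beta>' = (cyl \<alpha>' \<otimes> T \<alpha>) \<otimes> ((T \<beta>)\<^sup>\<star> \<otimes> cyl \<beta>')"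
    using assms by (simp add: mu_def m_assoc)
  then show ?thesis
    using assms by (auto simp: cyl_T[of _ a] T_star_cyl[of _ b] mu_def)
qed

lemma mu_mult:
  assumes "\<alpha> \<in> paths E a" "\<beta> \<in> paths E b" "\<beta>' \<in> paths E b" "\<delta> \<in> paths E d"
  shows "mu \<alpha> \<beta> \<otimes> mu \<beta>' \<delta> = (if \<beta> = \<beta>' \<and> path_range \<beta> = path_range \<alpha> then mu \<alpha> \<delta> else \<zero>)"
proof -
  have "mu \<alpha> \<beta> \<otimes> mu \<beta>' \<delta> = T \<alpha> \<otimes> ((T \<beta>)\<^sup>\<star> \<otimes> T \<beta>') \<otimes> (T \<delta>)\<^sup>\<star>"
    using assms by (simp add: mu_def m_assoc)
  moreover have "T \<alpha> \<otimes> P v = (if v = path_range \<alpha> then T \<alpha> else \<zero>)" if "v \<in> verts E" for v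
  proof (cases "v = path_range \<alpha>")
    case False
    have r: "path_range \<alpha> \<in> verts E" using assms(1) by simp
    have "T \<alpha> \<otimes> P v = T \<alpha> \<otimes> (P (path_range \<alpha>) \<otimes> P v)"
      using assms(1) r that T_P_range[OF assms(1)] by (simp flip: m_assoc)
    then show ?thesis using P_orthogonal[OF r that] False assms(1) by simp
  qed (use assms(1) T_P_range in simp)
  ultimately show ?thesis using assms by (simp add: T_star_T mu_def)
qed

lemma mu_eq_zero:
  assumes "\<alpha> \<in> paths E a" "\<beta> \<in> paths E b" "path_range \<alpha> \<noteq> path_range \<beta>"
  shows "mu \<alpha> \<beta> = \<zero>"
proof (rule adj_mult_self_eq_zero)
  show "(mu \<alpha> \<beta>)\<^sup>\<star> \<otimes> mu \<alpha> \<beta> = \<zero>"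
    using assms by (simp add: mu_star mu_mult)
qed (use assms in simp)

text \<open>The combinations of the matrix units \<open>S\<^sub>\<alpha> S\<^sub>\<beta>\<^sup>*\<close> with \<open>|\<alpha>| = a\<close>, \<open>|\<beta>| = b\<close> and
  coefficients in \<open>R\<close>. The description by blocks spares the choice of coefficients, which are not unique
  where a matrix unit vanishes.\<close>
definition mspan :: "complex set \<Rightarrow> nat \<Rightarrow> nat \<Rightarrow> 'a set" where
  "mspan R a b = {x \<in> carrier A.
     \<forall>\<alpha>\<in>paths E a. \<forall>\<beta>\<in>paths E b. \<exists>c\<in>R. cyl \<alpha> \<otimes> x \<otimes> cyl \<beta> = c \<odot> mu \<alpha> \<beta>}"

lemma mspan_closed: "x \<in> mspan R a b \<Longrightarrow> x \<in> carrier A"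
  by (simp add: mspan_def)

lemma mspanD:
  assumes "x \<in> mspan R a b" "\<alpha> \<in> paths E a" "\<beta> \<in> paths E b"
  obtains c where "c \<in> R" "cyl \<alpha> \<otimes> x \<otimes> cyl \<beta> = c \<odot> mu \<alpha> \<beta>"
  using assms by (auto simp: mspan_def)

lemma zero_in_mspan: "star_semiring R \<Longrightarrow> \<zero> \<in> mspan R a b"
  by (auto simp: mspan_def star_semiring_def intro!: bexI[of _ 0])

lemma mu_in_mspan:
  assumes "star_semiring R" "\<alpha> \<in> paths E a" "\<beta> \<in> paths E b"
  shows "mu \<alpha> \<beta> \<in> mspan R a b"
  unfolding mspan_def
proof (intro CollectI conjI ballI)
  fix \<alpha>' \<beta>' assume *: "\<alpha>' \<in> paths E a" "\<beta>' \<in> paths E b"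
  have "cyl \<alpha>' \<otimes> mu \<alpha> \<beta> \<otimes> cyl \<beta>' = (if \<alpha>' = \<alpha> \<and> \<beta>' = \<beta> then 1 else 0) \<odot> mu \<alpha>' \<beta>'"
    unfolding mu_blocks[OF assms(2,3) *] using * by (cases "\<alpha>' = \<alpha> \<and> \<beta>' = \<beta>") auto
  then show "\<exists>c\<in>R. cyl \<alpha>' \<otimes> mu \<alpha> \<beta> \<otimes> cyl \<beta>' = c \<odot> mu \<alpha>' \<beta>'"
    using assms(1) by (auto simp: star_semiring_def)
qed (use assms in simp)

lemma mspan_add:
  assumes R: "star_semiring R" and x: "x \<in> mspan R a b" and y: "y \<in> mspan R a b"
  shows "x \<oplus> y \<in> mspan R a b"
  unfolding mspan_def
proof (intro CollectI conjI ballI)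
  note c = mspan_closed[OF x] mspan_closed[OF y]
  then show "x \<oplus> y \<in> carrier A" by simp
  fix \<alpha> \<beta> assume *: "\<alpha> \<in> paths E a" "\<beta> \<in> paths E b"
  obtain k l where kl: "k \<in> R" "cyl \<alpha> \<otimes> x \<otimes> cyl \<beta> = k \<odot> mu \<alpha> \<beta>"
      "l \<in> R" "cyl \<alpha> \<otimes> y \<otimes> cyl \<beta> = l \<odot> mu \<alpha> \<beta>"
    using mspanD[OF x *] mspanD[OF y *] by metis
  then have "cyl \<alpha> \<otimes> (x \<oplus> y) \<otimes> cyl \<beta> = (k + l) \<odot> mu \<alpha> \<beta>"
    using * c by (simp add: mult_distr_l mult_distr_r smult_add_left)
  then show "\<exists>c\<in>R. cyl \<alpha> \<otimes> (x \<oplus> y) \<otimes> cyl \<beta> = c \<odot> mu \<alpha> \<beta>"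
    using kl R by (auto simp: star_semiring_def)
qed

lemma mspan_smult:
  assumes R: "star_semiring R" "k \<in> R" and x: "x \<in> mspan R a b"
  shows "k \<odot> x \<in> mspan R a b"
  unfolding mspan_def
proof (intro CollectI conjI ballI)
  note c = mspan_closed[OF x]
  then show "k \<odot> x \<in> carrier A" by simp
  fix \<alpha> \<beta> assume *: "\<alpha> \<in> paths E a" "\<beta> \<in> paths E b"
  obtain l where l: "l \<in> R" "cyl \<alpha> \<otimes> x \<otimes> cyl \<beta> = l \<odot> mu \<alpha> \<beta>" using mspanD[OF x *] .
  then have "cyl \<alpha> \<otimes> (k \<odot> x) \<otimes> cyl \<beta> = (k * l) \<odot> mu \<alpha> \<beta>"
    using * c by (simp add: smult_mult_l smult_mult_r smult_smult)
  then show "\<exists>c\<in>R. cyl \<alpha> \<otimes> (k \<odot> x) \<otimes> cyl \<beta> = c \<odot> mu \<alpha> \<beta>"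
    using l R by (auto simp: star_semiring_def)
qed

lemma mspan_star:
  assumes R: "star_semiring R" and x: "x \<in> mspan R a b"
  shows "x\<^sup>\<star> \<in> mspan R b a"
  unfolding mspan_def
proof (intro CollectI conjI ballI)
  note c = mspan_closed[OF x]
  then show "x\<^sup>\<star> \<in> carrier A" by simp
  fix \<beta> \<alpha> assume *: "\<beta> \<in> paths E b" "\<alpha> \<in> paths E a"
  obtain l where l: "l \<in> R" "cyl \<alpha> \<otimes> x \<otimes> cyl \<beta> = l \<odot> mu \<alpha> \<beta>" using mspanD[OF x *(2,1)] .
  have "cyl \<beta> \<otimes> x\<^sup>\<star> \<otimes> cyl \<alpha> = (cyl \<alpha> \<otimes> x \<otimes> cyl \<beta>)\<^sup>\<star>"
    using * c by (simp add: adj_mult m_assoc)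
  also have "\<dots> = cnj l \<odot> mu \<beta> \<alpha>" unfolding l(2) using * by (simp add: adj_smult mu_star)
  finally show "\<exists>c\<in>R. cyl \<beta> \<otimes> x\<^sup>\<star> \<otimes> cyl \<alpha> = c \<odot> mu \<beta> \<alpha>"
    using l R by (auto simp: star_semiring_def)
qed

lemma block_of_product:
  assumes x: "x \<in> carrier A" and y: "y \<in> carrier A" and \<alpha>: "\<alpha> \<in> paths E a" and \<delta>: "\<delta> \<in> paths E d"
  shows "cyl \<alpha> \<otimes> (x \<otimes> y) \<otimes> cyl \<delta>
    = (\<Oplus>\<beta>\<in>paths E b. (cyl \<alpha> \<otimes> x \<otimes> cyl \<beta>) \<otimes> (cyl \<beta> \<otimes> y \<otimes> cyl \<delta>))"
proof -
  have "cyl \<alpha> \<otimes> (x \<otimes> y) \<otimes> cyl \<delta> = (cyl \<alpha> \<otimes> x) \<otimes> (\<Oplus>\<beta>\<in>paths E b. cyl \<beta>) \<otimes> (y \<otimes> cyl \<delta>)"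
    using assms by (simp add: sum_cyl m_assoc)
  also have "(cyl \<alpha> \<otimes> x) \<otimes> (\<Oplus>\<beta>\<in>paths E b. cyl \<beta>) = (\<Oplus>\<beta>\<in>paths E b. (cyl \<alpha> \<otimes> x) \<otimes> cyl \<beta>)"
    by (rule finsum_mult_left) (use assms in auto)
  also have "\<dots> \<otimes> (y \<otimes> cyl \<delta>) = (\<Oplus>\<beta>\<in>paths E b. (cyl \<alpha> \<otimes> x) \<otimes> cyl \<beta> \<otimes> (y \<otimes> cyl \<delta>))"
    by (rule finsum_mult_right) (use assms in auto)
  also have "\<dots> = (\<Oplus>\<beta>\<in>paths E b. (cyl \<alpha> \<otimes> x \<otimes> cyl \<beta>) \<otimes> (cyl \<beta> \<otimes> y \<otimes> cyl \<delta>))"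
  proof (rule M.finsum_cong')
    fix \<beta> assume \<beta>: "\<beta> \<in> paths E b"
    have "cyl \<beta> \<otimes> (cyl \<beta> \<otimes> (y \<otimes> cyl \<delta>)) = cyl \<beta> \<otimes> (y \<otimes> cyl \<delta>)"
      using cyl_mult[OF \<beta> \<beta>] \<beta> \<delta> y by (simp flip: m_assoc)
    then show "(cyl \<alpha> \<otimes> x) \<otimes> cyl \<beta> \<otimes> (y \<otimes> cyl \<delta>) = (cyl \<alpha> \<otimes> x \<otimes> cyl \<beta>) \<otimes> (cyl \<beta> \<otimes> y \<otimes> cyl \<delta>)"
      using \<alpha> \<beta> \<delta> x y by (simp add: m_assoc)
  qed (use assms in auto)
  finally show ?thesis .
qed

lemma mspan_mult:
  assumes R: "star_semiring R" and x: "x \<in> mspan R a b" and y: "y \<in> mspan R b d"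
  shows "x \<otimes> y \<in> mspan R a d"
  unfolding mspan_def
proof (intro CollectI conjI ballI)
  note c = mspan_closed[OF x] mspan_closed[OF y]
  then show "x \<otimes> y \<in> carrier A" by simp
  fix \<alpha> \<delta> assume *: "\<alpha> \<in> paths E a" "\<delta> \<in> paths E d"
  have "\<exists>c\<in>R. (cyl \<alpha> \<otimes> x \<otimes> cyl \<beta>) \<otimes> (cyl \<beta> \<otimes> y \<otimes> cyl \<delta>) = c \<odot> mu \<alpha> \<delta>"
    if \<beta>: "\<beta> \<in> paths E b" for \<beta>
  proof -
    obtain k where k: "k \<in> R" "cyl \<alpha> \<otimes> x \<otimes> cyl \<beta> = k \<odot> mu \<alpha> \<beta>" using mspanD[OF x *(1) \<beta>] .
    obtain l where l: "l \<in> R" "cyl \<beta> \<otimes> y \<otimes> cyl \<delta> = l \<odot> mu \<beta> \<delta>" using mspanD[OF y \<beta> *(2)] .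
    have "(cyl \<alpha> \<otimes> x \<otimes> cyl \<beta>) \<otimes> (cyl \<beta> \<otimes> y \<otimes> cyl \<delta>) = (k * l) \<odot> (mu \<alpha> \<beta> \<otimes> mu \<beta> \<delta>)"
      unfolding k(2) l(2) using * \<beta>
      by (simp add: smult_mult_l smult_mult_r smult_smult mult.commute[of l k])
    also have "\<dots> = (if path_range \<beta> = path_range \<alpha> then k * l else 0) \<odot> mu \<alpha> \<delta>"
      using * \<beta> mu_mult[OF *(1) \<beta> \<beta> *(2)] by simp
    finally show ?thesis using k(1) l(1) R by (auto simp: star_semiring_def split: if_splits)
  qed
  moreover have "0 \<in> R" "\<And>c d. \<lbrakk>c \<in> R; d \<in> R\<rbrakk> \<Longrightarrow> c + d \<in> R"
    using R by (simp_all add: star_semiring_def)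
  ultimately show "\<exists>c\<in>R. cyl \<alpha> \<otimes> (x \<otimes> y) \<otimes> cyl \<delta> = c \<odot> mu \<alpha> \<delta>"
    unfolding block_of_product[OF c *, of b] using mu_closed[OF *]
    by (intro finsum_scalar_multiple[OF finite_paths])
qed

lemma snoc_path:
  assumes "\<alpha>' \<in> paths E (Suc k)"
  obtains \<alpha> e where "\<alpha> \<in> paths E k" "e \<in> arcs E" "tail E e = path_range \<alpha>"
    "\<alpha>' = (fst \<alpha>, snd \<alpha> @ [e])" "T \<alpha>' = T \<alpha> \<otimes> S e" "\<alpha> = (fst \<alpha>', butlast (snd \<alpha>'))"
proof -
  obtain u p where \<alpha>': "\<alpha>' = (u, p)" by (cases \<alpha>')
  then obtain q e where q: "p = q @ [e]" "(u, q) \<in> paths E k" "e \<in> arcs E" "tail E e = awlast u q"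
    using assms by (auto simp: paths_Suc_snoc)
  show ?thesis
  proof (rule that)
    show "\<alpha>' = (fst (u, q), snd (u, q) @ [e])" by (simp add: \<alpha>' q(1))
    show "T \<alpha>' = T (u, q) \<otimes> S e" unfolding \<alpha>' q(1) by (rule T_snoc[OF q(2-4)])
    show "(u, q) = (fst \<alpha>', butlast (snd \<alpha>'))" by (simp add: \<alpha>' q(1))
  qed (use q(2-4) in simp_all)
qed

text \<open>Matrix units of one level are sums of matrix units of the next.\<close>
lemma mspan_Suc:
  assumes R: "star_semiring R" and x: "x \<in> mspan R a b"
  shows "x \<in> mspan R (Suc a) (Suc b)"
  unfolding mspan_def
proof (intro CollectI conjI ballI)
  note c = mspan_closed[OF x]
  then show "x \<in> carrier A" by simp
  fix \<alpha>' \<beta>' assume *: "\<alpha>' \<in> paths E (Suc a)" "\<beta>' \<in> paths E (Suc b)"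
  obtain \<alpha> e where \<alpha>: "\<alpha> \<in> paths E a" "e \<in> arcs E" "tail E e = path_range \<alpha>" "T \<alpha>' = T \<alpha> \<otimes> S e"
    using snoc_path[OF *(1)] by metis
  obtain \<beta> f where \<beta>: "\<beta> \<in> paths E b" "f \<in> arcs E" "tail E f = path_range \<beta>" "T \<beta>' = T \<beta> \<otimes> S f"
    using snoc_path[OF *(2)] by metis
  obtain k where k: "k \<in> R" "cyl \<alpha> \<otimes> x \<otimes> cyl \<beta> = k \<odot> mu \<alpha> \<beta>" using mspanD[OF x \<alpha>(1) \<beta>(1)] .
  define l where "l = (if e = f then k else 0)"
  have lR: "l \<in> R" using k(1) R by (auto simp: l_def star_semiring_def)
  have T\<alpha>: "(T \<alpha>')\<^sup>\<star> \<otimes> cyl \<alpha> = (T \<alpha>')\<^sup>\<star>"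
    using \<alpha> T_star_cyl[OF \<alpha>(1,1)] by (simp add: adj_mult m_assoc)
  have T\<beta>: "cyl \<beta> \<otimes> T \<beta>' = T \<beta>'"
    using \<beta> cyl_T[OF \<beta>(1,1)] by (simp flip: m_assoc)
  have Sa: "(T \<alpha>')\<^sup>\<star> \<otimes> T \<alpha> = (S e)\<^sup>\<star>"
  proof -
    have "(T \<alpha>')\<^sup>\<star> \<otimes> T \<alpha> = (S e)\<^sup>\<star> \<otimes> P (tail E e)"
      using \<alpha> T_star_T_self[OF \<alpha>(1)] by (simp add: adj_mult m_assoc)
    also have "\<dots> = (P (tail E e) \<otimes> S e)\<^sup>\<star>" using \<alpha>(2) by (simp add: adj_mult)
    finally show ?thesis using \<alpha>(2) by (simp add: P_tail_S)
  qed
  have Sb: "(T \<beta>)\<^sup>\<star> \<otimes> T \<beta>' = S f"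
    using \<beta> T_star_T_self[OF \<beta>(1)] P_tail_S[OF \<beta>(2)] by (simp flip: m_assoc)
  have "(T \<alpha>')\<^sup>\<star> \<otimes> x \<otimes> T \<beta>' = (T \<alpha>')\<^sup>\<star> \<otimes> (cyl \<alpha> \<otimes> x \<otimes> cyl \<beta>) \<otimes> T \<beta>'"
  proof -
    have "(T \<alpha>')\<^sup>\<star> \<otimes> x \<otimes> T \<beta>' = ((T \<alpha>')\<^sup>\<star> \<otimes> cyl \<alpha>) \<otimes> x \<otimes> (cyl \<beta> \<otimes> T \<beta>')"
      unfolding T\<alpha> T\<beta> ..
    also have "\<dots> = (T \<alpha>')\<^sup>\<star> \<otimes> (cyl \<alpha> \<otimes> x \<otimes> cyl \<beta>) \<otimes> T \<beta>'"
      using * \<alpha>(1) \<beta>(1) c by (simp add: m_assoc)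
    finally show ?thesis .
  qed
  also have "\<dots> = k \<odot> (((T \<alpha>')\<^sup>\<star> \<otimes> T \<alpha>) \<otimes> ((T \<beta>)\<^sup>\<star> \<otimes> T \<beta>'))"
    unfolding k(2) mu_def using * \<alpha>(1) \<beta>(1) by (simp add: smult_mult_l smult_mult_r m_assoc)
  also have "\<dots> = (if e = f then k else 0) \<odot> P (head E e)"
    unfolding Sa Sb using \<alpha>(2) \<beta>(2) by (simp add: S_star_S S_orthogonal)
  finally have 1: "(T \<alpha>')\<^sup>\<star> \<otimes> x \<otimes> T \<beta>' = l \<odot> P (head E e)" unfolding l_def .
  have TP: "T \<alpha>' \<otimes> P (head E e) = T \<alpha>'"
    unfolding \<alpha>(4) using \<alpha>(1,2) by (simp add: m_assoc S_P_head)
  have "cyl \<alpha>' \<otimes> x \<otimes> cyl \<beta>' = T \<alpha>' \<otimes> ((T \<alpha>')\<^sup>\<star> \<otimes> x \<otimes> T \<beta>') \<otimes> (T \<beta>')\<^sup>\<star>"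
    unfolding cyl_def using * c by (simp add: m_assoc)
  also have "\<dots> = l \<odot> (T \<alpha>' \<otimes> P (head E e) \<otimes> (T \<beta>')\<^sup>\<star>)"
    unfolding 1 using * \<alpha>(2) by (simp add: smult_mult_l smult_mult_r)
  also have "T \<alpha>' \<otimes> P (head E e) \<otimes> (T \<beta>')\<^sup>\<star> = mu \<alpha>' \<beta>'"
    using arg_cong[OF TP, of "\<lambda>t. t \<otimes> (T \<beta>')\<^sup>\<star>"] mu_def[of \<alpha>' \<beta>'] by (rule trans[OF _ sym])
  finally show "\<exists>c\<in>R. cyl \<alpha>' \<otimes> x \<otimes> cyl \<beta>' = c \<odot> mu \<alpha>' \<beta>'"
    using lR by blast
qed

lemma mspan_raise: "\<lbrakk>star_semiring R; x \<in> mspan R a b\<rbrakk> \<Longrightarrow> x \<in> mspan R (a + n) (b + n)"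
  by (induct n) (simp_all add: mspan_Suc)

subsection \<open>Homogeneous elements\<close>

definition homog :: "int \<Rightarrow> 'a set" where
  "homog m = (\<Union>{mspan UNIV a b | a b. int a - int b = m})"

lemma homogI: "\<lbrakk>x \<in> mspan UNIV a b; int a - int b = m\<rbrakk> \<Longrightarrow> x \<in> homog m"
  unfolding homog_def by blast

lemma homogE:
  assumes "x \<in> homog m"
  obtains a b where "x \<in> mspan UNIV a b" "int a - int b = m"
  using assms unfolding homog_def by blast

lemma homog_closed: "x \<in> homog m \<Longrightarrow> x \<in> carrier A"
  by (erule homogE) (rule mspan_closed)

lemma zero_in_homog: "\<zero> \<in> homog m"
proof (rule homogI)
  show "\<zero> \<in> mspan UNIV (nat m) (nat (- m))" by (rule zero_in_mspan[OF star_semiring_UNIV])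
qed simp

lemma homog_add:
  assumes "x \<in> homog m" "y \<in> homog m"
  shows "x \<oplus> y \<in> homog m"
proof -
  obtain a b where x: "x \<in> mspan UNIV a b" "int a - int b = m" using homogE[OF assms(1)] .
  obtain c d where y: "y \<in> mspan UNIV c d" "int c - int d = m" using homogE[OF assms(2)] .
  have "c + b = a + d" using x(2) y(2) by simp
  then have "y \<in> mspan UNIV (a + d) (b + d)"
    using mspan_raise[OF star_semiring_UNIV y(1), of b] by (simp add: add.commute)
  then have "x \<oplus> y \<in> mspan UNIV (a + d) (b + d)"
    by (rule mspan_add[OF star_semiring_UNIV mspan_raise[OF star_semiring_UNIV x(1)]])
  then show ?thesis by (rule homogI) (use x(2) in simp)
qed

lemma homog_smult: "x \<in> homog m \<Longrightarrow> c \<odot> x \<in> homog m"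
  by (erule homogE) (rule homogI[OF mspan_smult[OF star_semiring_UNIV]], auto)

lemma homog_star: "x \<in> homog m \<Longrightarrow> x\<^sup>\<star> \<in> homog (- m)"
  by (erule homogE) (rule homogI[OF mspan_star[OF star_semiring_UNIV]], auto)

lemma homog_mult:
  assumes "x \<in> homog m" "y \<in> homog n"
  shows "x \<otimes> y \<in> homog (m + n)"
proof -
  obtain a b where x: "x \<in> mspan UNIV a b" "int a - int b = m" using homogE[OF assms(1)] .
  obtain c d where y: "y \<in> mspan UNIV c d" "int c - int d = n" using homogE[OF assms(2)] .
  have "y \<in> mspan UNIV (b + c) (d + b)"
    using mspan_raise[OF star_semiring_UNIV y(1), of b] by (simp add: add.commute)
  then have "x \<otimes> y \<in> mspan UNIV (a + c) (d + b)"
    by (rule mspan_mult[OF star_semiring_UNIV mspan_raise[OF star_semiring_UNIV x(1)]])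
  then show ?thesis by (rule homogI) (use x(2) y(2) in simp)
qed

lemma gauge_T: "\<lbrakk>cmod z = 1; \<alpha> \<in> paths E k\<rbrakk> \<Longrightarrow> \<gamma> z (T \<alpha>) = z ^ k \<odot> T \<alpha>"
proof (induct k arbitrary: \<alpha>)
  case 0
  then show ?case by (auto simp: paths_0 gauge_P)
next
  case (Suc k)
  then obtain e q where \<alpha>: "\<alpha> = (tail E e, e # q)" "e \<in> arcs E" "(head E e, q) \<in> paths E k"
    by (cases \<alpha>) (auto simp: paths_Suc_Cons)
  have T: "T \<alpha> = S e \<otimes> T (head E e, q)" unfolding \<alpha>(1) by (rule T_Cons[OF \<alpha>(2)])
  have "\<gamma> z (T \<alpha>) = (z \<odot> S e) \<otimes> (z ^ k \<odot> T (head E e, q))"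
    unfolding T using Suc(1)[OF Suc(2) \<alpha>(3)] \<alpha>(2,3) Suc(2)
    by (simp add: star_homD(3)[OF gauge_hom] gauge_S)
  then show ?case unfolding T using \<alpha>(2,3) by (simp add: smult_mult_l smult_mult_r smult_smult mult.commute)
qed

lemma gauge_mspan:
  assumes z: "cmod z = 1" and x: "x \<in> mspan R a b"
  shows "\<gamma> z x = (z ^ a * cnj z ^ b) \<odot> x"
proof (rule eq_if_blocks_eq[of _ _ a b])
  note c = mspan_closed[OF x]
  show "\<gamma> z x \<in> carrier A" "(z ^ a * cnj z ^ b) \<odot> x \<in> carrier A" using z c by auto
  have zz: "z ^ k * cnj z ^ k = 1" for k
    using complex_norm_square[of z] z by (simp flip: power_mult_distrib)
  have g_mu: "\<gamma> z (mu \<alpha> \<beta>) = (z ^ k * cnj z ^ l) \<odot> mu \<alpha> \<beta>"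
    if "\<alpha> \<in> paths E k" "\<beta> \<in> paths E l" for \<alpha> \<beta> k l
    using that z
    by (simp add: mu_def star_homD(3,5)[OF gauge_hom] gauge_T adj_smult smult_mult_l smult_mult_r
        smult_smult mult.commute)
  have g_cyl: "\<gamma> z (cyl \<alpha>) = cyl \<alpha>" if "\<alpha> \<in> paths E k" for \<alpha> k
    using g_mu[OF that that] that zz[of k] by (simp add: mu_self)
  fix \<alpha> \<beta> assume *: "\<alpha> \<in> paths E a" "\<beta> \<in> paths E b"
  obtain k where k: "cyl \<alpha> \<otimes> x \<otimes> cyl \<beta> = k \<odot> mu \<alpha> \<beta>" using mspanD[OF x *] .
  have "cyl \<alpha> \<otimes> \<gamma> z x \<otimes> cyl \<beta> = \<gamma> z (cyl \<alpha> \<otimes> x \<otimes> cyl \<beta>)"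
    using * c z g_cyl by (simp add: star_homD(3)[OF gauge_hom])
  also have "\<dots> = (z ^ a * cnj z ^ b) \<odot> (cyl \<alpha> \<otimes> x \<otimes> cyl \<beta>)"
    unfolding k using * g_mu[OF *] z
    by (simp add: star_homD(4)[OF gauge_hom] smult_smult mult.commute)
  also have "\<dots> = cyl \<alpha> \<otimes> ((z ^ a * cnj z ^ b) \<odot> x) \<otimes> cyl \<beta>"
    using * c by (simp add: smult_mult_l smult_mult_r)
  finally show "cyl \<alpha> \<otimes> \<gamma> z x \<otimes> cyl \<beta> = cyl \<alpha> \<otimes> ((z ^ a * cnj z ^ b) \<odot> x) \<otimes> cyl \<beta>" .
qed

lemma gauge_homog:
  assumes "x \<in> homog m"
  shows "\<gamma> (cis t) x = cis (t * of_int m) \<odot> x"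
proof -
  obtain a b where x: "x \<in> mspan UNIV a b" "int a - int b = m" using homogE[OF assms] .
  have m: "real_of_int m = real a - real b" using x(2) by auto
  have "cis t ^ a * cnj (cis t) ^ b = cis (t * of_int m)"
    unfolding cis_cnj Complex.DeMoivre cis_mult m by (simp add: algebra_simps)
  then show ?thesis using gauge_mspan[OF _ x(1), of "cis t"] by simp
qed

lemma mspan_in_core: "x \<in> mspan R a a \<Longrightarrow> x \<in> core E A P S"
proof -
  assume x: "x \<in> mspan R a a"
  have "\<gamma> z x = x" if z: "cmod z = 1" for z
    using gauge_mspan[OF z x] complex_norm_square[of z] z mspan_closed[OF x]
    by (simp flip: power_mult_distrib)
  then show ?thesis using mspan_closed[OF x] by (simp add: core_def)
qed


subsection \<open>Spectral projections of the gauge action\<close>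

text \<open>Averaging over the \<open>N\<close>-th roots of unity instead of the circle avoids integrals. It separates
  degrees only modulo \<open>N\<close>, which is enough for a sum of finitely many homogeneous elements.\<close>
definition spectral :: "nat \<Rightarrow> int \<Rightarrow> 'a \<Rightarrow> 'a" where
  "spectral N m x = complex_of_real (1 / real N) \<odot>
     (\<Oplus>j\<in>{..<N}. cis (- (2 * pi * real j / real N * of_int m)) \<odot> \<gamma> (cis (2 * pi * real j / real N)) x)"

lemma spectral_closed [simp]: "x \<in> carrier A \<Longrightarrow> spectral N m x \<in> carrier A"
  by (auto simp: spectral_def intro!: smult_closed' M.finsum_closed)

lemma spectral_add:
  assumes "x \<in> carrier A" "y \<in> carrier A"
  shows "spectral N m (x \<oplus> y) = spectral N m x \<oplus> spectral N m y"
proof -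
  let ?f = "\<lambda>x j. cis (- (2 * pi * real j / real N * of_int m)) \<odot> \<gamma> (cis (2 * pi * real j / real N)) x"
  have f: "?f x \<in> {..<N} \<rightarrow> carrier A" if "x \<in> carrier A" for x using that by auto
  have "(\<Oplus>j\<in>{..<N}. ?f (x \<oplus> y) j) = (\<Oplus>j\<in>{..<N}. ?f x j \<oplus> ?f y j)"
    by (rule M.finsum_cong') (use assms in \<open>auto simp: star_homD(2)[OF gauge_hom] smult_add_right\<close>)
  also have "\<dots> = (\<Oplus>j\<in>{..<N}. ?f x j) \<oplus> (\<Oplus>j\<in>{..<N}. ?f y j)"
    by (rule M.finsum_addf[OF f f]) (use assms in auto)
  finally show ?thesis
    unfolding spectral_def using M.finsum_closed[OF f] assms by (simp add: smult_add_right)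
qed

lemma spectral_eigen:
  assumes x: "x \<in> carrier A" and N: "N > 0" and d: "\<bar>d - m\<bar> < int N"
    and eigen: "\<And>j. j < N \<Longrightarrow> \<gamma> (cis (2 * pi * real j / real N)) x = cis (2 * pi * real j / real N * of_int d) \<odot> x"
  shows "spectral N m x = (if d = m then x else \<zero>)"
proof -
  have "(\<Oplus>j\<in>{..<N}. cis (- (2 * pi * real j / real N * of_int m)) \<odot> \<gamma> (cis (2 * pi * real j / real N)) x)
      = (\<Oplus>j\<in>{..<N}. cis (2 * pi * real j * of_int (d - m) / real N) \<odot> x)"
  proof (rule M.finsum_cong')
    fix j assume "j \<in> {..<N}"
    then have j: "j < N" by simp
    have "- (2 * pi * real j / real N * of_int m) + 2 * pi * real j / real N * of_int d
        = 2 * pi * real j * of_int (d - m) / real N"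
      using N by (simp add: field_simps)
    then show "cis (- (2 * pi * real j / real N * of_int m)) \<odot> \<gamma> (cis (2 * pi * real j / real N)) x
        = cis (2 * pi * real j * of_int (d - m) / real N) \<odot> x"
      unfolding eigen[OF j] smult_smult[OF x] cis_mult by (rule arg_cong)
  qed (use x in auto)
  also have "\<dots> = (\<Sum>j<N. cis (2 * pi * real j * of_int (d - m) / real N)) \<odot> x"
    by (rule finsum_smult_left) (use x in auto)
  also have "\<dots> = (if d - m = 0 then of_nat N else 0) \<odot> x"
    unfolding sum_roots_of_unity[OF d] ..
  finally show ?thesis
    unfolding spectral_def using N x by (simp add: smult_smult)
qed

lemma spectral_homog:
  assumes "x \<in> homog d" "N > 0" "\<bar>d - m\<bar> < int N"
  shows "spectral N m x = (if d = m then x else \<zero>)"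
  by (rule spectral_eigen[OF homog_closed]) (use assms gauge_homog in auto)

lemma spectral_contractive:
  assumes x: "x \<in> carrier A" and N: "N > 0"
  shows "cnorm A (spectral N m x) \<le> cnorm A x"
proof -
  let ?f = "\<lambda>j. cis (- (2 * pi * real j / real N * of_int m)) \<odot> \<gamma> (cis (2 * pi * real j / real N)) x"
  define s where "s = cnorm A (\<Oplus>j\<in>{..<N}. ?f j)"
  have "s \<le> (\<Sum>j<N. cnorm A (?f j))"
    unfolding s_def by (rule cnorm_finsum_le) (use x in auto)
  also have "\<dots> \<le> (\<Sum>j<N. cnorm A x)"
    by (rule sum_mono) (use x in \<open>auto simp: cnorm_smult gauge_contractive\<close>)
  finally have "s \<le> real N * cnorm A x" by simp
  moreover have "cnorm A (spectral N m x) = 1 / real N * s"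
    unfolding spectral_def s_def using x
    by (subst cnorm_smult) (auto intro!: M.finsum_closed simp del: of_real_divide)
  ultimately have "real N * cnorm A (spectral N m x) \<le> real N * cnorm A x" using N by simp
  then show ?thesis using N by (simp only: mult_le_cancel_left_pos of_nat_0_less_iff)
qed

text \<open>The finite sums of homogeneous elements; by induction over the number of summands, no ordering of
  the degrees has to be kept.\<close>
inductive_set poly :: "'a set" where
  poly_homog: "x \<in> homog m \<Longrightarrow> x \<in> poly"
| poly_add: "\<lbrakk>x \<in> poly; y \<in> poly\<rbrakk> \<Longrightarrow> x \<oplus> y \<in> poly"

lemma poly_closed: "x \<in> poly \<Longrightarrow> x \<in> carrier A"
  by (induct rule: poly.induct) (auto dest: homog_closed)

lemma poly_dense: "approximable poly = carrier A"
proof (rule dense_if_contains_generators)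
  show "poly \<subseteq> carrier A" using poly_closed by blast
  show "\<zero> \<in> poly" by (rule poly_homog[OF zero_in_homog])
  show "x \<oplus> y \<in> poly" if "x \<in> poly" "y \<in> poly" for x y using that by (rule poly_add)
  show "c \<odot> x \<in> poly" if "x \<in> poly" for c x
    using that
    by (induct rule: poly.induct) (auto simp: smult_add_right poly_closed intro: poly.intros homog_smult)
  show "x\<^sup>\<star> \<in> poly" if "x \<in> poly" for x
    using that
    by (induct rule: poly.induct) (auto simp: adj_add poly_closed intro: poly.intros homog_star)
  show "x \<otimes> y \<in> poly" if "x \<in> poly" "y \<in> poly" for x y
    using that
  proof (induct arbitrary: y rule: poly.induct)
    case (poly_homog x m)
    from poly_homog(2,1) show ?case
      by (induct rule: poly.induct)
        (auto simp: mult_distr_r poly_closed homog_closed intro: poly.intros homog_mult)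
  qed (auto simp: mult_distr_l poly_closed intro: poly.intros)
  have "P v \<in> homog 0" if v: "v \<in> verts E" for v
  proof (rule homogI)
    have "(v, []) \<in> paths E 0" using v by (simp add: paths_0)
    from mu_in_mspan[OF star_semiring_UNIV this this]
    show "P v \<in> mspan UNIV 0 0" using v by (simp add: mu_def)
  qed simp
  then show "P ` verts E \<subseteq> poly" by (auto intro: poly_homog)
  have "S e \<in> homog 1" if e: "e \<in> arcs E" for e
  proof (rule homogI)
    have 1: "(tail E e, [e]) \<in> paths E (Suc 0)" and 0: "(head E e, []) \<in> paths E 0"
      using e by (auto simp: paths_0 paths_Suc_Cons)
    from mu_in_mspan[OF star_semiring_UNIV 1 0]
    show "S e \<in> mspan UNIV (Suc 0) 0" using e by (simp add: mu_def S_P_head)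
  qed simp
  then show "S ` arcs E \<subseteq> poly" by (auto intro: poly_homog)
qed

text \<open>For \<open>N\<close> larger than twice every degree that occurs, no degree in the sum other than \<open>m\<close> is
  congruent to \<open>m\<close> modulo \<open>N\<close>.\<close>
lemma spectral_poly:
  assumes "x \<in> poly"
  shows "\<exists>L. \<forall>N > L. \<forall>m. 2 * \<bar>m\<bar> \<le> int N \<longrightarrow> spectral N m x \<in> homog m"
  using assms
proof (induct rule: poly.induct)
  case (poly_homog x d)
  have "spectral N m x \<in> homog m" if N: "N > 2 * nat \<bar>d\<bar>" and m: "2 * \<bar>m\<bar> \<le> int N" for N m
  proof -
    have "\<bar>d - m\<bar> < int N" using N m by linarith
    then have "spectral N m x = (if d = m then x else \<zero>)"
      by (intro spectral_homog[OF poly_homog]) (use N in auto)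
    then show ?thesis using poly_homog zero_in_homog by (cases "d = m") simp_all
  qed
  then show ?case by (intro exI[of _ "2 * nat \<bar>d\<bar>"]) simp
next
  case (poly_add x y)
  obtain L where L: "\<forall>N > L. \<forall>m. 2 * \<bar>m\<bar> \<le> int N \<longrightarrow> spectral N m x \<in> homog m"
    using poly_add(2) by (rule exE)
  obtain M where M: "\<forall>N > M. \<forall>m. 2 * \<bar>m\<bar> \<le> int N \<longrightarrow> spectral N m y \<in> homog m"
    using poly_add(4) by (rule exE)
  have "spectral N m (x \<oplus> y) \<in> homog m" if "N > max L M" "2 * \<bar>m\<bar> \<le> int N" for N m
    unfolding spectral_add[OF poly_closed[OF poly_add(1)] poly_closed[OF poly_add(3)]]
    by (rule homog_add) (use that L M in simp_all)
  then show ?case by (intro exI[of _ "max L M"]) simp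
qed

lemma spectral_approx:
  assumes x: "x \<in> carrier A" and \<epsilon>: "\<epsilon> > 0"
  obtains N where "N > 0"
    "\<forall>m. 2 * \<bar>m\<bar> \<le> int N \<longrightarrow> (\<exists>y\<in>homog m. cnorm A (spectral N m x \<ominus> y) < \<epsilon>)"
proof -
  have "x \<in> approximable poly" using x poly_dense by simp
  then obtain y where y: "y \<in> poly" "cnorm A (x \<ominus> y) < \<epsilon>" using \<epsilon> by (rule approximableD)
  obtain L where L: "\<And>N m. \<lbrakk>N > L; 2 * \<bar>m\<bar> \<le> int N\<rbrakk> \<Longrightarrow> spectral N m y \<in> homog m"
    using spectral_poly[OF y(1)] by blast
  note yA = poly_closed[OF y(1)]
  have "\<exists>y\<in>homog m. cnorm A (spectral (Suc L) m x \<ominus> y) < \<epsilon>" if m: "2 * \<bar>m\<bar> \<le> int (Suc L)" for m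
  proof (rule bexI)
    let ?p = "spectral (Suc L) m"
    have d: "x \<ominus> y \<in> carrier A" using x yA by simp
    have "x = (x \<ominus> y) \<oplus> y" using x yA by algebra
    then have "?p x = ?p (x \<ominus> y) \<oplus> ?p y" using spectral_add[OF d yA, of "Suc L" m] by metis
    then have "?p x \<ominus> ?p y = ?p (x \<ominus> y)" using add_diff_cancel_right spectral_closed d yA by metis
    then show "cnorm A (?p x \<ominus> ?p y) < \<epsilon>" using spectral_contractive[OF d, of "Suc L" m] y(2) by simp
    show "?p y \<in> homog m" by (rule L) (use m in auto)
  qed
  then show thesis by (intro that[of "Suc L"]) auto
qed

lemma core_approx:
  assumes x: "x \<in> core E A P S" and \<epsilon>: "\<epsilon> > 0"
  obtains k y where "y \<in> mspan UNIV k k" "cnorm A (x \<ominus> y) < \<epsilon>"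
proof -
  have xA: "x \<in> carrier A" using x by (simp add: core_def)
  obtain N where N: "N > 0" "\<forall>m. 2 * \<bar>m\<bar> \<le> int N \<longrightarrow> (\<exists>y\<in>homog m. cnorm A (spectral N m x \<ominus> y) < \<epsilon>)"
    using spectral_approx[OF xA \<epsilon>] .
  have "spectral N 0 x = x"
    using spectral_eigen[of x N 0 0] x xA N(1) by (simp add: core_def)
  then obtain y where y: "y \<in> homog 0" "cnorm A (x \<ominus> y) < \<epsilon>" using spec[OF N(2), of 0] by auto
  then show thesis using that by (elim homogE) auto
qed

text \<open>The eigenvalues of \<open>x\<close> form a character of the circle. Nothing is known about its continuity, but
  restricted to the \<open>N\<close>-th roots of unity it is \<open>z \<mapsto> z\<^sup>m\<close> for some \<open>m\<close>, so the \<open>m\<close>-th spectral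
  projection fixes \<open>x\<close>.\<close>
lemma eigenvector_approx:
  assumes x: "x \<in> carrier A" "x \<noteq> \<zero>" and eigen: "\<And>z. cmod z = 1 \<Longrightarrow> \<exists>c. \<gamma> z x = c \<odot> x"
    and \<epsilon>: "\<epsilon> > 0"
  obtains a b y where "y \<in> mspan UNIV a b" "cnorm A (x \<ominus> y) < \<epsilon>"
proof -
  obtain N where N: "N > 0" "\<forall>m. 2 * \<bar>m\<bar> \<le> int N \<longrightarrow> (\<exists>y\<in>homog m. cnorm A (spectral N m x \<ominus> y) < \<epsilon>)"
    using spectral_approx[OF x(1) \<epsilon>] .
  define \<zeta> where "\<zeta> = cis (2 * pi / real N)"
  have z: "cmod (\<zeta> ^ j) = 1" for j by (simp add: \<zeta>_def norm_power)
  obtain c where c: "\<gamma> \<zeta> x = c \<odot> x" using eigen[of \<zeta>] z[of 1] by auto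
  have cj: "\<gamma> (\<zeta> ^ j) x = c ^ j \<odot> x" for j
  proof (induct j)
    case (Suc j)
    have "\<gamma> (\<zeta> * \<zeta> ^ j) x = \<gamma> \<zeta> (c ^ j \<odot> x)"
      using gauge_gauge[of \<zeta> "\<zeta> ^ j" x] z[of 1] z[of j] x(1) by (simp add: Suc)
    also have "\<dots> = c ^ Suc j \<odot> x"
      using star_homD(4)[OF gauge_hom x(1), of \<zeta>] z[of 1] x(1) by (simp add: c smult_smult mult.commute)
    finally show ?case by simp
  qed (use x gauge_by_one in simp)
  have \<zeta>j: "\<zeta> ^ j = cis (2 * pi * real j / real N)" for j
    unfolding \<zeta>_def Complex.DeMoivre by (simp add: algebra_simps)
  have "\<zeta> ^ N = 1" using N(1) by (simp add: \<zeta>j)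
  then have "c ^ N \<odot> x = 1 \<odot> x" using cj[of N] x(1) gauge_by_one by simp
  then have "(c ^ N - 1) \<odot> x = \<zero>" using x(1) by (simp add: smult_diff_left)
  then have "cmod (c ^ N - 1) * cnorm A x = 0" using cnorm_smult[OF x(1), of "c ^ N - 1"] by simp
  then have "c ^ N = 1" using x cnorm_eq_0[OF x(1)] by simp
  then obtain l where l: "l < N" "c = cis (2 * pi * real l / real N)"
    using bij_betw_roots_unity[OF N(1)] unfolding bij_betw_def by (auto simp: image_iff set_eq_iff)
  \<comment> \<open>The representative of \<open>l\<close> modulo \<open>N\<close> of least absolute value.\<close>
  define m where "m = (if 2 * l \<le> N then int l else int l - int N)"
  have m: "2 * \<bar>m\<bar> \<le> int N" using l(1) by (auto simp: m_def)
  have cm: "c ^ j = cis (2 * pi * real j / real N * of_int m)" for j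
  proof (cases "2 * l \<le> N")
    case True
    then show ?thesis unfolding l(2) Complex.DeMoivre by (simp add: m_def algebra_simps)
  next
    case False
    then have m': "real_of_int m = real l - real N" by (simp add: m_def)
    have "2 * pi * real j / real N * of_int m
        = real j * (2 * pi * real l / real N) - 2 * pi * of_int (int j)"
      unfolding m' using N(1) by (simp add: field_simps)
    then have "cis (2 * pi * real j / real N * of_int m)
        = cis (real j * (2 * pi * real l / real N)) / cis (2 * pi * of_int (int j))"
      by (simp only: cis_divide)
    then show ?thesis
      unfolding l(2) Complex.DeMoivre by (simp only: cis_multiple_2pi Ints_of_int div_by_1)
  qed
  have "\<gamma> (cis (2 * pi * real j / real N)) x = cis (2 * pi * real j / real N * of_int m) \<odot> x" for j
    using cj[of j] unfolding \<zeta>j cm .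
  then have "spectral N m x = (if m = m then x else \<zero>)"
    by (intro spectral_eigen x(1) N(1)) (use N(1) in auto)
  then have "spectral N m x = x" by simp
  then obtain y where y: "y \<in> homog m" "cnorm A (x \<ominus> y) < \<epsilon>" using spec[OF N(2), of m] m by auto
  from y(1) show thesis by (rule homogE) (rule that[OF _ y(2)])
qed


section \<open>The diagonal and its normalizers\<close>

subsection \<open>Combinatorial elements\<close>

definition natural :: "nat \<Rightarrow> 'a set" where
  "natural k = mspan \<nat> k k"

definition Natural :: "'a set" where
  "Natural = (\<Union>k. natural k)"

text \<open>All projections in \<open>Natural\<close>, so that an automorphism that preserves \<open>Natural\<close> preserves
  \<open>Diag\<close> for trivial reasons. That these projections are the sums of cylinder projections follows from
  \<open>projection_natural_cyl\<close>.\<close>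
definition Diag :: "'a set" where
  "Diag = projections A \<inter> Natural"

lemma natural_closed: "x \<in> natural k \<Longrightarrow> x \<in> carrier A"
  unfolding natural_def by (rule mspan_closed)

lemma Natural_closed: "x \<in> Natural \<Longrightarrow> x \<in> carrier A"
  by (auto simp: Natural_def natural_closed)

lemma natural_Natural: "x \<in> natural k \<Longrightarrow> x \<in> Natural"
  by (auto simp: Natural_def)

lemma natural_mono: "\<lbrakk>x \<in> natural k; k \<le> l\<rbrakk> \<Longrightarrow> x \<in> natural l"
  using mspan_raise[OF star_semiring_Nats, of x k k "l - k"] by (simp add: natural_def)

lemma Natural_core: "x \<in> Natural \<Longrightarrow> x \<in> core E A P S"
  by (auto simp: Natural_def natural_def intro: mspan_in_core)

lemma common_level:
  assumes "x \<in> Natural" "y \<in> Natural"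
  obtains k where "k \<ge> n" "x \<in> natural k" "y \<in> natural k"
proof -
  obtain a b where "x \<in> natural a" "y \<in> natural b" using assms by (auto simp: Natural_def)
  then show thesis using that[of "max n (max a b)"] natural_mono by simp
qed

lemma Natural_add: "\<lbrakk>x \<in> Natural; y \<in> Natural\<rbrakk> \<Longrightarrow> x \<oplus> y \<in> Natural"
  by (rule common_level[of x y 0], assumption, assumption)
    (rule natural_Natural, unfold natural_def, rule mspan_add[OF star_semiring_Nats])

lemma Natural_mult: "\<lbrakk>x \<in> Natural; y \<in> Natural\<rbrakk> \<Longrightarrow> x \<otimes> y \<in> Natural"
  by (rule common_level[of x y 0], assumption, assumption)
    (rule natural_Natural, unfold natural_def, rule mspan_mult[OF star_semiring_Nats])

lemma Natural_star: "x \<in> Natural \<Longrightarrow> x\<^sup>\<star> \<in> Natural"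
  by (auto simp: Natural_def natural_def intro: mspan_star[OF star_semiring_Nats])

lemma natural_zero: "\<zero> \<in> natural k"
  unfolding natural_def by (rule zero_in_mspan[OF star_semiring_Nats])

lemma natural_mu: "\<lbrakk>\<alpha> \<in> paths E k; \<beta> \<in> paths E k\<rbrakk> \<Longrightarrow> mu \<alpha> \<beta> \<in> natural k"
  unfolding natural_def by (rule mu_in_mspan[OF star_semiring_Nats])

lemma natural_finsum:
  "\<lbrakk>finite I; \<And>i. i \<in> I \<Longrightarrow> f i \<in> natural k\<rbrakk> \<Longrightarrow> (\<Oplus>i\<in>I. f i) \<in> natural k"
proof (induct I rule: finite_induct)
  case (insert i I)
  then have "f i \<oplus> (\<Oplus>i\<in>I. f i) \<in> natural k"
    unfolding natural_def by (intro mspan_add[OF star_semiring_Nats]) auto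
  moreover have "(\<Oplus>i\<in>insert i I. f i) = f i \<oplus> (\<Oplus>i\<in>I. f i)"
    by (rule M.finsum_insert) (use insert natural_closed in auto)
  ultimately show ?case by simp
qed (simp add: natural_zero)

lemma Natural_finsum:
  "\<lbrakk>finite I; \<And>i. i \<in> I \<Longrightarrow> f i \<in> Natural\<rbrakk> \<Longrightarrow> (\<Oplus>i\<in>I. f i) \<in> Natural"
proof (induct I rule: finite_induct)
  case (insert i I)
  then have "f i \<oplus> (\<Oplus>i\<in>I. f i) \<in> Natural" by (intro Natural_add) auto
  moreover have "(\<Oplus>i\<in>insert i I. f i) = f i \<oplus> (\<Oplus>i\<in>I. f i)"
    by (rule M.finsum_insert) (use insert Natural_closed in auto)
  ultimately show ?case by simp
qed (use natural_zero natural_Natural in auto)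

lemma natural_one: "\<one> \<in> natural k"
proof -
  have "(\<Oplus>\<alpha>\<in>paths E k. cyl \<alpha>) \<in> natural k"
    by (rule natural_finsum[OF finite_paths]) (metis natural_mu mu_self)
  then show ?thesis by (simp add: sum_cyl)
qed

lemma naturalD:
  assumes "x \<in> natural k" "\<alpha> \<in> paths E k" "\<beta> \<in> paths E k"
  obtains n :: nat where "cyl \<alpha> \<otimes> x \<otimes> cyl \<beta> = of_nat n \<odot> mu \<alpha> \<beta>" "mu \<alpha> \<beta> = \<zero> \<Longrightarrow> n = 0"
proof -
  obtain c where c: "c \<in> \<nat>" "cyl \<alpha> \<otimes> x \<otimes> cyl \<beta> = c \<odot> mu \<alpha> \<beta>"
    using mspanD[OF assms[unfolded natural_def]] .
  then obtain m where "c = of_nat m" by (auto elim: Nats_cases)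
  then show thesis using c that[of "if mu \<alpha> \<beta> = \<zero> then 0 else m"] by simp
qed

lemma DiagD: "q \<in> Diag \<Longrightarrow> q \<in> projections A" "q \<in> Diag \<Longrightarrow> q \<in> Natural" "q \<in> Diag \<Longrightarrow> q \<in> carrier A"
  by (auto simp: Diag_def dest: projectionsD)

lemma cyl_Diag: "\<alpha> \<in> paths E k \<Longrightarrow> cyl \<alpha> \<in> Diag"
  using natural_mu[of \<alpha> k \<alpha>] by (simp add: Diag_def cyl_projection mu_self natural_Natural)

lemma one_Diag: "\<one> \<in> Diag"
  by (simp add: Diag_def one_projection natural_Natural[OF natural_one[of 0]])

lemma mu_star_mu:
  assumes "\<alpha> \<in> paths E a" "\<beta> \<in> paths E b" "path_range \<alpha> = path_range \<beta>"
  shows "mu \<beta> \<alpha> \<otimes> mu \<alpha> \<beta> = cyl \<beta>"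
  using mu_mult[OF assms(2,1,1,2)] assms(3) by (simp add: mu_self)

text \<open>For a projection \<open>q = q\<^sup>* q\<close> the diagonal coefficients satisfy \<open>n\<^sub>\<beta>\<^sub>\<beta> = \<Sum>\<^sub>\<alpha> n\<^sub>\<alpha>\<^sub>\<beta>\<^sup>2\<close>. For natural
  numbers this leaves only diagonal matrices with entries 0 and 1.\<close>
lemma projection_natural_blocks:
  assumes q: "q \<in> projections A" "q \<in> natural k" and \<beta>: "\<beta> \<in> paths E k"
  shows "cyl \<beta> \<otimes> q \<otimes> cyl \<beta> \<in> {\<zero>, cyl \<beta>}"
    and "\<And>\<alpha>. \<lbrakk>\<alpha> \<in> paths E k; \<alpha> \<noteq> \<beta>\<rbrakk> \<Longrightarrow> cyl \<alpha> \<otimes> q \<otimes> cyl \<beta> = \<zero>"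
proof -
  note c = projectionsD[OF q(1)]
  have "\<forall>\<alpha>\<in>paths E k. \<exists>n::nat. cyl \<alpha> \<otimes> q \<otimes> cyl \<beta> = of_nat n \<odot> mu \<alpha> \<beta> \<and> (mu \<alpha> \<beta> = \<zero> \<longrightarrow> n = 0)"
    using naturalD[OF q(2) _ \<beta>] by metis
  then obtain n :: "'v \<times> 'e list \<Rightarrow> nat" where n:
    "\<And>\<alpha>. \<alpha> \<in> paths E k \<Longrightarrow> cyl \<alpha> \<otimes> q \<otimes> cyl \<beta> = of_nat (n \<alpha>) \<odot> mu \<alpha> \<beta>"
    "\<And>\<alpha>. \<lbrakk>\<alpha> \<in> paths E k; mu \<alpha> \<beta> = \<zero>\<rbrakk> \<Longrightarrow> n \<alpha> = 0"
    by metis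
  have entry: "(cyl \<beta> \<otimes> q \<otimes> cyl \<alpha>) \<otimes> (cyl \<alpha> \<otimes> q \<otimes> cyl \<beta>) = of_nat (n \<alpha> * n \<alpha>) \<odot> cyl \<beta>"
    if \<alpha>: "\<alpha> \<in> paths E k" for \<alpha>
  proof -
    have "cyl \<beta> \<otimes> q \<otimes> cyl \<alpha> = (cyl \<alpha> \<otimes> q \<otimes> cyl \<beta>)\<^sup>\<star>"
      using \<alpha> \<beta> c(1,2) by (simp add: adj_mult m_assoc)
    also have "\<dots> = of_nat (n \<alpha>) \<odot> mu \<beta> \<alpha>"
      unfolding n(1)[OF \<alpha>] using \<alpha> \<beta> by (simp add: adj_smult mu_star)
    finally have "(cyl \<beta> \<otimes> q \<otimes> cyl \<alpha>) \<otimes> (cyl \<alpha> \<otimes> q \<otimes> cyl \<beta>)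
        = of_nat (n \<alpha> * n \<alpha>) \<odot> (mu \<beta> \<alpha> \<otimes> mu \<alpha> \<beta>)"
      unfolding n(1)[OF \<alpha>] using \<alpha> \<beta> by (simp add: smult_mult_l smult_mult_r smult_smult)
    also have "\<dots> = of_nat (n \<alpha> * n \<alpha>) \<odot> cyl \<beta>"
    proof (cases "path_range \<alpha> = path_range \<beta>")
      case True
      show ?thesis unfolding mu_star_mu[OF \<alpha> \<beta> True] ..
    next
      case False
      then have "n \<alpha> = 0" using n(2)[OF \<alpha>] mu_eq_zero[OF \<alpha> \<beta>] by simp
      then show ?thesis using \<alpha> \<beta> by simp
    qed
    finally show ?thesis .
  qed
  have sum: "of_nat (n \<beta>) \<odot> cyl \<beta> = of_nat (\<Sum>\<alpha>\<in>paths E k. n \<alpha> * n \<alpha>) \<odot> cyl \<beta>"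
  proof -
    have "of_nat (n \<beta>) \<odot> cyl \<beta> = cyl \<beta> \<otimes> (q \<otimes> q) \<otimes> cyl \<beta>"
      using n(1)[OF \<beta>] c(3) by (simp add: mu_self)
    also have "\<dots> = (\<Oplus>\<alpha>\<in>paths E k. of_nat (n \<alpha> * n \<alpha>) \<odot> cyl \<beta>)"
      unfolding block_of_product[OF c(1) c(1) \<beta> \<beta>, of k]
      by (rule M.finsum_cong') (use entry \<beta> in auto)
    also have "\<dots> = (\<Sum>\<alpha>\<in>paths E k. of_nat (n \<alpha> * n \<alpha>)) \<odot> cyl \<beta>"
      by (rule finsum_smult_left) (use \<beta> in auto)
    finally show ?thesis by simp
  qed
  have "cyl \<beta> \<otimes> q \<otimes> cyl \<beta> \<in> {\<zero>, cyl \<beta>} \<and> (\<forall>\<alpha>\<in>paths E k. \<alpha> \<noteq> \<beta> \<longrightarrow> cyl \<alpha> \<otimes> q \<otimes> cyl \<beta> = \<zero>)"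
  proof (cases "cyl \<beta> = \<zero>")
    case True
    then show ?thesis using c(1) cyl_closed by (auto simp: m_closed)
  next
    case False
    have "complex_of_nat (n \<beta>) = complex_of_nat (\<Sum>\<alpha>\<in>paths E k. n \<alpha> * n \<alpha>)"
      by (rule smult_cancel[OF cyl_closed[OF \<beta>] False sum])
    then have eq: "(\<Sum>\<alpha>\<in>paths E k. n \<alpha> * n \<alpha>) = n \<beta>" by (simp only: of_nat_eq_iff)
    note nn = nat_sum_squares_eq[OF finite_paths \<beta> eq]
    have "n \<beta> = 0 \<or> n \<beta> = 1" using nn(1) by linarith
    then have "cyl \<beta> \<otimes> q \<otimes> cyl \<beta> \<in> {\<zero>, cyl \<beta>}"
      unfolding n(1)[OF \<beta>] mu_self using \<beta> by auto
    moreover have "cyl \<alpha> \<otimes> q \<otimes> cyl \<beta> = \<zero>" if "\<alpha> \<in> paths E k" "\<alpha> \<noteq> \<beta>" for \<alpha>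
      unfolding n(1)[OF that(1)] nn(2)[OF that] using that \<beta> by simp
    ultimately show ?thesis by blast
  qed
  then show "cyl \<beta> \<otimes> q \<otimes> cyl \<beta> \<in> {\<zero>, cyl \<beta>}"
    and "\<And>\<alpha>. \<lbrakk>\<alpha> \<in> paths E k; \<alpha> \<noteq> \<beta>\<rbrakk> \<Longrightarrow> cyl \<alpha> \<otimes> q \<otimes> cyl \<beta> = \<zero>" by blast+
qed

lemma projection_natural_cyl:
  assumes q: "q \<in> projections A" "q \<in> natural k" and \<beta>: "\<beta> \<in> paths E k"
  shows "q \<otimes> cyl \<beta> \<in> {\<zero>, cyl \<beta>}" "cyl \<beta> \<otimes> q = q \<otimes> cyl \<beta>"
proof -
  note c = projectionsD[OF q(1)]
  have eq: "q \<otimes> cyl \<beta> = cyl \<beta> \<otimes> q \<otimes> cyl \<beta>"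
  proof (rule eq_if_cyl_mult_eq[of _ _ k])
    fix \<alpha> assume \<alpha>: "\<alpha> \<in> paths E k"
    have "cyl \<alpha> \<otimes> (cyl \<beta> \<otimes> q \<otimes> cyl \<beta>) = (cyl \<alpha> \<otimes> cyl \<beta>) \<otimes> q \<otimes> cyl \<beta>"
      using \<alpha> \<beta> c(1) by (simp add: m_assoc)
    then show "cyl \<alpha> \<otimes> (q \<otimes> cyl \<beta>) = cyl \<alpha> \<otimes> (cyl \<beta> \<otimes> q \<otimes> cyl \<beta>)"
      using \<alpha> \<beta> c(1) projection_natural_blocks(2)[OF q \<beta> \<alpha>] by (cases "\<alpha> = \<beta>") (simp_all add: cyl_mult m_assoc)
  qed (use c(1) \<beta> in auto)
  then show "q \<otimes> cyl \<beta> \<in> {\<zero>, cyl \<beta>}" using projection_natural_blocks(1)[OF q \<beta>] by (simp only:)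
  have "cyl \<beta> \<otimes> q = (q \<otimes> cyl \<beta>)\<^sup>\<star>" using \<beta> c(1,2) by (simp add: adj_mult)
  also have "\<dots> = cyl \<beta> \<otimes> q \<otimes> cyl \<beta>" unfolding eq using \<beta> c(1,2) by (simp add: adj_mult m_assoc)
  finally show "cyl \<beta> \<otimes> q = q \<otimes> cyl \<beta>" using eq by (simp only:)
qed

lemma eq_if_mult_cyl_eq:
  assumes "x \<in> carrier A" "y \<in> carrier A" "\<And>\<beta>. \<beta> \<in> paths E b \<Longrightarrow> x \<otimes> cyl \<beta> = y \<otimes> cyl \<beta>"
  shows "x = y"
  by (rule eq_if_blocks_eq[of _ _ 0 b]) (use assms in \<open>auto simp: m_assoc\<close>)

lemma Diag_commute:
  assumes p: "p \<in> Diag" and q: "q \<in> Diag"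
  shows "p \<otimes> q = q \<otimes> p"
proof -
  obtain k where k: "p \<in> natural k" "q \<in> natural k"
    using common_level[OF DiagD(2)[OF p] DiagD(2)[OF q]] .
  note c = DiagD(3)[OF p] DiagD(3)[OF q]
  show ?thesis
  proof (rule eq_if_mult_cyl_eq[of _ _ k])
    fix \<beta> assume \<beta>: "\<beta> \<in> paths E k"
    have "p \<otimes> (q \<otimes> cyl \<beta>) = q \<otimes> (p \<otimes> cyl \<beta>)"
      using projection_natural_cyl(1)[OF DiagD(1)[OF p] k(1) \<beta>]
        projection_natural_cyl(1)[OF DiagD(1)[OF q] k(2) \<beta>] c by auto
    then show "p \<otimes> q \<otimes> cyl \<beta> = q \<otimes> p \<otimes> cyl \<beta>" using c \<beta> by (simp add: m_assoc)
  qed (use c in auto)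
qed

lemma Diag_mult: "\<lbrakk>p \<in> Diag; q \<in> Diag\<rbrakk> \<Longrightarrow> p \<otimes> q \<in> Diag"
  using projection_mult[of p q] Diag_commute[of p q] Natural_mult[of p q] by (simp only: Diag_def Int_iff)

lemma conjugate_Diag:
  assumes x: "x \<in> Natural" "x\<^sup>\<star> \<otimes> x \<in> projections A" and q: "q \<in> Diag"
  shows "x \<otimes> q \<otimes> x\<^sup>\<star> \<in> Diag"
proof -
  note c = Natural_closed[OF x(1)] projectionsD[OF DiagD(1)[OF q]]
  have i: "x\<^sup>\<star> \<otimes> x \<in> Diag" using x Natural_mult Natural_star by (simp add: Diag_def)
  have "x \<otimes> q \<otimes> x\<^sup>\<star> \<otimes> (x \<otimes> q \<otimes> x\<^sup>\<star>) = x \<otimes> (q \<otimes> (x\<^sup>\<star> \<otimes> x)) \<otimes> q \<otimes> x\<^sup>\<star>"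
    using c(1,2) by (simp add: m_assoc)
  also have "\<dots> = (x \<otimes> (x\<^sup>\<star> \<otimes> x)) \<otimes> (q \<otimes> q) \<otimes> x\<^sup>\<star>"
    unfolding Diag_commute[OF q i] using c(1,2) by (simp add: m_assoc)
  also have "\<dots> = x \<otimes> q \<otimes> x\<^sup>\<star>"
    unfolding c(4) partial_isometry_mult_initial[OF c(1) refl x(2)] ..
  finally have "x \<otimes> q \<otimes> x\<^sup>\<star> \<in> projections A"
    using c(1-3) by (simp add: projections_def adj_mult m_assoc)
  then show ?thesis using x(1) DiagD(2)[OF q] by (simp add: Diag_def Natural_mult Natural_star)
qed

text \<open>Natural coefficients can be recovered from their squares. Therefore an element of
  \<open>Natural\<close> is determined by its action on the diagonal, without the usual ambiguity of a phase.\<close>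
lemma eq_if_conjugation_eq:
  assumes x: "x \<in> Natural" and y: "y \<in> Natural"
    and conj: "\<And>q. q \<in> Diag \<Longrightarrow> x \<otimes> q \<otimes> x\<^sup>\<star> = y \<otimes> q \<otimes> y\<^sup>\<star>"
  shows "x = y"
proof -
  obtain k where k: "x \<in> natural k" "y \<in> natural k" using common_level[OF x y] .
  have square: "of_nat (n * n) \<odot> (mu \<alpha> \<beta> \<otimes> mu \<beta> \<alpha>) = cyl \<alpha> \<otimes> (z \<otimes> cyl \<beta> \<otimes> z\<^sup>\<star>) \<otimes> cyl \<alpha>"
    if "z \<in> carrier A" and ab: "\<alpha> \<in> paths E k" "\<beta> \<in> paths E k"
      and n: "cyl \<alpha> \<otimes> z \<otimes> cyl \<beta> = of_nat n \<odot> mu \<alpha> \<beta>" for z n \<alpha> \<beta>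
  proof -
    have "cyl \<alpha> \<otimes> (z \<otimes> cyl \<beta> \<otimes> z\<^sup>\<star>) \<otimes> cyl \<alpha> = cyl \<alpha> \<otimes> z \<otimes> (cyl \<beta> \<otimes> cyl \<beta>) \<otimes> (z\<^sup>\<star> \<otimes> cyl \<alpha>)"
      using that(1-3) cyl_mult[OF ab(2,2)] by (simp add: m_assoc)
    also have "\<dots> = (cyl \<alpha> \<otimes> z \<otimes> cyl \<beta>) \<otimes> (cyl \<alpha> \<otimes> z \<otimes> cyl \<beta>)\<^sup>\<star>"
      using that(1-3) by (simp add: adj_mult m_assoc)
    also have "\<dots> = of_nat (n * n) \<odot> (mu \<alpha> \<beta> \<otimes> mu \<beta> \<alpha>)"
      unfolding n using ab by (simp add: adj_smult mu_star smult_mult_l smult_mult_r smult_smult)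
    finally show ?thesis by simp
  qed
  show ?thesis
  proof (rule eq_if_blocks_eq[of _ _ k k])
    fix \<alpha> \<beta> assume ab: "\<alpha> \<in> paths E k" "\<beta> \<in> paths E k"
    obtain n where n: "cyl \<alpha> \<otimes> x \<otimes> cyl \<beta> = of_nat n \<odot> mu \<alpha> \<beta>" using naturalD[OF k(1) ab] .
    obtain m where m: "cyl \<alpha> \<otimes> y \<otimes> cyl \<beta> = of_nat m \<odot> mu \<alpha> \<beta>" using naturalD[OF k(2) ab] .
    show "cyl \<alpha> \<otimes> x \<otimes> cyl \<beta> = cyl \<alpha> \<otimes> y \<otimes> cyl \<beta>"
    proof (cases "mu \<beta> \<alpha> = \<zero>")
      case True
      then have "mu \<alpha> \<beta> = \<zero>" using mu_star[OF ab(2,1)] by simp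
      then show ?thesis unfolding n m by simp
    next
      case False
      have "of_nat (n * n) \<odot> (mu \<alpha> \<beta> \<otimes> mu \<beta> \<alpha>) = of_nat (m * m) \<odot> (mu \<alpha> \<beta> \<otimes> mu \<beta> \<alpha>)"
        unfolding square[OF Natural_closed[OF x] ab n] square[OF Natural_closed[OF y] ab m]
          conj[OF cyl_Diag[OF ab(2)]] ..
      moreover have "mu \<alpha> \<beta> \<otimes> mu \<beta> \<alpha> \<noteq> \<zero>"
        using adj_mult_self_eq_zero[of "mu \<beta> \<alpha>"] False ab by (auto simp: mu_star)
      ultimately have "complex_of_nat (n * n) = complex_of_nat (m * m)"
        by (intro smult_cancel[of "mu \<alpha> \<beta> \<otimes> mu \<beta> \<alpha>"]) (use ab in auto)
      then have "n * n = m * m" by (simp only: of_nat_eq_iff)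
      then have "n = m" by (metis power2_eq_square power2_eq_iff_nonneg zero_le)
      then show ?thesis unfolding n m by simp
    qed
  qed (use Natural_closed x y in auto)
qed

text \<open>The diagonal is maximal abelian in the core, at the level of projections: compressed to a
  cylinder, the projection is almost a scalar.\<close>
lemma Diag_maximal:
  assumes p: "p \<in> projections A" "p \<in> core E A P S" and comm: "\<And>q. q \<in> Diag \<Longrightarrow> p \<otimes> q = q \<otimes> p"
  shows "p \<in> Diag"
proof -
  note c = projectionsD[OF p(1)]
  obtain k y where y: "y \<in> mspan UNIV k k" "cnorm A (p \<ominus> y) < 1 / 2"
    by (rule core_approx[OF p(2), of "1 / 2"]) simp
  have cut: "p \<otimes> cyl \<alpha> \<in> {\<zero>, cyl \<alpha>}" if \<alpha>: "\<alpha> \<in> paths E k" for \<alpha>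
  proof -
    have pc: "p \<otimes> cyl \<alpha> = cyl \<alpha> \<otimes> p" by (rule comm[OF cyl_Diag[OF \<alpha>]])
    obtain k where k: "cyl \<alpha> \<otimes> y \<otimes> cyl \<alpha> = k \<odot> mu \<alpha> \<alpha>" using mspanD[OF y(1) \<alpha> \<alpha>] .
    have cc: "cyl \<alpha> \<otimes> cyl \<alpha> = cyl \<alpha>" using cyl_mult[OF \<alpha> \<alpha>] by simp
    have 1: "p \<otimes> cyl \<alpha> \<otimes> cyl \<alpha> = p \<otimes> cyl \<alpha>" using c(1) \<alpha> cc by (simp add: m_assoc)
    then have "cyl \<alpha> \<otimes> p \<otimes> cyl \<alpha> = p \<otimes> cyl \<alpha>" unfolding pc[symmetric] .
    then have "p \<otimes> cyl \<alpha> \<ominus> k \<odot> cyl \<alpha> = cyl \<alpha> \<otimes> (p \<ominus> y) \<otimes> cyl \<alpha>"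
      using k c(1) \<alpha> mspan_closed[OF y(1)] by (simp add: mult_diff_distrib mu_self)
    then have "cnorm A (p \<otimes> cyl \<alpha> \<ominus> k \<odot> cyl \<alpha>) < 1 / 2"
      using cnorm_compress_le[OF cyl_projection[OF \<alpha>] cyl_projection[OF \<alpha>], of "p \<ominus> y"] y c(1)
        mspan_closed[OF y(1)] by simp
    moreover have "cyl \<alpha> \<otimes> (p \<otimes> cyl \<alpha>) = p \<otimes> cyl \<alpha>"
      using 1 pc c(1) \<alpha> m_assoc[of "cyl \<alpha>" p "cyl \<alpha>"] by simp
    ultimately have "p \<otimes> cyl \<alpha> = \<zero> \<or> p \<otimes> cyl \<alpha> = cyl \<alpha>"
      by (intro projection_near_scalar cyl_projection[OF \<alpha>] projection_mult p(1) pc 1)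
    then show ?thesis by simp
  qed
  have "p \<in> natural k"
    unfolding natural_def mspan_def
  proof (intro CollectI conjI ballI c(1))
    fix \<alpha> \<beta> assume ab: "\<alpha> \<in> paths E k" "\<beta> \<in> paths E k"
    show "\<exists>c\<in>\<nat>. cyl \<alpha> \<otimes> p \<otimes> cyl \<beta> = c \<odot> mu \<alpha> \<beta>"
    proof (cases "\<alpha> = \<beta> \<and> p \<otimes> cyl \<beta> = cyl \<beta>")
      case True
      then have "cyl \<alpha> \<otimes> p \<otimes> cyl \<beta> = 1 \<odot> mu \<alpha> \<beta>"
        using ab c(1) cyl_mult[OF ab] by (simp add: m_assoc mu_self)
      then show ?thesis using Nats_1 by (rule bexI)
    next
      case False
      then have "cyl \<alpha> \<otimes> (p \<otimes> cyl \<beta>) = \<zero>" using cut[OF ab(2)] ab cyl_mult[OF ab] by auto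
      then have "cyl \<alpha> \<otimes> p \<otimes> cyl \<beta> = 0 \<odot> mu \<alpha> \<beta>" using ab c(1) by (simp add: m_assoc)
      then show ?thesis using Nats_0 by (rule bexI)
    qed
  qed
  then show ?thesis using p(1) by (simp add: Diag_def natural_Natural)
qed

subsection \<open>Normalizers of the diagonal\<close>

definition normalizer :: "'a \<Rightarrow> bool" where
  "normalizer v \<longleftrightarrow> v \<in> carrier A \<and> (\<forall>q\<in>Diag. v \<otimes> q \<otimes> v\<^sup>\<star> \<in> Diag \<and> v\<^sup>\<star> \<otimes> q \<otimes> v \<in> Diag)"

lemma normalizerD:
  assumes "normalizer v"
  shows "v \<in> carrier A" "q \<in> Diag \<Longrightarrow> v \<otimes> q \<otimes> v\<^sup>\<star> \<in> Diag" "q \<in> Diag \<Longrightarrow> v\<^sup>\<star> \<otimes> q \<otimes> v \<in> Diag"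
  using assms by (auto simp: normalizer_def)

lemma normalizer_star: "normalizer v \<Longrightarrow> normalizer (v\<^sup>\<star>)"
  by (simp add: normalizer_def)

lemma cnorm_normalizer_le:
  assumes "normalizer v" shows "cnorm A v \<le> 1"
proof (rule cnorm_partial_isometry_le)
  show "v\<^sup>\<star> \<otimes> v \<in> projections A"
    using normalizerD(3)[OF assms one_Diag] normalizerD(1)[OF assms] DiagD(1) by simp
qed (rule normalizerD(1)[OF assms])

text \<open>The scalar \<open>c\<close> is the coefficient at \<open>S\<^sub>\<alpha> S\<^sub>\<beta>\<^sup>*\<close> of a combination of matrix units close to \<open>v\<close>.
  The block \<open>z\<close> of \<open>v\<close> satisfies \<open>z\<^sup>* z \<approx> |c|\<^sup>2 S\<^sub>\<beta> S\<^sub>\<beta>\<^sup>*\<close>, and \<open>z\<^sup>* z\<close> is a projection in the diagonal,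
  so there is no room between 0 and a full block.\<close>
lemma normalizer_full_block:
  assumes v: "normalizer v" and y: "y \<in> mspan UNIV a b" "cnorm A (v \<ominus> y) < 1 / 8"
    and \<alpha>: "\<alpha> \<in> paths E a" and \<beta>: "\<beta> \<in> paths E b" and nz: "cyl \<alpha> \<otimes> v \<otimes> cyl \<beta> \<noteq> \<zero>"
  obtains c where "path_range \<alpha> = path_range \<beta>"
    "(cyl \<alpha> \<otimes> v \<otimes> cyl \<beta>)\<^sup>\<star> \<otimes> (cyl \<alpha> \<otimes> v \<otimes> cyl \<beta>) = cyl \<beta>"
    "cnorm A (cyl \<alpha> \<otimes> v \<otimes> cyl \<beta> \<ominus> c \<odot> mu \<alpha> \<beta>) < 1 / 8"
proof -
  define z where "z = cyl \<alpha> \<otimes> v \<otimes> cyl \<beta>"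
  note vA = normalizerD(1)[OF v]
  have zA: "z \<in> carrier A" using vA \<alpha> \<beta> by (simp add: z_def)
  obtain c where c: "cyl \<alpha> \<otimes> y \<otimes> cyl \<beta> = c \<odot> mu \<alpha> \<beta>" using mspanD[OF y(1) \<alpha> \<beta>] .
  define m where "m = c \<odot> mu \<alpha> \<beta>"
  have mA: "m \<in> carrier A" using \<alpha> \<beta> by (simp add: m_def)
  note yA = mspan_closed[OF y(1)]
  have "z \<ominus> m = cyl \<alpha> \<otimes> (v \<ominus> y) \<otimes> cyl \<beta>"
    unfolding z_def m_def c[symmetric] using vA yA \<alpha> \<beta> by (simp add: mult_diff_distrib)
  then have zm: "cnorm A (z \<ominus> m) < 1 / 8"
    using cnorm_compress_le[OF cyl_projection[OF \<alpha>] cyl_projection[OF \<beta>], of "v \<ominus> y"] y(2) vA yA by simp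
  have z1: "cnorm A z \<le> 1"
    using cnorm_compress_le[OF cyl_projection[OF \<alpha>] cyl_projection[OF \<beta>] vA] cnorm_normalizer_le[OF v]
    by (simp add: z_def)
  have zm': "cnorm A (z\<^sup>\<star> \<ominus> m\<^sup>\<star>) < 1 / 8"
    using zm cnorm_adj[of "z \<ominus> m"] zA mA by (simp add: adj_diff)
  have z1': "cnorm A (z\<^sup>\<star>) \<le> 1" using z1 zA by simp
  have close: "cnorm A (z\<^sup>\<star> \<otimes> z \<ominus> m\<^sup>\<star> \<otimes> m) < 1 / 2"
    using conjugates_close[OF _ z1' _ zm' one_projection] zA mA by simp
  define d where "d = v\<^sup>\<star> \<otimes> cyl \<alpha> \<otimes> v"
  have d: "d \<in> Diag" unfolding d_def by (rule normalizerD(3)[OF v cyl_Diag[OF \<alpha>]])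
  note \<beta>D = cyl_Diag[OF \<beta>]
  have cc: "cyl \<alpha> \<otimes> cyl \<alpha> = cyl \<alpha>" "cyl \<beta> \<otimes> cyl \<beta> = cyl \<beta>"
    using cyl_mult[OF \<alpha> \<alpha>] cyl_mult[OF \<beta> \<beta>] by simp_all
  have zz: "z\<^sup>\<star> \<otimes> z = cyl \<beta> \<otimes> d \<otimes> cyl \<beta>"
  proof -
    have "z\<^sup>\<star> \<otimes> z = cyl \<beta> \<otimes> (v\<^sup>\<star> \<otimes> (cyl \<alpha> \<otimes> cyl \<alpha>) \<otimes> v) \<otimes> cyl \<beta>"
      unfolding z_def using vA \<alpha> \<beta> by (simp add: adj_mult m_assoc)
    then show ?thesis unfolding cc d_def .
  qed
  have proj: "z\<^sup>\<star> \<otimes> z \<in> projections A"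
    unfolding zz by (intro DiagD(1) Diag_mult d \<beta>D)
  have under: "z\<^sup>\<star> \<otimes> z \<otimes> cyl \<beta> = z\<^sup>\<star> \<otimes> z" "cyl \<beta> \<otimes> (z\<^sup>\<star> \<otimes> z) = z\<^sup>\<star> \<otimes> z"
    unfolding zz using DiagD(3)[OF d] \<beta> cc(2) by (simp_all add: m_assoc, simp flip: m_assoc)
  have nz': "z\<^sup>\<star> \<otimes> z \<noteq> \<zero>"
    using adj_mult_self_eq_zero[OF zA] nz by (auto simp: z_def)
  have range: "path_range \<alpha> = path_range \<beta>"
  proof (rule ccontr)
    assume "path_range \<alpha> \<noteq> path_range \<beta>"
    then have "m = \<zero>" using mu_eq_zero[OF \<alpha> \<beta>] by (simp add: m_def)
    then have "cnorm A (z\<^sup>\<star> \<otimes> z) < 1" using close zA by (simp add: a_minus_def)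
    then show False using projection_eq_zero[OF proj] nz' by blast
  qed
  have "m\<^sup>\<star> \<otimes> m = (cnj c * c) \<odot> (mu \<beta> \<alpha> \<otimes> mu \<alpha> \<beta>)"
    using \<alpha> \<beta> by (simp add: m_def adj_smult mu_star smult_mult_l smult_mult_r smult_smult mult.commute)
  then have "m\<^sup>\<star> \<otimes> m = (cnj c * c) \<odot> cyl \<beta>" unfolding mu_star_mu[OF \<alpha> \<beta> range] .
  then have "z\<^sup>\<star> \<otimes> z = \<zero> \<or> z\<^sup>\<star> \<otimes> z = cyl \<beta>"
    using close by (intro projection_near_scalar[OF cyl_projection[OF \<beta>] proj under]) simp
  then have "z\<^sup>\<star> \<otimes> z = cyl \<beta>" using nz' by blast
  then show thesis using that[OF range, of c] zm unfolding z_def m_def by blast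
qed

text \<open>At most one block in a column of \<open>v\<close> is nonzero: \<open>v S\<^sub>\<beta> S\<^sub>\<beta>\<^sup>* v\<^sup>*\<close> is diagonal, so it
  commutes with the projections that separate two such blocks.\<close>
lemma normalizer_block:
  assumes v: "normalizer v" and y: "y \<in> mspan UNIV a b" "cnorm A (v \<ominus> y) < 1 / 8"
    and \<beta>: "\<beta> \<in> paths E b" and nz: "v \<otimes> cyl \<beta> \<noteq> \<zero>"
  obtains \<alpha> c where "\<alpha> \<in> paths E a" "path_range \<alpha> = path_range \<beta>" "v \<otimes> cyl \<beta> \<otimes> v\<^sup>\<star> = cyl \<alpha>"
    "cyl \<beta> \<noteq> \<zero>" "(v \<otimes> cyl \<beta>)\<^sup>\<star> \<otimes> (v \<otimes> cyl \<beta>) = cyl \<beta>" "cnorm A (v \<otimes> cyl \<beta> \<ominus> c \<odot> mu \<alpha> \<beta>) < 1 / 8"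
proof -
  note vA = normalizerD(1)[OF v]
  have "\<exists>\<alpha>\<in>paths E a. cyl \<alpha> \<otimes> (v \<otimes> cyl \<beta>) \<noteq> \<zero>"
  proof (rule ccontr)
    assume neg: "\<not> ?thesis"
    have "v \<otimes> cyl \<beta> = \<zero>"
      by (rule eq_if_cyl_mult_eq[of _ _ a]) (use neg vA \<beta> in auto)
    then show False using nz by simp
  qed
  then obtain \<alpha> where \<alpha>: "\<alpha> \<in> paths E a" and nz\<alpha>: "cyl \<alpha> \<otimes> (v \<otimes> cyl \<beta>) \<noteq> \<zero>" by blast
  define z where "z = cyl \<alpha> \<otimes> v \<otimes> cyl \<beta>"
  have zA: "z \<in> carrier A" using vA \<alpha> \<beta> by (simp add: z_def)
  have nz: "z \<noteq> \<zero>" using nz\<alpha> vA \<alpha> \<beta> by (simp add: z_def m_assoc)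
  obtain c where c: "path_range \<alpha> = path_range \<beta>" "z\<^sup>\<star> \<otimes> z = cyl \<beta>" "cnorm A (z \<ominus> c \<odot> mu \<alpha> \<beta>) < 1 / 8"
    using normalizer_full_block[OF v y \<alpha> \<beta> nz[unfolded z_def]] unfolding z_def .
  have z_star: "z\<^sup>\<star> = cyl \<beta> \<otimes> v\<^sup>\<star> \<otimes> cyl \<alpha>"
    unfolding z_def using vA \<alpha> \<beta> by (simp add: adj_mult m_assoc)
  have z_range: "z \<otimes> z\<^sup>\<star> = cyl \<alpha>"
  proof -
    have yA: "y \<in> carrier A" by (rule mspan_closed[OF y(1)])
    have "y\<^sup>\<star> \<in> mspan UNIV b a" by (rule mspan_star[OF star_semiring_UNIV y(1)])
    moreover have "cnorm A (v\<^sup>\<star> \<ominus> y\<^sup>\<star>) < 1 / 8"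
      using y(2) cnorm_adj[of "v \<ominus> y"] vA yA by (simp add: adj_diff)
    moreover have "cyl \<beta> \<otimes> v\<^sup>\<star> \<otimes> cyl \<alpha> \<noteq> \<zero>"
      unfolding z_star[symmetric] using nz adj_adj[OF zA] adj_zero by metis
    ultimately obtain c' where
      "(cyl \<beta> \<otimes> v\<^sup>\<star> \<otimes> cyl \<alpha>)\<^sup>\<star> \<otimes> (cyl \<beta> \<otimes> v\<^sup>\<star> \<otimes> cyl \<alpha>) = cyl \<alpha>"
      using normalizer_full_block[OF normalizer_star[OF v] _ _ \<beta> \<alpha>] by blast
    then show ?thesis unfolding z_star[symmetric] using zA by simp
  qed
  define D where "D = v \<otimes> cyl \<beta> \<otimes> v\<^sup>\<star>"
  have D: "D \<in> Diag" unfolding D_def by (rule normalizerD(2)[OF v cyl_Diag[OF \<beta>]])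
  note DA = DiagD(3)[OF D]
  have vz: "v \<otimes> cyl \<beta> = z"
  proof (rule eq_if_cyl_mult_eq[of _ _ a])
    fix \<alpha>' assume \<alpha>': "\<alpha>' \<in> paths E a"
    show "cyl \<alpha>' \<otimes> (v \<otimes> cyl \<beta>) = cyl \<alpha>' \<otimes> z"
    proof (cases "\<alpha>' = \<alpha>")
      case True
      have "cyl \<alpha> \<otimes> z = (cyl \<alpha> \<otimes> cyl \<alpha>) \<otimes> (v \<otimes> cyl \<beta>)"
        unfolding z_def using vA \<alpha> \<beta> by (simp add: m_assoc)
      then show ?thesis using True cyl_mult[OF \<alpha> \<alpha>] by simp
    next
      case False
      have "cyl \<alpha>' \<otimes> (v \<otimes> cyl \<beta>) = cyl \<alpha>' \<otimes> (v \<otimes> (cyl \<beta> \<otimes> (z\<^sup>\<star> \<otimes> z)))"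
        unfolding c(2) using cyl_mult[OF \<beta> \<beta>] by simp
      also have "cyl \<beta> \<otimes> (z\<^sup>\<star> \<otimes> z) = (cyl \<beta> \<otimes> cyl \<beta>) \<otimes> v\<^sup>\<star> \<otimes> cyl \<alpha> \<otimes> z"
        unfolding z_star using vA zA \<alpha> \<beta> by (simp add: m_assoc)
      also have "\<dots> = cyl \<beta> \<otimes> v\<^sup>\<star> \<otimes> cyl \<alpha> \<otimes> z" using cyl_mult[OF \<beta> \<beta>] by simp
      also have "cyl \<alpha>' \<otimes> (v \<otimes> (cyl \<beta> \<otimes> v\<^sup>\<star> \<otimes> cyl \<alpha> \<otimes> z)) = (cyl \<alpha>' \<otimes> D) \<otimes> cyl \<alpha> \<otimes> z"
        unfolding D_def using vA zA \<alpha> \<alpha>' \<beta> by (simp add: m_assoc)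
      also have "\<dots> = D \<otimes> (cyl \<alpha>' \<otimes> cyl \<alpha>) \<otimes> z"
        unfolding Diag_commute[OF cyl_Diag[OF \<alpha>'] D] using DA zA \<alpha> \<alpha>' by (simp add: m_assoc)
      also have "\<dots> = \<zero>" using cyl_mult[OF \<alpha>' \<alpha>] False DA zA by simp
      also have "\<zero> = (cyl \<alpha>' \<otimes> cyl \<alpha>) \<otimes> (v \<otimes> cyl \<beta>)"
        using cyl_mult[OF \<alpha>' \<alpha>] False vA \<beta> by simp
      also have "\<dots> = cyl \<alpha>' \<otimes> z" unfolding z_def using vA \<alpha> \<alpha>' \<beta> by (simp add: m_assoc)
      finally show ?thesis .
    qed
  qed (use vA zA \<beta> in auto)
  have "v \<otimes> cyl \<beta> \<otimes> v\<^sup>\<star> = (v \<otimes> cyl \<beta>) \<otimes> (v \<otimes> cyl \<beta>)\<^sup>\<star>"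
  proof -
    have "(v \<otimes> cyl \<beta>) \<otimes> (v \<otimes> cyl \<beta>)\<^sup>\<star> = v \<otimes> (cyl \<beta> \<otimes> cyl \<beta>) \<otimes> v\<^sup>\<star>"
      using vA \<beta> by (simp add: adj_mult m_assoc)
    then show ?thesis using cyl_mult[OF \<beta> \<beta>] by simp
  qed
  then have "v \<otimes> cyl \<beta> \<otimes> v\<^sup>\<star> = cyl \<alpha>" unfolding vz z_range .
  moreover have "cyl \<beta> \<noteq> \<zero>" using adj_mult_self_eq_zero[OF zA] c(2) nz by auto
  ultimately show thesis using that[OF \<alpha> c(1), of c] c(2,3) unfolding vz by blast
qed

text \<open>At equal levels the matrix unit \<open>e = S\<^sub>\<alpha> S\<^sub>\<beta>\<^sup>*\<close> itself belongs to \<open>Natural\<close>, so \<open>e q e\<^sup>*\<close>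
  is a diagonal projection at distance below 1 from the conjugate of \<open>q\<close> by \<open>v\<close>.\<close>
lemma normalizer_block_conjugation:
  assumes v: "normalizer v" and y: "y \<in> mspan UNIV k k" "cnorm A (v \<ominus> y) < 1 / 8"
    and \<beta>: "\<beta> \<in> paths E k" and nz: "v \<otimes> cyl \<beta> \<noteq> \<zero>"
  obtains \<alpha> where "\<alpha> \<in> paths E k" "path_range \<alpha> = path_range \<beta>" "v \<otimes> cyl \<beta> \<otimes> v\<^sup>\<star> = cyl \<alpha>"
    "cyl \<beta> \<noteq> \<zero>" "\<And>q. q \<in> Diag \<Longrightarrow> v \<otimes> (q \<otimes> cyl \<beta>) \<otimes> v\<^sup>\<star> = mu \<alpha> \<beta> \<otimes> q \<otimes> mu \<beta> \<alpha>"
proof -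
  note vA = normalizerD(1)[OF v]
  define z where "z = v \<otimes> cyl \<beta>"
  have zA: "z \<in> carrier A" using vA \<beta> by (simp add: z_def)
  obtain \<alpha> c where \<alpha>: "\<alpha> \<in> paths E k" "path_range \<alpha> = path_range \<beta>" "v \<otimes> cyl \<beta> \<otimes> v\<^sup>\<star> = cyl \<alpha>"
    and nz\<beta>: "cyl \<beta> \<noteq> \<zero>" and zz: "z\<^sup>\<star> \<otimes> z = cyl \<beta>" and close: "cnorm A (z \<ominus> c \<odot> mu \<alpha> \<beta>) < 1 / 8"
    using normalizer_block[OF v y \<beta> nz] unfolding z_def .
  have cyl1: "cnorm A (cyl \<beta>) = 1"
    using cnorm_projection[OF cyl_projection[OF \<beta>]] cnorm_eq_0[OF cyl_closed[OF \<beta>]] nz\<beta> by blast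
  have muA: "mu \<alpha> \<beta> \<in> carrier A" using \<alpha> \<beta> by simp
  have norm1: "cnorm A x = 1" if "x \<in> carrier A" "x\<^sup>\<star> \<otimes> x = cyl \<beta>" for x
    using cstar_identity[OF that(1)] cyl1 that(2) cnorm_nonneg[OF that(1)] by (simp add: power2_eq_1_iff)
  have z1: "cnorm A z = 1" by (rule norm1[OF zA zz])
  have mu_iso: "(mu \<alpha> \<beta>)\<^sup>\<star> \<otimes> mu \<alpha> \<beta> = cyl \<beta>" unfolding mu_star[OF \<alpha>(1) \<beta>] by (rule mu_star_mu[OF \<alpha>(1) \<beta> \<alpha>(2)])
  have "cnorm A (c \<odot> mu \<alpha> \<beta>) = cmod c" using norm1[OF muA mu_iso] muA by (simp add: cnorm_smult)
  then have c: "cmod c \<le> 9 / 8" "7 / 8 \<le> cmod c"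
    using cnorm_reverse_triangle[of "c \<odot> mu \<alpha> \<beta>" z] cnorm_reverse_triangle[of z "c \<odot> mu \<alpha> \<beta>"]
      cnorm_diff_commute[of z "c \<odot> mu \<alpha> \<beta>"] zA muA z1 close by simp_all
  have conj: "v \<otimes> (q \<otimes> cyl \<beta>) \<otimes> v\<^sup>\<star> = mu \<alpha> \<beta> \<otimes> q \<otimes> mu \<beta> \<alpha>" if q: "q \<in> Diag" for q
  proof (rule commuting_projections_close)
    note qA = DiagD(3)[OF q]
    let ?r = "v \<otimes> (q \<otimes> cyl \<beta>) \<otimes> v\<^sup>\<star>" and ?s = "mu \<alpha> \<beta> \<otimes> q \<otimes> mu \<beta> \<alpha>"
    have r: "?r \<in> Diag" by (intro normalizerD(2)[OF v] Diag_mult q cyl_Diag[OF \<beta>])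
    have s: "?s \<in> Diag"
      using conjugate_Diag[OF natural_Natural[OF natural_mu[OF \<alpha>(1) \<beta>]] _ q] mu_iso cyl_projection[OF \<beta>]
        mu_star[OF \<alpha>(1) \<beta>] by simp
    show "?r \<in> projections A" "?s \<in> projections A" using r s DiagD(1) by auto
    show "?r \<otimes> ?s = ?s \<otimes> ?r" by (rule Diag_commute[OF r s])
    have "?r = z \<otimes> q \<otimes> z\<^sup>\<star>"
    proof -
      have "z \<otimes> q \<otimes> z\<^sup>\<star> = v \<otimes> (cyl \<beta> \<otimes> q) \<otimes> cyl \<beta> \<otimes> v\<^sup>\<star>"
        unfolding z_def using vA qA \<beta> by (simp add: adj_mult m_assoc)
      also have "\<dots> = v \<otimes> (q \<otimes> (cyl \<beta> \<otimes> cyl \<beta>)) \<otimes> v\<^sup>\<star>"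
        unfolding Diag_commute[OF cyl_Diag[OF \<beta>] q] using vA qA \<beta> by (simp add: m_assoc)
      finally show ?thesis using cyl_mult[OF \<beta> \<beta>] by simp
    qed
    moreover have "(c \<odot> mu \<alpha> \<beta>) \<otimes> q \<otimes> (c \<odot> mu \<alpha> \<beta>)\<^sup>\<star> = complex_of_real ((cmod c)\<^sup>2) \<odot> ?s"
      unfolding complex_norm_square using \<alpha>(1) \<beta> qA
      by (simp add: adj_smult mu_star smult_mult_l smult_mult_r smult_smult mult.commute)
    ultimately have 1: "cnorm A (?r \<ominus> complex_of_real ((cmod c)\<^sup>2) \<odot> ?s) \<le> 17 / 64"
      using conjugates_close[OF zA _ _ close DiagD(1)[OF q]] z1 muA by simp
    have "complex_of_real ((cmod c)\<^sup>2) \<odot> ?s \<ominus> ?s = complex_of_real ((cmod c)\<^sup>2 - 1) \<odot> ?s"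
      using DiagD(3)[OF s] by (simp add: smult_diff_left)
    then have "cnorm A (complex_of_real ((cmod c)\<^sup>2) \<odot> ?s \<ominus> ?s) = \<bar>(cmod c)\<^sup>2 - 1\<bar> * cnorm A ?s"
      using cnorm_smult[OF DiagD(3)[OF s], of "complex_of_real ((cmod c)\<^sup>2 - 1)"] by (simp only: norm_of_real)
    also have "\<dots> \<le> \<bar>(cmod c)\<^sup>2 - 1\<bar> * 1"
      by (rule mult_left_mono) (use cnorm_projection_le[OF DiagD(1)[OF s]] in auto)
    also have "\<dots> \<le> 17 / 64"
    proof -
      have "(cmod c)\<^sup>2 \<le> (9 / 8)\<^sup>2" "(7 / 8)\<^sup>2 \<le> (cmod c)\<^sup>2" by (intro power_mono c; simp)+
      then have "(cmod c)\<^sup>2 \<le> 81 / 64" "49 / 64 \<le> (cmod c)\<^sup>2" by (simp_all add: power2_eq_square)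
      then show ?thesis unfolding mult_1_right by (intro abs_leI) linarith+
    qed
    finally have 2: "cnorm A (complex_of_real ((cmod c)\<^sup>2) \<odot> ?s \<ominus> ?s) \<le> 17 / 64" .
    show "cnorm A (?r \<ominus> ?s) < 1"
      using cnorm_triangle_diff[of ?r "complex_of_real ((cmod c)\<^sup>2) \<odot> ?s" ?s] 1 2
        DiagD(3)[OF r] DiagD(3)[OF s] by simp
  qed
  show thesis by (rule that[OF \<alpha> nz\<beta> conj])
qed


section \<open>Localized automorphisms\<close>

subsection \<open>Automorphisms preserving the combinatorial elements\<close>

lemma Natural_smult: "x \<in> Natural \<Longrightarrow> of_nat n \<odot> x \<in> Natural"
proof -
  assume "x \<in> Natural"
  then obtain k where "x \<in> natural k" by (auto simp: Natural_def)
  then have "of_nat n \<odot> x \<in> natural k"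
    unfolding natural_def by (intro mspan_smult[OF star_semiring_Nats of_nat_in_Nats])
  then show ?thesis by (rule natural_Natural)
qed

lemma star_hom_Natural:
  assumes f: "f \<in> star_hom A A"
    and mu: "\<And>k \<alpha> \<beta>. \<lbrakk>\<alpha> \<in> paths E k; \<beta> \<in> paths E k\<rbrakk> \<Longrightarrow> f (mu \<alpha> \<beta>) \<in> Natural"
    and x: "x \<in> Natural"
  shows "f x \<in> Natural"
proof -
  obtain k where k: "x \<in> natural k" using x by (auto simp: Natural_def)
  note xA = natural_closed[OF k]
  have block: "f (cyl \<alpha> \<otimes> x \<otimes> cyl \<beta>) \<in> Natural" if ab: "\<alpha> \<in> paths E k" "\<beta> \<in> paths E k" for \<alpha> \<beta>
  proof -
    obtain n where n: "cyl \<alpha> \<otimes> x \<otimes> cyl \<beta> = of_nat n \<odot> mu \<alpha> \<beta>" using naturalD[OF k ab] .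
    show ?thesis
      unfolding n star_homD(4)[OF f mu_closed[OF ab]] by (rule Natural_smult[OF mu[OF ab]])
  qed
  have "f x = f (\<Oplus>\<alpha>\<in>paths E k. \<Oplus>\<beta>\<in>paths E k. cyl \<alpha> \<otimes> x \<otimes> cyl \<beta>)"
    using sum_blocks[OF xA, of k k] by simp
  also have "\<dots> = (\<Oplus>\<alpha>\<in>paths E k. f (\<Oplus>\<beta>\<in>paths E k. cyl \<alpha> \<otimes> x \<otimes> cyl \<beta>))"
    by (rule star_hom_finsum[OF f]) (use xA in \<open>auto intro!: M.finsum_closed\<close>)
  also have "\<dots> = (\<Oplus>\<alpha>\<in>paths E k. \<Oplus>\<beta>\<in>paths E k. f (cyl \<alpha> \<otimes> x \<otimes> cyl \<beta>))"
  proof (rule M.finsum_cong')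
    fix \<alpha> assume "\<alpha> \<in> paths E k"
    then show "f (\<Oplus>\<beta>\<in>paths E k. cyl \<alpha> \<otimes> x \<otimes> cyl \<beta>) = (\<Oplus>\<beta>\<in>paths E k. f (cyl \<alpha> \<otimes> x \<otimes> cyl \<beta>))"
      by (intro star_hom_finsum[OF f]) (use xA in auto)
  qed (use xA star_homD(1)[OF f] in \<open>auto intro!: M.finsum_closed\<close>)
  finally have "f x = (\<Oplus>\<alpha>\<in>paths E k. \<Oplus>\<beta>\<in>paths E k. f (cyl \<alpha> \<otimes> x \<otimes> cyl \<beta>))" .
  moreover have "\<dots> \<in> Natural"
    by (rule Natural_finsum[OF finite_paths], rule Natural_finsum[OF finite_paths], rule block)
  ultimately show ?thesis by (simp only:)
qed

lemma Natural_P: "v \<in> verts E \<Longrightarrow> P v \<in> Natural"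
proof -
  assume v: "v \<in> verts E"
  then have "(v, []) \<in> paths E 0" by (simp add: paths_0)
  from natural_Natural[OF natural_mu[OF this this]] show ?thesis using v by (simp add: mu_def)
qed

lemma cyl_Cons_S:
  assumes "g \<in> arcs E" "(head E g, q) \<in> paths E k" "e \<in> arcs E"
  shows "cyl (tail E g, g # q) \<otimes> S e = (if g = e then S e \<otimes> cyl (head E e, q) else \<zero>)"
proof -
  have gA: "T (head E g, q) \<in> carrier A" using assms(2) by (rule T_closed)
  have "cyl (tail E g, g # q) \<otimes> S e
      = S g \<otimes> T (head E g, q) \<otimes> ((T (head E g, q))\<^sup>\<star> \<otimes> ((S g)\<^sup>\<star> \<otimes> S e))"
    using assms(1,3) gA by (simp add: cyl_def T_Cons adj_mult m_assoc)
  moreover have "(T (head E g, q))\<^sup>\<star> \<otimes> P (head E g) = (T (head E g, q))\<^sup>\<star>"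
    using adj_mult[of "P (head E g)" "T (head E g, q)"] P_T[OF _ assms(2), of "head E g"] assms(1) gA by simp
  ultimately show ?thesis
    using assms(1,3) gA by (cases "g = e") (simp_all add: S_star_S S_orthogonal cyl_def m_assoc)
qed

lemma Natural_shift:
  assumes x: "x \<in> Natural" and ef: "e \<in> arcs E" "f \<in> arcs E"
  shows "S e \<otimes> x \<otimes> (S f)\<^sup>\<star> \<in> Natural"
proof -
  obtain k where k: "x \<in> natural k" using x by (auto simp: Natural_def)
  note xA = natural_closed[OF k]
  have "S e \<otimes> x \<otimes> (S f)\<^sup>\<star> \<in> natural (Suc k)"
    unfolding natural_def mspan_def
  proof (intro CollectI conjI ballI)
    show "S e \<otimes> x \<otimes> (S f)\<^sup>\<star> \<in> carrier A" using xA ef by simp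
    fix \<alpha> \<beta> assume "\<alpha> \<in> paths E (Suc k)" "\<beta> \<in> paths E (Suc k)"
    then obtain g q h r where \<alpha>: "\<alpha> = (tail E g, g # q)" "g \<in> arcs E" "(head E g, q) \<in> paths E k"
      and \<beta>: "\<beta> = (tail E h, h # r)" "h \<in> arcs E" "(head E h, r) \<in> paths E k"
      by (cases \<alpha>, cases \<beta>) (auto simp: paths_Suc_Cons)
    have \<alpha>p: "\<alpha> \<in> paths E (Suc k)" and \<beta>p: "\<beta> \<in> paths E (Suc k)" by fact+
    have fh: "(S f)\<^sup>\<star> \<otimes> cyl \<beta> = (cyl \<beta> \<otimes> S f)\<^sup>\<star>" using ef \<beta>p by (simp add: adj_mult)
    have block: "cyl \<alpha> \<otimes> (S e \<otimes> x \<otimes> (S f)\<^sup>\<star>) \<otimes> cyl \<beta> = (cyl \<alpha> \<otimes> S e) \<otimes> x \<otimes> ((S f)\<^sup>\<star> \<otimes> cyl \<beta>)"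
      using ef xA \<alpha>p \<beta>p by (simp add: m_assoc)
    have \<alpha>S: "cyl \<alpha> \<otimes> S e = (if g = e then S e \<otimes> cyl (head E e, q) else \<zero>)"
      unfolding \<alpha>(1) by (rule cyl_Cons_S[OF \<alpha>(2,3) ef(1)])
    have \<beta>S: "cyl \<beta> \<otimes> S f = (if h = f then S f \<otimes> cyl (head E f, r) else \<zero>)"
      unfolding \<beta>(1) by (rule cyl_Cons_S[OF \<beta>(2,3) ef(2)])
    show "\<exists>c\<in>\<nat>. cyl \<alpha> \<otimes> (S e \<otimes> x \<otimes> (S f)\<^sup>\<star>) \<otimes> cyl \<beta> = c \<odot> mu \<alpha> \<beta>"
    proof (cases "g = e \<and> h = f")
      case True
      then have p: "(head E e, q) \<in> paths E k" "(head E f, r) \<in> paths E k" using \<alpha> \<beta> by auto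
      obtain n where n: "cyl (head E e, q) \<otimes> x \<otimes> cyl (head E f, r) = of_nat n \<odot> mu (head E e, q) (head E f, r)"
        using naturalD[OF k p] .
      have "cyl \<alpha> \<otimes> (S e \<otimes> x \<otimes> (S f)\<^sup>\<star>) \<otimes> cyl \<beta>
          = S e \<otimes> (cyl (head E e, q) \<otimes> x \<otimes> cyl (head E f, r)) \<otimes> (S f)\<^sup>\<star>"
        unfolding block fh \<alpha>S \<beta>S using True ef xA cyl_closed[OF p(1)] cyl_closed[OF p(2)]
        by (simp add: adj_mult cyl_star[OF p(2)] m_assoc)
      also have "\<dots> = of_nat n \<odot> mu \<alpha> \<beta>"
        unfolding n mu_def \<alpha>(1) \<beta>(1) using True ef T_closed[OF p(1)] T_closed[OF p(2)]
        by (simp add: T_Cons adj_mult smult_mult_l smult_mult_r m_assoc)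
      finally show ?thesis by (rule bexI) (rule of_nat_in_Nats)
    next
      case False
      then have "cyl \<alpha> \<otimes> (S e \<otimes> x \<otimes> (S f)\<^sup>\<star>) \<otimes> cyl \<beta> = 0 \<odot> mu \<alpha> \<beta>"
        unfolding block fh \<alpha>S \<beta>S using ef xA \<alpha>p \<beta>p cyl_closed[OF \<alpha>(3)] cyl_closed[OF \<beta>(3)] by auto
      then show ?thesis using Nats_0 by (rule bexI)
    qed
  qed
  then show ?thesis by (rule natural_Natural)
qed

text \<open>Matrix units of level \<open>k + 1\<close> are of the form \<open>S\<^sub>g x S\<^sub>h\<^sup>*\<close> with \<open>x\<close> of level \<open>k\<close>, and
  such an element is mapped to \<open>u S\<^sub>b\<^sub>g f(x) S\<^sub>b\<^sub>h\<^sup>* u\<^sup>*\<close>.\<close>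
lemma twisted_endomorphism_Natural:
  assumes f: "f \<in> star_hom A A" and a: "\<And>v. v \<in> verts E \<Longrightarrow> a v \<in> verts E \<and> f (P v) = P (a v)"
    and b: "\<And>e. e \<in> arcs E \<Longrightarrow> b e \<in> arcs E \<and> f (S e) = u \<otimes> S (b e)"
    and u: "u \<in> Natural" and x: "x \<in> Natural"
  shows "f x \<in> Natural"
proof (rule star_hom_Natural[OF f _ x])
  note uA = Natural_closed[OF u]
  fix k \<alpha> \<beta> assume "\<alpha> \<in> paths E k" "\<beta> \<in> paths E k"
  then show "f (mu \<alpha> \<beta>) \<in> Natural"
  proof (induct k arbitrary: \<alpha> \<beta>)
    case 0
    then obtain v w where vw: "\<alpha> = (v, [])" "\<beta> = (w, [])" "v \<in> verts E" "w \<in> verts E"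
      by (auto simp: paths_0)
    have "f (P v \<otimes> P w) = P (a v) \<otimes> P (a w)" using vw a by (simp add: star_homD(3)[OF f])
    then show ?case using vw a Natural_mult Natural_P by (simp add: mu_def)
  next
    case (Suc k)
    then obtain g q h r where \<alpha>: "\<alpha> = (tail E g, g # q)" "g \<in> arcs E" "(head E g, q) \<in> paths E k"
      and \<beta>: "\<beta> = (tail E h, h # r)" "h \<in> arcs E" "(head E h, r) \<in> paths E k"
      by (cases \<alpha>, cases \<beta>) (auto simp: paths_Suc_Cons)
    let ?m = "mu (head E g, q) (head E h, r)"
    have m: "?m \<in> carrier A" "f ?m \<in> Natural" using \<alpha> \<beta> Suc(1) by auto
    have "mu \<alpha> \<beta> = S g \<otimes> ?m \<otimes> (S h)\<^sup>\<star>"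
      unfolding mu_def \<alpha>(1) \<beta>(1) using \<alpha>(2,3) \<beta>(2,3) T_closed by (simp add: T_Cons adj_mult m_assoc)
    then have "f (mu \<alpha> \<beta>) = f (S g) \<otimes> f ?m \<otimes> (f (S h))\<^sup>\<star>"
      using \<alpha>(2) \<beta>(2) m(1) by (simp add: star_homD[OF f])
    also have "\<dots> = u \<otimes> (S (b g) \<otimes> f ?m \<otimes> (S (b h))\<^sup>\<star>) \<otimes> u\<^sup>\<star>"
      using b[OF \<alpha>(2)] b[OF \<beta>(2)] uA Natural_closed[OF m(2)] by (simp add: adj_mult m_assoc)
    also have "\<dots> \<in> Natural"
      using b[OF \<alpha>(2)] b[OF \<beta>(2)] by (intro Natural_mult Natural_star Natural_shift u m(2)) auto
    finally show ?case .
  qed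
qed

definition gauge_equivariant :: "('a \<Rightarrow> 'a) \<Rightarrow> bool" where
  "gauge_equivariant f \<longleftrightarrow> (\<forall>z. cmod z = 1 \<longrightarrow> (\<forall>x\<in>carrier A. f (\<gamma> z x) = \<gamma> z (f x)))"

lemma conjugation_sum:
  assumes w: "w \<in> carrier A" and q: "q \<in> carrier A"
  shows "w \<otimes> q \<otimes> w\<^sup>\<star> = (\<Oplus>\<beta>\<in>paths E k. w \<otimes> (q \<otimes> cyl \<beta>) \<otimes> w\<^sup>\<star>)"
proof -
  have "w \<otimes> q \<otimes> w\<^sup>\<star> = (w \<otimes> q) \<otimes> (\<Oplus>\<beta>\<in>paths E k. cyl \<beta>) \<otimes> w\<^sup>\<star>" using w q by (simp add: sum_cyl)
  also have "(w \<otimes> q) \<otimes> (\<Oplus>\<beta>\<in>paths E k. cyl \<beta>) = (\<Oplus>\<beta>\<in>paths E k. (w \<otimes> q) \<otimes> cyl \<beta>)"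
    by (rule finsum_mult_left) (use w q in auto)
  also have "\<dots> \<otimes> w\<^sup>\<star> = (\<Oplus>\<beta>\<in>paths E k. (w \<otimes> q) \<otimes> cyl \<beta> \<otimes> w\<^sup>\<star>)"
    by (rule finsum_mult_right) (use w q in auto)
  also have "\<dots> = (\<Oplus>\<beta>\<in>paths E k. w \<otimes> (q \<otimes> cyl \<beta>) \<otimes> w\<^sup>\<star>)"
    by (rule M.finsum_cong') (use w q in \<open>auto simp: m_assoc\<close>)
  finally show ?thesis .
qed

lemma conjugation_cyl:
  assumes w: "w \<in> carrier A" and q: "q \<in> Diag" and \<beta>: "\<beta> \<in> paths E k"
  shows "w \<otimes> (q \<otimes> cyl \<beta>) \<otimes> w\<^sup>\<star> = (w \<otimes> cyl \<beta>) \<otimes> q \<otimes> (w \<otimes> cyl \<beta>)\<^sup>\<star>"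
proof -
  note qA = DiagD(3)[OF q]
  have "(w \<otimes> cyl \<beta>) \<otimes> q \<otimes> (w \<otimes> cyl \<beta>)\<^sup>\<star> = w \<otimes> (cyl \<beta> \<otimes> q) \<otimes> (cyl \<beta> \<otimes> w\<^sup>\<star>)"
    using w qA \<beta> by (simp add: adj_mult m_assoc)
  also have "\<dots> = w \<otimes> (q \<otimes> (cyl \<beta> \<otimes> cyl \<beta>)) \<otimes> w\<^sup>\<star>"
    unfolding Diag_commute[OF cyl_Diag[OF \<beta>] q] using w qA \<beta> by (simp add: m_assoc)
  finally show ?thesis using cyl_mult[OF \<beta> \<beta>] by simp
qed

text \<open>The phases of the blocks of \<open>v\<close> are dropped; they do not affect conjugation.\<close>
lemma normalizer_combinatorial_part:
  assumes v: "normalizer v" and y: "y \<in> mspan UNIV k k" "cnorm A (v \<ominus> y) < 1 / 8"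
  obtains s where "s \<in> Natural" "\<forall>q\<in>Diag. s \<otimes> q \<otimes> s\<^sup>\<star> = v \<otimes> q \<otimes> v\<^sup>\<star>"
proof -
  note vA = normalizerD(1)[OF v]
  define B where "B = {\<beta> \<in> paths E k. v \<otimes> cyl \<beta> \<noteq> \<zero>}"
  have "\<forall>\<beta>\<in>B. \<exists>\<alpha>. \<alpha> \<in> paths E k \<and>
      (\<forall>q\<in>Diag. v \<otimes> (q \<otimes> cyl \<beta>) \<otimes> v\<^sup>\<star> = mu \<alpha> \<beta> \<otimes> q \<otimes> mu \<beta> \<alpha>)"
  proof
    fix \<beta> assume "\<beta> \<in> B"
    then have \<beta>: "\<beta> \<in> paths E k" "v \<otimes> cyl \<beta> \<noteq> \<zero>" by (auto simp: B_def)
    show "\<exists>\<alpha>. \<alpha> \<in> paths E k \<and> (\<forall>q\<in>Diag. v \<otimes> (q \<otimes> cyl \<beta>) \<otimes> v\<^sup>\<star> = mu \<alpha> \<beta> \<otimes> q \<otimes> mu \<beta> \<alpha>)"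
      by (rule normalizer_block_conjugation[OF v y \<beta>]) (intro exI conjI ballI)
  qed
  then obtain j where j: "\<And>\<beta>. \<beta> \<in> B \<Longrightarrow> j \<beta> \<in> paths E k"
    "\<And>\<beta> q. \<lbrakk>\<beta> \<in> B; q \<in> Diag\<rbrakk> \<Longrightarrow> v \<otimes> (q \<otimes> cyl \<beta>) \<otimes> v\<^sup>\<star> = mu (j \<beta>) \<beta> \<otimes> q \<otimes> mu \<beta> (j \<beta>)"
    by metis
  have B: "finite B" "B \<subseteq> paths E k" by (auto simp: B_def)
  define s where "s = (\<Oplus>\<beta>\<in>B. mu (j \<beta>) \<beta>)"
  have muN: "mu (j \<beta>) \<beta> \<in> natural k" if "\<beta> \<in> B" for \<beta> using that j(1) B by (intro natural_mu) auto
  then have sN: "s \<in> natural k" unfolding s_def by (rule natural_finsum[OF B(1)])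
  note sA = natural_closed[OF sN]
  have s_cyl: "s \<otimes> cyl \<beta> = (if \<beta> \<in> B then mu (j \<beta>) \<beta> else \<zero>)" if \<beta>: "\<beta> \<in> paths E k" for \<beta>
  proof -
    have term_eq: "mu (j \<beta>') \<beta>' \<otimes> cyl \<beta> = (if \<beta>' = \<beta> then mu (j \<beta>') \<beta>' else \<zero>)" if "\<beta>' \<in> B" for \<beta>'
    proof -
      have p: "\<beta>' \<in> paths E k" "j \<beta>' \<in> paths E k" using that B j(1) by auto
      have "mu (j \<beta>') \<beta>' \<otimes> cyl \<beta> = T (j \<beta>') \<otimes> ((T \<beta>')\<^sup>\<star> \<otimes> cyl \<beta>)"
        unfolding mu_def using p \<beta> by (simp add: m_assoc)
      then show ?thesis using T_star_cyl[OF \<beta> p(1)] p by (auto simp: mu_def)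
    qed
    have "s \<otimes> cyl \<beta> = (\<Oplus>\<beta>'\<in>B. mu (j \<beta>') \<beta>' \<otimes> cyl \<beta>)"
      unfolding s_def by (rule finsum_mult_right[OF B(1)]) (use \<beta> natural_closed[OF muN] in auto)
    also have "\<dots> = (if \<beta> \<in> B then mu (j \<beta>) \<beta> else \<zero>)"
    proof (cases "\<beta> \<in> B")
      case True
      have "(\<Oplus>\<beta>'\<in>B. mu (j \<beta>') \<beta>' \<otimes> cyl \<beta>) = mu (j \<beta>) \<beta> \<otimes> cyl \<beta>"
        by (rule finsum_only[OF B(1) True])
          (use term_eq[OF True] natural_closed[OF muN[OF True]] term_eq in auto)
      then show ?thesis using True term_eq[OF True] by simp
    next
      case False
      have "(\<Oplus>\<beta>'\<in>B. mu (j \<beta>') \<beta>' \<otimes> cyl \<beta>) = \<zero>"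
        by (rule finsum_zeroI) (use False term_eq in auto)
      then show ?thesis using False by simp
    qed
    finally show ?thesis .
  qed
  have "s \<otimes> q \<otimes> s\<^sup>\<star> = v \<otimes> q \<otimes> v\<^sup>\<star>" if q: "q \<in> Diag" for q
  proof -
    note qA = DiagD(3)[OF q]
    have "s \<otimes> (q \<otimes> cyl \<beta>) \<otimes> s\<^sup>\<star> = v \<otimes> (q \<otimes> cyl \<beta>) \<otimes> v\<^sup>\<star>" if \<beta>: "\<beta> \<in> paths E k" for \<beta>
    proof (cases "\<beta> \<in> B")
      case True
      show ?thesis
        unfolding conjugation_cyl[OF sA q \<beta>] j(2)[OF True q] s_cyl[OF \<beta>]
        using True j(1)[OF True] \<beta> by (simp add: mu_star)
    next
      case False
      then have "v \<otimes> cyl \<beta> = \<zero>" using \<beta> by (simp add: B_def)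
      then show ?thesis
        unfolding conjugation_cyl[OF sA q \<beta>] conjugation_cyl[OF vA q \<beta>] s_cyl[OF \<beta>]
        using False by simp
    qed
    then show ?thesis
      unfolding conjugation_sum[OF sA qA, of k] conjugation_sum[OF vA qA, of k]
      by (intro M.finsum_cong') (use vA qA in auto)
  qed
  then show thesis by (intro that[OF natural_Natural[OF sN]]) blast
qed

text \<open>The inverse of a localized automorphism is localized as well. It preserves the diagonal,
  because the diagonal is maximal abelian in the core. So it maps a matrix unit \<open>x\<close> to a normalizer
  of the diagonal; the combinatorial part \<open>s\<close> of this normalizer has an image \<open>f s\<close> which acts on
  the diagonal like \<open>x\<close>, whence \<open>f s = x\<close>.\<close>
lemma inverse_Natural:
  assumes f: "f \<in> cstar_auto A" "gauge_equivariant f" "\<And>x. x \<in> Natural \<Longrightarrow> f x \<in> Natural"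
    and g: "g \<in> cstar_auto A" "\<And>x. x \<in> carrier A \<Longrightarrow> f (g x) = x" "\<And>x. x \<in> carrier A \<Longrightarrow> g (f x) = x"
    and x: "x \<in> Natural"
  shows "g x \<in> Natural"
proof (rule star_hom_Natural[OF cstar_auto_hom[OF g(1)] _ x])
  note fh = cstar_auto_hom[OF f(1)] and gh = cstar_auto_hom[OF g(1)]
  note fA = star_homD(1)[OF fh] and gA = star_homD(1)[OF gh]
  have g_core: "g x \<in> core E A P S" if "x \<in> Natural" for x
  proof -
    have xA: "x \<in> carrier A" and inv: "\<And>z. cmod z = 1 \<Longrightarrow> \<gamma> z x = x"
      using Natural_core[OF that] by (auto simp: core_def)
    have "\<gamma> z (g x) = g x" if z: "cmod z = 1" for z
    proof -
      have "f (\<gamma> z (g x)) = x"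
        using f(2) z gA[OF xA] g(2)[OF xA] inv[OF z] by (simp add: gauge_equivariant_def)
      then show ?thesis using g(3)[of "\<gamma> z (g x)"] z gA[OF xA] by simp
    qed
    then show ?thesis using gA[OF xA] by (simp add: core_def)
  qed
  have f_Diag: "f q \<in> Diag" if "q \<in> Diag" for q
    using that f(3) star_hom_projection[OF fh] by (auto simp: Diag_def)
  have g_Diag: "g q \<in> Diag" if q: "q \<in> Diag" for q
  proof (rule Diag_maximal)
    show "g q \<in> projections A" by (rule star_hom_projection[OF gh DiagD(1)[OF q]])
    show "g q \<in> core E A P S" by (rule g_core[OF DiagD(2)[OF q]])
    fix p assume p: "p \<in> Diag"
    have "g (q \<otimes> f p) = g (f p \<otimes> q)" by (rule arg_cong[OF Diag_commute[OF q f_Diag[OF p]]])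
    then show "g q \<otimes> p = p \<otimes> g q"
      using DiagD(3)[OF p] DiagD(3)[OF q] fA by (simp add: star_homD(3)[OF gh] g(3))
  qed
  fix k \<alpha> \<beta> assume ab: "\<alpha> \<in> paths E k" "\<beta> \<in> paths E k"
  let ?x = "mu \<alpha> \<beta>"
  have xA: "?x \<in> carrier A" and xN: "?x \<in> Natural" "mu \<beta> \<alpha> \<in> Natural"
    using ab natural_Natural[OF natural_mu[OF ab]] natural_Natural[OF natural_mu[OF ab(2,1)]] by simp_all
  have iso: "(mu \<gamma>' \<delta>)\<^sup>\<star> \<otimes> mu \<gamma>' \<delta> \<in> projections A" if "\<gamma>' \<in> paths E k" "\<delta> \<in> paths E k" for \<gamma>' \<delta>
  proof (cases "path_range \<gamma>' = path_range \<delta>")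
    case True
    show ?thesis
      unfolding mu_star[OF that] mu_star_mu[OF that True] by (rule cyl_projection[OF that(2)])
  next
    case False
    then show ?thesis unfolding mu_eq_zero[OF that False] by (simp add: projections_def)
  qed
  have "normalizer (g ?x)"
    unfolding normalizer_def
  proof (intro conjI ballI)
    show "g ?x \<in> carrier A" by (rule gA[OF xA])
    fix q assume q: "q \<in> Diag"
    have fq: "f q \<in> carrier A" by (rule fA[OF DiagD(3)[OF q]])
    have "?x \<otimes> f q \<otimes> ?x\<^sup>\<star> \<in> Diag" by (rule conjugate_Diag[OF xN(1) iso[OF ab] f_Diag[OF q]])
    then have "g (?x \<otimes> f q \<otimes> ?x\<^sup>\<star>) \<in> Diag" by (rule g_Diag)
    then show "g ?x \<otimes> q \<otimes> (g ?x)\<^sup>\<star> \<in> Diag"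
      using xA fq DiagD(3)[OF q] by (simp add: star_homD[OF gh] g(3))
    have "mu \<beta> \<alpha> \<otimes> f q \<otimes> (mu \<beta> \<alpha>)\<^sup>\<star> \<in> Diag" by (rule conjugate_Diag[OF xN(2) iso[OF ab(2,1)] f_Diag[OF q]])
    then have "?x\<^sup>\<star> \<otimes> f q \<otimes> ?x \<in> Diag" using mu_star[OF ab] mu_star[OF ab(2,1)] by simp
    then have "g (?x\<^sup>\<star> \<otimes> f q \<otimes> ?x) \<in> Diag" by (rule g_Diag)
    then show "(g ?x)\<^sup>\<star> \<otimes> q \<otimes> g ?x \<in> Diag"
      using xA fq DiagD(3)[OF q] by (simp add: star_homD[OF gh] g(3))
  qed
  note v = this
  obtain l y where y: "y \<in> mspan UNIV l l" "cnorm A (g ?x \<ominus> y) < 1 / 8"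
    by (rule core_approx[OF g_core[OF xN(1)], of "1 / 8"]) simp
  obtain s where s: "s \<in> Natural" "\<forall>q\<in>Diag. s \<otimes> q \<otimes> s\<^sup>\<star> = g ?x \<otimes> q \<otimes> (g ?x)\<^sup>\<star>"
    using normalizer_combinatorial_part[OF v y] .
  note sA = Natural_closed[OF s(1)]
  have "f s = ?x"
  proof (rule eq_if_conjugation_eq[OF f(3)[OF s(1)] xN(1)])
    fix q assume q: "q \<in> Diag"
    note qA = DiagD(3)[OF q]
    have "f (s \<otimes> g q \<otimes> s\<^sup>\<star>) = f (g ?x \<otimes> g q \<otimes> (g ?x)\<^sup>\<star>)"
      by (rule arg_cong[OF bspec[OF s(2) g_Diag[OF q]]])
    then show "f s \<otimes> q \<otimes> (f s)\<^sup>\<star> = ?x \<otimes> q \<otimes> ?x\<^sup>\<star>"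
      using sA qA gA xA by (simp add: star_homD[OF fh] g(2))
  qed
  then have "g ?x = s" using g(3)[OF sA] by simp
  then show "g ?x \<in> Natural" using s(1) by simp
qed


section \<open>Inner automorphisms\<close>

subsection \<open>Live paths\<close>

text \<open>Some vertex projections may vanish, and with them all paths that end at such vertices.\<close>
definition live :: "nat \<Rightarrow> ('v \<times> 'e list) set" where
  "live n = {\<alpha> \<in> paths E n. cyl \<alpha> \<noteq> \<zero>}"

lemma finite_live [simp]: "finite (live n)"
  by (simp add: live_def)

lemma live_paths: "\<alpha> \<in> live n \<Longrightarrow> \<alpha> \<in> paths E n"
  by (simp add: live_def)

lemma inj_on_cyl: "inj_on cyl (live n)"
proof (rule inj_onI, rule ccontr)
  fix \<alpha> \<beta> assume a: "\<alpha> \<in> live n" "\<beta> \<in> live n" "cyl \<alpha> = cyl \<beta>" "\<alpha> \<noteq> \<beta>"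
  then have "cyl \<alpha> \<otimes> cyl \<alpha> = \<zero>" "cyl \<alpha> \<otimes> cyl \<alpha> = cyl \<alpha>"
    using cyl_mult[of \<alpha> n \<beta>] cyl_mult[of \<alpha> n \<alpha>] live_paths by auto
  then show False using a(1) by (simp add: live_def)
qed

definition shorten :: "'v \<times> 'e list \<Rightarrow> 'v \<times> 'e list" where
  "shorten \<alpha> = (fst \<alpha>, butlast (snd \<alpha>))"

lemma cyl_mult_longer:
  assumes \<alpha>: "\<alpha> \<in> paths E n" and \<alpha>': "\<alpha>' \<in> paths E (Suc n)"
  shows "cyl \<alpha> \<otimes> cyl \<alpha>' = (if \<alpha> = shorten \<alpha>' then cyl \<alpha>' else \<zero>)"
    and "shorten \<alpha>' \<in> paths E n"
proof -
  obtain \<beta> e where \<beta>: "\<beta> \<in> paths E n" "e \<in> arcs E" "T \<alpha>' = T \<beta> \<otimes> S e" "\<beta> = shorten \<alpha>'"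
    using snoc_path[OF \<alpha>'] unfolding shorten_def by metis
  have "cyl \<alpha> \<otimes> cyl \<alpha>' = (cyl \<alpha> \<otimes> T \<beta>) \<otimes> (S e \<otimes> (T \<alpha>')\<^sup>\<star>)"
    unfolding cyl_def[of \<alpha>'] using \<alpha> \<alpha>' \<beta>(1,2) by (simp add: \<beta>(3) m_assoc)
  moreover have "T \<beta> \<otimes> (S e \<otimes> (T \<alpha>')\<^sup>\<star>) = cyl \<alpha>'"
    unfolding cyl_def[of \<alpha>'] using \<alpha>' \<beta>(1,2) by (simp add: \<beta>(3) m_assoc)
  ultimately show "cyl \<alpha> \<otimes> cyl \<alpha>' = (if \<alpha> = shorten \<alpha>' then cyl \<alpha>' else \<zero>)"
    using cyl_T[OF \<alpha> \<beta>(1)] \<alpha>' \<beta>(1,2) unfolding \<beta>(4)[symmetric] by auto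
  show "shorten \<alpha>' \<in> paths E n" using \<beta>(1) unfolding \<beta>(4) .
qed

lemma cyl_eq_sum_longer:
  assumes "\<alpha> \<in> paths E n"
  shows "cyl \<alpha> = (\<Oplus>\<alpha>'\<in>paths E (Suc n). cyl \<alpha> \<otimes> cyl \<alpha>')"
  using finsum_mult_left[of "paths E (Suc n)" "cyl \<alpha>" cyl] assms by (simp add: sum_cyl)

lemma shorten_live: "shorten ` live (Suc n) = live n"
proof (intro equalityI subsetI)
  fix \<alpha> assume "\<alpha> \<in> shorten ` live (Suc n)"
  then obtain \<alpha>' where \<alpha>': "\<alpha>' \<in> paths E (Suc n)" "cyl \<alpha>' \<noteq> \<zero>" "\<alpha> = shorten \<alpha>'"
    by (auto simp: live_def)
  have "\<alpha> \<in> paths E n" using cyl_mult_longer(2)[OF _ \<alpha>'(1)] \<alpha>'(1,3) snoc_path[OF \<alpha>'(1)] by metis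
  moreover from this have "cyl \<alpha> \<otimes> cyl \<alpha>' = cyl \<alpha>'" using cyl_mult_longer(1)[OF _ \<alpha>'(1)] \<alpha>'(3) by simp
  then have "cyl \<alpha> \<noteq> \<zero>" using \<alpha>'(1,2) by auto
  ultimately show "\<alpha> \<in> live n" by (simp add: live_def)
next
  fix \<alpha> assume \<alpha>: "\<alpha> \<in> live n"
  have "\<exists>\<alpha>'\<in>paths E (Suc n). cyl \<alpha> \<otimes> cyl \<alpha>' \<noteq> \<zero>"
  proof (rule ccontr)
    assume "\<not> ?thesis"
    then have "cyl \<alpha> = \<zero>"
      using cyl_eq_sum_longer[OF live_paths[OF \<alpha>]] finsum_zeroI[of "paths E (Suc n)"] by simp
    then show False using \<alpha> by (simp add: live_def)
  qed
  then obtain \<alpha>' where \<alpha>': "\<alpha>' \<in> paths E (Suc n)" "cyl \<alpha> \<otimes> cyl \<alpha>' \<noteq> \<zero>" by blast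
  then have "\<alpha> = shorten \<alpha>' \<and> cyl \<alpha>' \<noteq> \<zero>"
    using cyl_mult_longer(1)[OF live_paths[OF \<alpha>] \<alpha>'(1)] by (auto split: if_splits)
  then show "\<alpha> \<in> shorten ` live (Suc n)" using \<alpha>'(1) by (auto simp: live_def)
qed

lemma card_live_mono: "m \<le> n \<Longrightarrow> card (live m) \<le> card (live n)"
  by (rule lift_Suc_mono_le[of "\<lambda>n. card (live n)"]) (metis card_image_le finite_live shorten_live)

lemma cyl_shorten:
  assumes card: "card (live (Suc n)) = card (live n)" and \<alpha>': "\<alpha>' \<in> live (Suc n)"
  shows "cyl (shorten \<alpha>') = cyl \<alpha>'"
proof -
  have inj: "inj_on shorten (live (Suc n))"
    by (rule eq_card_imp_inj_on) (simp_all add: shorten_live card)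
  have s: "shorten \<alpha>' \<in> paths E n" using \<alpha>' shorten_live live_paths by blast
  have "cyl (shorten \<alpha>') = (\<Oplus>\<beta>'\<in>paths E (Suc n). cyl (shorten \<alpha>') \<otimes> cyl \<beta>')"
    by (rule cyl_eq_sum_longer[OF s])
  also have "\<dots> = cyl (shorten \<alpha>') \<otimes> cyl \<alpha>'"
  proof (rule finsum_only[where f = "\<lambda>\<beta>'. cyl (shorten \<alpha>') \<otimes> cyl \<beta>'" and i = \<alpha>'])
    fix \<beta>' assume \<beta>': "\<beta>' \<in> paths E (Suc n)" "\<beta>' \<noteq> \<alpha>'"
    show "cyl (shorten \<alpha>') \<otimes> cyl \<beta>' = \<zero>"
    proof (cases "shorten \<alpha>' = shorten \<beta>'")
      case True
      then have "\<beta>' \<notin> live (Suc n)" using inj \<alpha>' \<beta>'(2) by (auto dest: inj_onD)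
      then have "cyl \<beta>' = \<zero>" using \<beta>'(1) by (simp add: live_def)
      then show ?thesis using s by simp
    next
      case False
      then show ?thesis using cyl_mult_longer(1)[OF s \<beta>'(1)] by simp
    qed
  qed (use live_paths[OF \<alpha>'] s in auto)
  also have "\<dots> = cyl \<alpha>'" using cyl_mult_longer(1)[OF s live_paths[OF \<alpha>']] by simp
  finally show ?thesis .
qed

text \<open>If the number of live paths stabilizes, live paths have unique extensions from some level on, so
  no new cylinders appear.\<close>
lemma finite_Diag:
  assumes card: "\<And>n. n \<ge> n\<^sub>0 \<Longrightarrow> card (live (Suc n)) = card (live n)"
  shows "finite Diag"
proof -
  have sub: "cyl ` live n \<subseteq> cyl ` live n\<^sub>0" if "n \<ge> n\<^sub>0" for n
    using that
  proof (induct n rule: dec_induct)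
    case (step n)
    have "cyl \<alpha>' \<in> cyl ` live n" if "\<alpha>' \<in> live (Suc n)" for \<alpha>'
      using cyl_shorten[OF card[OF step(1)] that] that shorten_live by (metis imageI)
    then show ?case using step(3) by blast
  qed simp
  have "Diag \<subseteq> (\<lambda>Y. \<Oplus>p\<in>Y. p) ` Pow (cyl ` live n\<^sub>0)"
  proof
    fix q assume q: "q \<in> Diag"
    obtain k where k: "k \<ge> n\<^sub>0" "q \<in> natural k"
      using common_level[OF DiagD(2)[OF q] DiagD(2)[OF q]] .
    define Y where "Y = {\<alpha> \<in> live k. q \<otimes> cyl \<alpha> = cyl \<alpha>}"
    have XP: "Y \<subseteq> paths E k" using live_paths by (auto simp: Y_def)
    have "q = (\<Oplus>\<alpha>\<in>paths E k. q \<otimes> cyl \<alpha>)"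
      using finsum_mult_left[of "paths E k" q cyl] DiagD(3)[OF q] by (simp add: sum_cyl)
    also have "\<dots> = (\<Oplus>\<alpha>\<in>Y. cyl \<alpha>)"
    proof (rule M.add.finprod_mono_neutral_cong_right)
      fix \<alpha> assume "\<alpha> \<in> paths E k - Y"
      then show "q \<otimes> cyl \<alpha> = \<zero>"
        using projection_natural_cyl(1)[OF DiagD(1)[OF q] k(2), of \<alpha>] by (auto simp: Y_def live_def)
    qed (use XP DiagD(3)[OF q] in \<open>auto simp: Y_def intro: cyl_closed\<close>)
    also have "\<dots> = (\<Oplus>p\<in>cyl ` Y. p)"
    proof (rule M.finsum_reindex[symmetric])
      show "inj_on cyl Y" by (rule inj_on_subset[OF inj_on_cyl]) (auto simp: Y_def)
    qed (use XP cyl_closed in blast)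
    finally have "q = (\<Oplus>p\<in>cyl ` Y. p)" .
    moreover have "cyl ` Y \<subseteq> cyl ` live n\<^sub>0" using sub[OF k(1)] by (auto simp: Y_def)
    ultimately show "q \<in> (\<lambda>Y. \<Oplus>p\<in>Y. p) ` Pow (cyl ` live n\<^sub>0)" by blast
  qed
  then show ?thesis by (rule finite_subset) simp
qed


subsection \<open>Unitary normalizers\<close>

lemma unitaryD:
  assumes "w \<in> unitaries A"
  shows "w \<in> carrier A" "w\<^sup>\<star> \<otimes> w = \<one>" "w \<otimes> w\<^sup>\<star> = \<one>"
  using assms by (auto simp: unitaries_def)

lemma unitary_conjugation_cancel:
  assumes w: "w \<in> unitaries A" and x: "x \<in> carrier A"
  shows "w\<^sup>\<star> \<otimes> (w \<otimes> x \<otimes> w\<^sup>\<star>) \<otimes> w = x"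
proof -
  note c = unitaryD[OF w]
  have "w\<^sup>\<star> \<otimes> (w \<otimes> x \<otimes> w\<^sup>\<star>) \<otimes> w = (w\<^sup>\<star> \<otimes> w) \<otimes> x \<otimes> (w\<^sup>\<star> \<otimes> w)" using c(1) x by (simp add: m_assoc)
  then show ?thesis using x by (simp add: c(2))
qed

lemma unitary_mult_cyl:
  assumes w: "w \<in> unitaries A" and \<beta>: "\<beta> \<in> live b"
  shows "w \<otimes> cyl \<beta> \<noteq> \<zero>"
proof
  note c = unitaryD[OF w] cyl_closed[OF live_paths[OF \<beta>]]
  assume "w \<otimes> cyl \<beta> = \<zero>"
  then have "w\<^sup>\<star> \<otimes> (w \<otimes> cyl \<beta>) = \<zero>" using c(1) by simp
  then have "(w\<^sup>\<star> \<otimes> w) \<otimes> cyl \<beta> = \<zero>" using c(1,4) by (simp add: m_assoc)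
  then show False using c(4) \<beta> by (simp add: c(2) live_def)
qed

lemma card_live_le:
  assumes w: "w \<in> unitaries A" "normalizer w" and y: "y \<in> mspan UNIV a b" "cnorm A (w \<ominus> y) < 1 / 8"
  shows "card (live b) \<le> card (live a)"
proof -
  have "\<forall>\<beta>\<in>live b. \<exists>\<alpha>\<in>live a. w \<otimes> cyl \<beta> \<otimes> w\<^sup>\<star> = cyl \<alpha>"
  proof
    fix \<beta> assume \<beta>: "\<beta> \<in> live b"
    obtain \<alpha> where \<alpha>: "\<alpha> \<in> paths E a" "w \<otimes> cyl \<beta> \<otimes> w\<^sup>\<star> = cyl \<alpha>"
      using normalizer_block[OF w(2) y live_paths[OF \<beta>] unitary_mult_cyl[OF w(1) \<beta>]] by metis
    have "w\<^sup>\<star> \<otimes> cyl \<alpha> \<otimes> w = cyl \<beta>"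
      unfolding \<alpha>(2)[symmetric] by (rule unitary_conjugation_cancel[OF w(1) cyl_closed[OF live_paths[OF \<beta>]]])
    then have "cyl \<alpha> \<noteq> \<zero>" using \<beta> unitaryD(1)[OF w(1)] by (auto simp: live_def)
    then show "\<exists>\<alpha>\<in>live a. w \<otimes> cyl \<beta> \<otimes> w\<^sup>\<star> = cyl \<alpha>"
      using \<alpha> by (intro bexI[of _ \<alpha>]) (simp_all add: live_def)
  qed
  then obtain j where j: "\<And>\<beta>. \<beta> \<in> live b \<Longrightarrow> j \<beta> \<in> live a"
    "\<And>\<beta>. \<beta> \<in> live b \<Longrightarrow> w \<otimes> cyl \<beta> \<otimes> w\<^sup>\<star> = cyl (j \<beta>)" by metis
  have "inj_on j (live b)"
  proof (rule inj_onI)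
    fix \<beta> \<beta>' assume b: "\<beta> \<in> live b" "\<beta>' \<in> live b" "j \<beta> = j \<beta>'"
    then have "cyl \<beta> = cyl \<beta>'"
      using unitary_conjugation_cancel[OF w(1) cyl_closed[OF live_paths[OF b(1)]]]
        unitary_conjugation_cancel[OF w(1) cyl_closed[OF live_paths[OF b(2)]]] j(2)[OF b(1)] j(2)[OF b(2)]
      by (simp only:)
    then show "\<beta> = \<beta>'" using inj_on_cyl b by (auto dest: inj_onD)
  qed
  then show ?thesis using j(1) by (intro card_inj_on_le) auto
qed

text \<open>Conjugation by \<open>w\<close> matches the live paths of length \<open>b + i\<close> with those of length \<open>a + i\<close>,
  for every \<open>i\<close>. Since the number of live paths does not decrease with the length, it is constant from
  \<open>min a b\<close> on.\<close>
lemma finite_Diag_if_nonzero_degree: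
  assumes w: "w \<in> unitaries A" "normalizer w" and y: "y \<in> mspan UNIV a b" "cnorm A (w \<ominus> y) < 1 / 8"
    and ab: "a \<noteq> b"
  shows "finite Diag"
proof (rule finite_Diag)
  have "w\<^sup>\<star> \<in> unitaries A" by (rule unitaries_closed(2)[OF w(1)])
  moreover have "cnorm A (w\<^sup>\<star> \<ominus> y\<^sup>\<star>) < 1 / 8"
    using y(2) cnorm_adj[of "w \<ominus> y"] unitaryD(1)[OF w(1)] mspan_closed[OF y(1)] by (simp add: adj_diff)
  ultimately have eq: "card (live (a + i)) = card (live (b + i))" for i
    using card_live_le[OF w mspan_raise[OF star_semiring_UNIV y(1)] y(2)]
      card_live_le[OF _ normalizer_star[OF w(2)] mspan_raise[OF star_semiring_UNIV mspan_star[OF star_semiring_UNIV y(1)]]]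
    by (intro antisym) auto
  fix n assume n: "n \<ge> min a b"
  have "card (live n) = card (live (max a b + (n - min a b)))"
    using eq[of "n - min a b"] n by (cases "a \<le> b") (auto simp: min_def max_def)
  moreover have "Suc n \<le> max a b + (n - min a b)" using n ab by (auto simp: min_def max_def)
  ultimately show "card (live (Suc n)) = card (live n)"
    using card_live_mono[of n "Suc n"] card_live_mono[of "Suc n" "max a b + (n - min a b)"] by simp
qed

lemma mu_mult_self:
  assumes "\<alpha> \<in> paths E k" "\<beta> \<in> paths E k"
  shows "mu \<alpha> \<beta> \<otimes> cyl \<beta> = mu \<alpha> \<beta>"
  using T_star_cyl[OF assms(2,2)] assms by (simp add: mu_def m_assoc)

text \<open>For \<open>a \<noteq> b\<close> there are only finitely many diagonal projections to permute. For \<open>a = b\<close>,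
  conjugation by \<open>w\<close> permutes the finitely many live paths of length \<open>b\<close> by a map \<open>j\<close>, and it does
  not touch what a path does after its first \<open>b\<close> edges; a power of \<open>j\<close> is the identity.\<close>
lemma unitary_normalizer_periodic:
  assumes w: "w \<in> unitaries A" "normalizer w" and y: "y \<in> mspan UNIV a b" "cnorm A (w \<ominus> y) < 1 / 8"
  obtains M where "M > 0" "\<forall>q\<in>Diag. ((\<lambda>x. w \<otimes> x \<otimes> w\<^sup>\<star>) ^^ M) q = q"
proof (cases "a = b")
  case False
  have "finite Diag" by (rule finite_Diag_if_nonzero_degree[OF w y False])
  moreover have "(\<lambda>x. w \<otimes> x \<otimes> w\<^sup>\<star>) ` Diag \<subseteq> Diag" using normalizerD(2)[OF w(2)] by auto
  moreover have "inj_on (\<lambda>x. w \<otimes> x \<otimes> w\<^sup>\<star>) Diag"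
    by (rule inj_on_inverseI[of _ "\<lambda>x. w\<^sup>\<star> \<otimes> x \<otimes> w"]) (rule unitary_conjugation_cancel[OF w(1) DiagD(3)])
  ultimately show thesis using that by (rule inj_on_finite_periodic)
next
  case True
  let ?f = "\<lambda>x. w \<otimes> x \<otimes> w\<^sup>\<star>"
  note wA = unitaryD(1)[OF w(1)]
  have y': "y \<in> mspan UNIV b b" using y(1) True by simp
  have "\<forall>\<beta>\<in>live b. \<exists>\<alpha>. \<alpha> \<in> live b \<and> ?f (cyl \<beta>) = cyl \<alpha> \<and> path_range \<alpha> = path_range \<beta> \<and>
      (\<forall>q\<in>Diag. ?f (q \<otimes> cyl \<beta>) = mu \<alpha> \<beta> \<otimes> q \<otimes> mu \<beta> \<alpha>)"
  proof
    fix \<beta> assume \<beta>: "\<beta> \<in> live b"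
    show "\<exists>\<alpha>. \<alpha> \<in> live b \<and> ?f (cyl \<beta>) = cyl \<alpha> \<and> path_range \<alpha> = path_range \<beta> \<and>
      (\<forall>q\<in>Diag. ?f (q \<otimes> cyl \<beta>) = mu \<alpha> \<beta> \<otimes> q \<otimes> mu \<beta> \<alpha>)"
    proof (rule normalizer_block_conjugation[OF w(2) y' y(2) live_paths[OF \<beta>] unitary_mult_cyl[OF w(1) \<beta>]])
      fix \<alpha> assume \<alpha>: "\<alpha> \<in> paths E b" "path_range \<alpha> = path_range \<beta>" "?f (cyl \<beta>) = cyl \<alpha>"
        and conj: "\<And>q. q \<in> Diag \<Longrightarrow> ?f (q \<otimes> cyl \<beta>) = mu \<alpha> \<beta> \<otimes> q \<otimes> mu \<beta> \<alpha>"
      have "w\<^sup>\<star> \<otimes> cyl \<alpha> \<otimes> w = cyl \<beta>"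
        unfolding \<alpha>(3)[symmetric] by (rule unitary_conjugation_cancel[OF w(1) cyl_closed[OF live_paths[OF \<beta>]]])
      then have "cyl \<alpha> \<noteq> \<zero>" using \<beta> wA by (auto simp: live_def)
      then have "\<alpha> \<in> live b" using \<alpha>(1) by (simp add: live_def)
      then show ?thesis using \<alpha>(2,3) conj by (intro exI[of _ \<alpha>] conjI ballI)
    qed
  qed
  then obtain j where j: "\<And>\<beta>. \<beta> \<in> live b \<Longrightarrow> j \<beta> \<in> live b"
    "\<And>\<beta>. \<beta> \<in> live b \<Longrightarrow> ?f (cyl \<beta>) = cyl (j \<beta>)" "\<And>\<beta>. \<beta> \<in> live b \<Longrightarrow> path_range (j \<beta>) = path_range \<beta>"
    "\<And>\<beta> q. \<lbrakk>\<beta> \<in> live b; q \<in> Diag\<rbrakk> \<Longrightarrow> ?f (q \<otimes> cyl \<beta>) = mu (j \<beta>) \<beta> \<otimes> q \<otimes> mu \<beta> (j \<beta>)"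
    by metis
  have inj: "inj_on j (live b)"
  proof (rule inj_onI)
    fix \<beta> \<beta>' assume b: "\<beta> \<in> live b" "\<beta>' \<in> live b" "j \<beta> = j \<beta>'"
    then have "cyl \<beta> = cyl \<beta>'"
      using unitary_conjugation_cancel[OF w(1) cyl_closed[OF live_paths[OF b(1)]]]
        unitary_conjugation_cancel[OF w(1) cyl_closed[OF live_paths[OF b(2)]]] j(2)[OF b(1)] j(2)[OF b(2)]
      by (simp only:)
    then show "\<beta> = \<beta>'" using inj_on_cyl b by (auto dest: inj_onD)
  qed
  obtain M where M: "M > 0" "\<forall>\<beta>\<in>live b. (j ^^ M) \<beta> = \<beta>"
    using inj_on_finite_periodic[OF finite_live _ inj] j(1) by blast
  have jn: "(j ^^ n) \<beta> \<in> live b \<and> path_range ((j ^^ n) \<beta>) = path_range \<beta>" if "\<beta> \<in> live b" for \<beta> n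
    using that by (induct n) (auto simp: j(1,3))
  have power: "(?f ^^ n) (q \<otimes> cyl \<beta>) = mu ((j ^^ n) \<beta>) \<beta> \<otimes> q \<otimes> mu \<beta> ((j ^^ n) \<beta>)"
    if q: "q \<in> Diag" and \<beta>: "\<beta> \<in> live b" for n q \<beta>
  proof (induct n)
    case 0
    note c = DiagD(3)[OF q] live_paths[OF \<beta>]
    have "cyl \<beta> \<otimes> q \<otimes> cyl \<beta> = q \<otimes> (cyl \<beta> \<otimes> cyl \<beta>)"
      unfolding Diag_commute[OF cyl_Diag[OF c(2)] q] using c by (simp add: m_assoc)
    then show ?case using cyl_mult[OF c(2,2)] by (simp add: mu_self)
  next
    case (Suc n)
    let ?\<gamma> = "(j ^^ n) \<beta>"
    let ?e = "mu ?\<gamma> \<beta>" and ?e' = "mu \<beta> ?\<gamma>"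
    have g: "?\<gamma> \<in> live b" "path_range ?\<gamma> = path_range \<beta>" using jn[OF \<beta>] by auto
    note p = live_paths[OF \<beta>] live_paths[OF g(1)] live_paths[OF j(1)[OF g(1)]]
    note qA = DiagD(3)[OF q]
    let ?q = "?e \<otimes> q \<otimes> ?e'"
    have "?e\<^sup>\<star> \<otimes> ?e \<in> projections A"
      unfolding mu_star[OF p(2,1)] mu_star_mu[OF p(2,1) g(2)] by (rule cyl_projection[OF p(1)])
    then have q': "?q \<in> Diag"
      using conjugate_Diag[OF natural_Natural[OF natural_mu[OF p(2,1)]] _ q] mu_star[OF p(2,1)] by simp
    have "?q \<otimes> cyl ?\<gamma> = ?q" using mu_mult_self[OF p(1,2)] p qA by (simp add: m_assoc)
    then have "(?f ^^ Suc n) (q \<otimes> cyl \<beta>) = ?f (?q \<otimes> cyl ?\<gamma>)" using Suc by simp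
    also have "\<dots> = mu (j ?\<gamma>) ?\<gamma> \<otimes> ?q \<otimes> mu ?\<gamma> (j ?\<gamma>)" by (rule j(4)[OF g(1) q'])
    also have "\<dots> = (mu (j ?\<gamma>) ?\<gamma> \<otimes> ?e) \<otimes> q \<otimes> (?e' \<otimes> mu ?\<gamma> (j ?\<gamma>))"
      using p qA by (simp add: m_assoc)
    also have "\<dots> = mu (j ?\<gamma>) \<beta> \<otimes> q \<otimes> mu \<beta> (j ?\<gamma>)"
      using mu_mult[OF p(3,2,2,1)] mu_mult[OF p(1,2,2,3)] j(3)[OF g(1)] g(2) by simp
    finally show ?case by simp
  qed
  have "(?f ^^ M) q = q" if q: "q \<in> Diag" for q
  proof -
    note qA = DiagD(3)[OF q]
    have sum: "(?f ^^ n) q = (\<Oplus>\<beta>\<in>paths E b. (?f ^^ n) (q \<otimes> cyl \<beta>)) \<and>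
        (\<forall>\<beta>\<in>paths E b. (?f ^^ n) (q \<otimes> cyl \<beta>) \<in> carrier A)" for n
    proof (induct n)
      case 0
      show ?case using finsum_mult_left[of "paths E b" q cyl] qA by (simp add: sum_cyl)
    next
      case (Suc n)
      have c: "(?f ^^ n) (q \<otimes> cyl \<beta>) \<in> carrier A" if "\<beta> \<in> paths E b" for \<beta> using Suc that by blast
      have "(?f ^^ Suc n) q = w \<otimes> (\<Oplus>\<beta>\<in>paths E b. (?f ^^ n) (q \<otimes> cyl \<beta>)) \<otimes> w\<^sup>\<star>" using Suc by simp
      also have "w \<otimes> (\<Oplus>\<beta>\<in>paths E b. (?f ^^ n) (q \<otimes> cyl \<beta>)) = (\<Oplus>\<beta>\<in>paths E b. w \<otimes> (?f ^^ n) (q \<otimes> cyl \<beta>))"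
        by (rule finsum_mult_left) (use wA c in auto)
      also have "\<dots> \<otimes> w\<^sup>\<star> = (\<Oplus>\<beta>\<in>paths E b. ?f ((?f ^^ n) (q \<otimes> cyl \<beta>)))"
        by (rule finsum_mult_right) (use wA c in auto)
      finally show ?case using c wA by simp
    qed
    have "(?f ^^ M) (q \<otimes> cyl \<beta>) = q \<otimes> cyl \<beta>" if \<beta>: "\<beta> \<in> paths E b" for \<beta>
    proof (cases "\<beta> \<in> live b")
      case True
      then show ?thesis using power[OF q True, of M] power[OF q True, of 0] M(2) by simp
    next
      case False
      then have z: "q \<otimes> cyl \<beta> = \<zero>" using \<beta> qA by (simp add: live_def)
      have "(?f ^^ n) \<zero> = \<zero>" for n using wA by (induct n) auto
      then show ?thesis unfolding z .
    qed
    then have "(?f ^^ M) q = (\<Oplus>\<beta>\<in>paths E b. q \<otimes> cyl \<beta>)"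
      unfolding sum[of M, THEN conjunct1] by (intro M.finsum_cong') (use qA in auto)
    also have "\<dots> = q" using finsum_mult_left[of "paths E b" q cyl] qA by (simp add: sum_cyl)
    finally show ?thesis .
  qed
  then show thesis using that[of M] M(1) by blast
qed

subsection \<open>Periodicity\<close>

text \<open>Unlike being of the form \<open>S\<^sub>e \<mapsto> u S\<^sub>e\<close> with a permutation unitary \<open>u\<close>, these conditions
  are visibly inherited by products and inverses.\<close>
definition localized :: "('a \<Rightarrow> 'a) set" where
  "localized = {f \<in> cstar_auto A. gauge_equivariant f \<and> f ` Natural = Natural}"

lemma gauge_equivariantD:
  "\<lbrakk>gauge_equivariant f; cmod z = 1; x \<in> carrier A\<rbrakk> \<Longrightarrow> f (\<gamma> z x) = \<gamma> z (f x)"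
  by (simp add: gauge_equivariant_def)

lemma core_subset: "core E A P S \<subseteq> carrier A"
  by (auto simp: core_def)

text \<open>If \<open>Ad(w)\<close> commutes with the gauge action, then \<open>Ad(w) = Ad(\<gamma>\<^sub>z(w))\<close>, so that
  \<open>w\<^sup>* \<gamma>\<^sub>z(w)\<close> is central.\<close>
lemma gauge_eigenvector:
  assumes w: "w \<in> unitaries A" and eq: "gauge_equivariant (Ad A w)"
    and comm: "relative_commutant A (core E A P S) = {c \<odot> \<one> | c. True}" and z: "cmod z = 1"
  shows "\<exists>c. \<gamma> z w = c \<odot> w"
proof -
  note c = unitaryD[OF w]
  define t where "t = w\<^sup>\<star> \<otimes> \<gamma> z w"
  have gA: "\<gamma> z w \<in> carrier A" using z c(1) by simp
  have tA: "t \<in> carrier A" using gA c(1) by (simp add: t_def)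
  have gg: "(\<gamma> z w)\<^sup>\<star> \<otimes> \<gamma> z w = \<one>"
  proof -
    have "\<gamma> z (w\<^sup>\<star> \<otimes> w) = (\<gamma> z w)\<^sup>\<star> \<otimes> \<gamma> z w" using c(1) z by (simp add: star_homD[OF gauge_hom])
    then show ?thesis by (simp add: c(2) gauge_one[OF z])
  qed
  have central: "t \<otimes> x = x \<otimes> t" if x: "x \<in> carrier A" for x
  proof -
    have z': "cmod (cnj z) = 1" using z by simp
    define y where "y = \<gamma> (cnj z) x"
    have y: "y \<in> carrier A" using x z' by (simp add: y_def)
    have "\<gamma> z y = \<gamma> (z * cnj z) x" unfolding y_def by (rule gauge_gauge[OF z z' x])
    also have "z * cnj z = 1" using complex_norm_square[of z] z by simp
    finally have yx: "\<gamma> z y = x" using gauge_by_one[OF x] by simp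
    have "w \<otimes> x \<otimes> w\<^sup>\<star> = Ad A w (\<gamma> z y)" using x by (simp add: Ad_def yx)
    also have "\<dots> = \<gamma> z (w \<otimes> y \<otimes> w\<^sup>\<star>)" using gauge_equivariantD[OF eq z y] y by (simp add: Ad_def)
    also have "\<dots> = \<gamma> z w \<otimes> x \<otimes> (\<gamma> z w)\<^sup>\<star>" using c(1) y z by (simp add: star_homD[OF gauge_hom] yx)
    finally have 1: "w \<otimes> x \<otimes> w\<^sup>\<star> = \<gamma> z w \<otimes> x \<otimes> (\<gamma> z w)\<^sup>\<star>" .
    have "x \<otimes> t = (w\<^sup>\<star> \<otimes> w) \<otimes> x \<otimes> (w\<^sup>\<star> \<otimes> \<gamma> z w)" using x by (simp add: c(2) t_def)
    also have "\<dots> = w\<^sup>\<star> \<otimes> (w \<otimes> x \<otimes> w\<^sup>\<star>) \<otimes> \<gamma> z w" using c(1) gA x by (simp add: m_assoc)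
    also have "\<dots> = w\<^sup>\<star> \<otimes> \<gamma> z w \<otimes> x \<otimes> ((\<gamma> z w)\<^sup>\<star> \<otimes> \<gamma> z w)"
      unfolding 1 using c(1) gA x by (simp add: m_assoc)
    also have "\<dots> = t \<otimes> x" using tA x by (simp add: gg t_def[symmetric])
    finally show ?thesis by simp
  qed
  have "t \<in> relative_commutant A (core E A P S)"
    using tA central core_subset unfolding relative_commutant_def by blast
  then obtain k where k: "t = k \<odot> \<one>" unfolding comm by blast
  have "\<gamma> z w = w \<otimes> t" using c(1,3) gA by (simp add: t_def flip: m_assoc)
  also have "\<dots> = k \<odot> w" unfolding k using c(1) by (simp add: smult_mult_r)
  finally show ?thesis by blast
qed

text \<open>A power \<open>Ad(u)\<close> of \<open>Ad(w)\<close> fixes the diagonal. For a matrix unit \<open>x\<close>, the element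
  \<open>u x u\<^sup>*\<close> of \<open>Natural\<close> then acts on the diagonal like \<open>x\<close>, so it equals \<open>x\<close>. Consequently
  \<open>u\<close> commutes with the core and is a scalar.\<close>
lemma inner_localized_periodic:
  assumes w: "w \<in> unitaries A" and loc: "Ad A w \<in> localized"
    and comm: "relative_commutant A (core E A P S) = {c \<odot> \<one> | c. True}"
  obtains M where "M > 0" "\<forall>x\<in>carrier A. (Ad A w ^^ M) x = x"
proof (cases "w = \<zero>")
  \<comment> \<open>Here \<open>A\<close> is the zero algebra.\<close>
  case True
  have "\<one> = \<zero>" using unitaryD(3)[OF w] True by simp
  have zero: "x = \<zero>" if x: "x \<in> carrier A" for x
  proof -
    have "x = \<one> \<otimes> x" using x by simp
    also have "\<dots> = \<zero>" unfolding \<open>\<one> = \<zero>\<close> by (rule A.l_null[OF x])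
    finally show ?thesis .
  qed
  show thesis
  proof (rule that)
    show "(1::nat) > 0" by simp
    show "\<forall>x\<in>carrier A. (Ad A w ^^ 1) x = x"
    proof
      fix x assume x: "x \<in> carrier A"
      have "Ad A w x \<in> carrier A" using x unitaryD(1)[OF w] by (simp add: Ad_def)
      from zero[OF this] zero[OF x] have "Ad A w x = x" by (rule trans[OF _ sym])
      then show "(Ad A w ^^ 1) x = x" by simp
    qed
  qed
next
  case False
  note c = unitaryD[OF w]
  have eq: "gauge_equivariant (Ad A w)" and img: "Ad A w ` Natural = Natural"
    using loc by (auto simp: localized_def)
  note fauto = Ad_in_auto[OF w] and fh = cstar_auto_hom[OF Ad_in_auto[OF w]]
  have fD: "Ad A w q \<in> Diag" if "q \<in> Diag" for q
    using that img star_hom_projection[OF fh] by (auto simp: Diag_def)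
  have norm: "normalizer w"
    unfolding normalizer_def
  proof (intro conjI ballI c(1))
    fix q assume q: "q \<in> Diag"
    note qA = DiagD(3)[OF q]
    show "w \<otimes> q \<otimes> w\<^sup>\<star> \<in> Diag" using fD[OF q] qA by (simp add: Ad_def)
    obtain p where p: "p \<in> Natural" "q = w \<otimes> p \<otimes> w\<^sup>\<star>"
    proof -
      have "q \<in> Ad A w ` Natural" unfolding img by (rule DiagD(2)[OF q])
      then show thesis using that Natural_closed by (auto simp: Ad_def)
    qed
    have "w\<^sup>\<star> \<otimes> q \<otimes> w = p"
      unfolding p(2) by (rule unitary_conjugation_cancel[OF w Natural_closed[OF p(1)]])
    moreover have "w\<^sup>\<star> \<otimes> q \<otimes> w = Ad A (w\<^sup>\<star>) q" using qA c(1) by (simp add: Ad_def)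
    then have "w\<^sup>\<star> \<otimes> q \<otimes> w \<in> projections A"
      using star_hom_projection[OF cstar_auto_hom[OF Ad_in_auto[OF unitaries_closed(2)[OF w]]] DiagD(1)[OF q]]
      by simp
    ultimately show "w\<^sup>\<star> \<otimes> q \<otimes> w \<in> Diag" using p(1) by (simp add: Diag_def)
  qed
  obtain a b y where y: "y \<in> mspan UNIV a b" "cnorm A (w \<ominus> y) < 1 / 8"
    by (rule eigenvector_approx[OF c(1) False gauge_eigenvector[OF w eq comm], of "1 / 8"]) simp_all
  obtain M where M: "M > 0" "\<forall>q\<in>Diag. ((\<lambda>x. w \<otimes> x \<otimes> w\<^sup>\<star>) ^^ M) q = q"
    using unitary_normalizer_periodic[OF w norm y] .
  obtain u where u: "u \<in> unitaries A" "\<forall>x\<in>carrier A. (Ad A w ^^ M) x = Ad A u x"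
    using Ad_power[OF w] .
  let ?h = "Ad A u"
  note hauto = Ad_in_auto[OF u(1)] and hh = cstar_auto_hom[OF Ad_in_auto[OF u(1)]]
  note uc = unitaryD[OF u(1)]
  have pow: "(Ad A w ^^ n) x = ((\<lambda>x. w \<otimes> x \<otimes> w\<^sup>\<star>) ^^ n) x \<and> (Ad A w ^^ n) x \<in> carrier A"
    if "x \<in> carrier A" for x n
    using that c(1) by (induct n) (auto simp: Ad_def)
  have h_Diag: "?h q = q" if q: "q \<in> Diag" for q
    using u(2) M(2) pow[OF DiagD(3)[OF q], of M] q DiagD(3)[OF q] by simp
  have pow_Natural: "(Ad A w ^^ n) x \<in> Natural" if "x \<in> Natural" for x n
    using that img by (induct n) auto
  have h_mu: "?h (mu \<alpha> \<beta>) = mu \<alpha> \<beta>" if ab: "\<alpha> \<in> paths E k" "\<beta> \<in> paths E k" for \<alpha> \<beta> k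
  proof (rule eq_if_conjugation_eq)
    let ?x = "mu \<alpha> \<beta>"
    have xN: "?x \<in> Natural" using natural_Natural[OF natural_mu[OF ab]] .
    note xA = Natural_closed[OF xN]
    show "?x \<in> Natural" by (rule xN)
    show "?h ?x \<in> Natural" using pow_Natural[OF xN, of M] u(2) xA by simp
    fix q assume q: "q \<in> Diag"
    note qA = DiagD(3)[OF q]
    have "?x \<otimes> q \<otimes> ?x\<^sup>\<star> \<in> Diag"
    proof (cases "path_range \<alpha> = path_range \<beta>")
      case True
      have "?x\<^sup>\<star> \<otimes> ?x = cyl \<beta>" unfolding mu_star[OF ab] by (rule mu_star_mu[OF ab True])
      then show ?thesis using conjugate_Diag[OF xN _ q] cyl_projection[OF ab(2)] by simp
    next
      case False
      then show ?thesis
        using conjugate_Diag[OF xN _ q] mu_eq_zero[OF ab False] by (simp add: projections_def)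
    qed
    then have "?h (?x \<otimes> q \<otimes> ?x\<^sup>\<star>) = ?x \<otimes> q \<otimes> ?x\<^sup>\<star>" by (rule h_Diag)
    then show "?h ?x \<otimes> q \<otimes> (?h ?x)\<^sup>\<star> = ?x \<otimes> q \<otimes> ?x\<^sup>\<star>"
      using xA qA h_Diag[OF q] by (simp add: star_homD[OF hh])
  qed
  have h_mspan: "?h y = y" if y: "y \<in> mspan UNIV k k" for y k
  proof (rule eq_if_blocks_eq[of _ _ k k])
    note yA = mspan_closed[OF y]
    show "?h y \<in> carrier A" "y \<in> carrier A" using yA star_homD(1)[OF hh] by auto
    fix \<alpha> \<beta> assume ab: "\<alpha> \<in> paths E k" "\<beta> \<in> paths E k"
    obtain l where l: "cyl \<alpha> \<otimes> y \<otimes> cyl \<beta> = l \<odot> mu \<alpha> \<beta>" using mspanD[OF y ab] .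
    have "cyl \<alpha> \<otimes> ?h y \<otimes> cyl \<beta> = ?h (cyl \<alpha> \<otimes> y \<otimes> cyl \<beta>)"
      using ab yA h_Diag[OF cyl_Diag[OF ab(1)]] h_Diag[OF cyl_Diag[OF ab(2)]]
      by (simp add: star_homD(3)[OF hh])
    then show "cyl \<alpha> \<otimes> ?h y \<otimes> cyl \<beta> = cyl \<alpha> \<otimes> y \<otimes> cyl \<beta>"
      unfolding l using h_mu[OF ab] ab by (simp add: star_homD(4)[OF hh])
  qed
  have h_core: "?h x = x" if x: "x \<in> core E A P S" for x
  proof -
    have xA: "x \<in> carrier A" using x core_subset by blast
    have hxA: "?h x \<in> carrier A" by (rule star_homD(1)[OF hh xA])
    have "?h x \<ominus> x = \<zero>"
    proof (rule eq_zero_if_arbitrarily_small[of _ 2])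
      fix \<epsilon> :: real assume "\<epsilon> > 0"
      obtain k y where y: "y \<in> mspan UNIV k k" "cnorm A (x \<ominus> y) < \<epsilon>" using core_approx[OF x \<open>\<epsilon> > 0\<close>] .
      note yA = mspan_closed[OF y(1)]
      have "cnorm A (?h x \<ominus> x) \<le> cnorm A (?h x \<ominus> y) + cnorm A (y \<ominus> x)"
        by (rule cnorm_triangle_diff) (use hxA xA yA in auto)
      also have "?h x \<ominus> y = ?h (x \<ominus> y)" using h_mspan[OF y(1)] xA yA by (simp add: star_hom_diff[OF hh])
      also have "cnorm A (?h (x \<ominus> y)) \<le> cnorm A (x \<ominus> y)"
        by (rule unital_star_hom_contractive[OF hh auto_one[OF hauto]]) (use xA yA in simp)
      finally show "cnorm A (?h x \<ominus> x) \<le> 2 * \<epsilon>" using y(2) cnorm_diff_commute[OF xA yA] by simp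
    qed (use hxA xA in simp)
    then show ?thesis using hxA xA by (simp add: diff_eq_zero_iff)
  qed
  have "u \<in> relative_commutant A (core E A P S)"
    unfolding relative_commutant_def
  proof (intro CollectI conjI ballI uc(1))
    fix x assume x: "x \<in> core E A P S"
    then have xA: "x \<in> carrier A" using core_subset by blast
    have "x \<otimes> u = (u \<otimes> x \<otimes> u\<^sup>\<star>) \<otimes> u" using h_core[OF x] xA by (simp add: Ad_def)
    also have "\<dots> = u \<otimes> x \<otimes> (u\<^sup>\<star> \<otimes> u)" using uc(1) xA by (simp add: m_assoc)
    finally show "u \<otimes> x = x \<otimes> u" using uc(1) xA by (simp add: uc(2))
  qed
  then obtain k where k: "u = k \<odot> \<one>" unfolding comm by blast
  have "?h x = x" if x: "x \<in> carrier A" for x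
  proof -
    have "u \<otimes> x = x \<otimes> u" unfolding k using x by (simp add: smult_mult_l smult_mult_r)
    then have "?h x = x \<otimes> (u \<otimes> u\<^sup>\<star>)" using x uc(1) by (simp add: Ad_def m_assoc)
    then show ?thesis using x by (simp add: uc(3))
  qed
  then show thesis using that[of M] M(1) u(2) by simp
qed


subsection \<open>The restricted Weyl group\<close>

lemma subgroup_localized: "subgroup localized (aut_group A)"
proof -
  interpret G: group "aut_group A" by (rule group_aut_group)
  show ?thesis
  proof (rule G.subgroupI)
    show "localized \<subseteq> carrier (aut_group A)" by (auto simp: localized_def carrier_aut_group)
    have "\<one>\<^bsub>aut_group A\<^esub> \<in> localized"
      using G.one_closed Natural_closed
      by (auto simp: localized_def carrier_aut_group one_aut_group gauge_equivariant_def image_iff)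
    then show "localized \<noteq> {}" by blast
  next
    fix f assume f: "f \<in> localized"
    then have fa: "f \<in> cstar_auto A" and fe: "gauge_equivariant f" and fN: "f ` Natural = Natural"
      by (auto simp: localized_def)
    obtain g where g': "g \<in> cstar_auto A" "\<forall>x\<in>carrier A. f (g x) = x" "\<forall>x\<in>carrier A. g (f x) = x"
      using cstar_auto_inverse[OF fa] .
    have g: "g \<in> cstar_auto A" "\<And>x. x \<in> carrier A \<Longrightarrow> f (g x) = x"
      "\<And>x. x \<in> carrier A \<Longrightarrow> g (f x) = x" using g' by auto
    have "g \<otimes>\<^bsub>aut_group A\<^esub> f = \<one>\<^bsub>aut_group A\<^esub>"
      unfolding mult_aut_group[OF g(1) fa] one_aut_group by (auto simp: compose_def g(3) intro!: restrict_ext)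
    then have inv: "inv\<^bsub>aut_group A\<^esub> f = g"
      by (rule G.inv_equality) (use fa g(1) in \<open>auto simp: carrier_aut_group\<close>)
    have gA: "g x \<in> carrier A" if "x \<in> carrier A" for x using star_homD(1)[OF cstar_auto_hom[OF g(1)] that] .
    have "gauge_equivariant g"
      unfolding gauge_equivariant_def
    proof (intro allI impI ballI)
      fix z x assume z: "cmod z = 1" and x: "x \<in> carrier A"
      have "f (\<gamma> z (g x)) = \<gamma> z x" using gauge_equivariantD[OF fe z gA[OF x]] g(2)[OF x] by simp
      then show "g (\<gamma> z x) = \<gamma> z (g x)" using g(3)[of "\<gamma> z (g x)"] z gA[OF x] by simp
    qed
    moreover have "g ` Natural = Natural"
    proof -
      have "g ` (f ` Natural) = (\<lambda>x. x) ` Natural"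
        unfolding image_image by (rule image_cong) (use g(3) Natural_closed in auto)
      then show ?thesis unfolding fN by simp
    qed
    ultimately show "inv\<^bsub>aut_group A\<^esub> f \<in> localized" unfolding inv using g(1) by (simp add: localized_def)
  next
    fix f g assume "f \<in> localized" "g \<in> localized"
    then have f: "f \<in> cstar_auto A" "gauge_equivariant f" "f ` Natural = Natural"
      and g: "g \<in> cstar_auto A" "gauge_equivariant g" "g ` Natural = Natural"
      by (auto simp: localized_def)
    have gA: "g x \<in> carrier A" if "x \<in> carrier A" for x using star_homD(1)[OF cstar_auto_hom[OF g(1)] that] .
    have "compose (carrier A) f g \<in> cstar_auto A"
      using G.m_closed[of f g] f(1) g(1) by (simp add: carrier_aut_group mult_aut_group)
    moreover have "gauge_equivariant (compose (carrier A) f g)"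
      unfolding gauge_equivariant_def
      by (intro allI impI ballI) (simp add: compose_def gA gauge_equivariantD[OF f(2)] gauge_equivariantD[OF g(2)])
    moreover have "compose (carrier A) f g ` Natural = Natural"
    proof -
      have "compose (carrier A) f g ` Natural = f ` (g ` Natural)"
        unfolding image_image by (rule image_cong) (use Natural_closed in \<open>auto simp: compose_def\<close>)
      then show ?thesis by (simp add: f(3) g(3))
    qed
    ultimately show "f \<otimes>\<^bsub>aut_group A\<^esub> g \<in> localized"
      unfolding mult_aut_group[OF f(1) g(1)] by (simp add: localized_def)
  qed
qed

lemma twisted_automorphism_localized:
  assumes f: "f \<in> cstar_auto A" and ab: "(a, b) \<in> graph_auto E"
    and u: "u \<in> U_group E A P" "u \<in> Natural"
    and fP: "\<And>v. v \<in> verts E \<Longrightarrow> f (P v) = P (a v)" and fS: "\<And>e. e \<in> arcs E \<Longrightarrow> f (S e) = u \<otimes> S (b e)"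
  shows "f \<in> localized"
proof -
  note fh = cstar_auto_hom[OF f]
  have av: "a v \<in> verts E" if "v \<in> verts E" for v
    using ab that by (auto simp: graph_auto_def dest: bij_betw_apply)
  have be: "b e \<in> arcs E" if "e \<in> arcs E" for e
    using ab that by (auto simp: graph_auto_def dest: bij_betw_apply)
  have uA: "u \<in> carrier A" and uu: "u\<^sup>\<star> \<otimes> u = \<one>" "u \<otimes> u\<^sup>\<star> = \<one>"
    and uP: "\<And>v. v \<in> verts E \<Longrightarrow> u \<otimes> P v = P v \<otimes> u"
    using u(1) by (auto simp: U_group_def unitaries_def)
  have gauge: "gauge_equivariant f"
    unfolding gauge_equivariant_def
  proof (intro allI impI ballI)
    fix z x assume z: "cmod z = 1" and x: "x \<in> carrier A"
    have zz: "cnj z * z = 1" "z * cnj z = 1"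
      using z complex_norm_square[of z] by (simp_all add: mult.commute)
    have "z \<odot> u \<in> U_group E A P"
      using uA uu uP zz
      by (auto simp: U_group_def unitaries_def adj_smult smult_mult_l smult_mult_r smult_smult)
    then have ck: "ck_family E A (\<lambda>v. P (a v)) (\<lambda>e. (z \<odot> u) \<otimes> S (b e))"
      by (rule ck_family_twisted[OF ab]) simp_all
    have gu: "\<gamma> z u = u" using Natural_core[OF u(2)] z by (simp add: core_def)
    have "compose (carrier A) f (\<gamma> z) = compose (carrier A) (\<gamma> z) f"
    proof (rule star_hom_eqI[OF ck])
      show "compose (carrier A) f (\<gamma> z) \<in> star_hom A A" "compose (carrier A) (\<gamma> z) f \<in> star_hom A A"
        by (intro star_hom_compose fh gauge_hom[OF z])+
      fix e assume e: "e \<in> arcs E"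
      show "compose (carrier A) f (\<gamma> z) (S e) = (z \<odot> u) \<otimes> S (b e)"
        using e be[OF e] uA by (simp add: compose_def gauge_S[OF z] star_homD(4)[OF fh] fS smult_mult_l)
      show "compose (carrier A) (\<gamma> z) f (S e) = (z \<odot> u) \<otimes> S (b e)"
        using e be[OF e] uA
        by (simp add: compose_def gauge_S[OF z] star_homD(3)[OF gauge_hom[OF z]] fS gu smult_mult_l smult_mult_r)
    qed (simp_all add: compose_def gauge_P[OF z] fP av)
    then show "f (\<gamma> z x) = \<gamma> z (f x)" using x by (metis compose_eq)
  qed
  have sub: "f x \<in> Natural" if "x \<in> Natural" for x
    using twisted_endomorphism_Natural[OF fh _ _ u(2) that] fP fS av be by blast
  obtain g where g': "g \<in> cstar_auto A" "\<forall>x\<in>carrier A. f (g x) = x" "\<forall>x\<in>carrier A. g (f x) = x"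
    using cstar_auto_inverse[OF f] .
  have g: "g \<in> cstar_auto A" "\<And>x. x \<in> carrier A \<Longrightarrow> f (g x) = x"
    "\<And>x. x \<in> carrier A \<Longrightarrow> g (f x) = x" using g' by auto
  have "f ` Natural = Natural"
  proof (intro equalityI subsetI)
    fix x assume x: "x \<in> Natural"
    have "g x \<in> Natural" by (rule inverse_Natural[OF f gauge sub g x])
    then show "x \<in> f ` Natural" using g(2)[OF Natural_closed[OF x]] by (metis imageI)
  qed (use sub in auto)
  then show ?thesis using f gauge by (simp add: localized_def)
qed

lemma perm_unitaries_Natural: "u \<in> perm_unitaries E A P S k \<Longrightarrow> u \<in> Natural"
proof -
  assume "u \<in> perm_unitaries E A P S k"
  then obtain J where J: "J \<subseteq> paths E k \<times> paths E k" "finite J"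
    "u = (\<Oplus>p\<in>J. T (fst p) \<otimes> (T (snd p))\<^sup>\<star>)"
    by (auto simp: perm_unitaries_def)
  have "(\<Oplus>p\<in>J. T (fst p) \<otimes> (T (snd p))\<^sup>\<star>) \<in> natural k"
  proof (rule natural_finsum[OF J(2)])
    fix p assume "p \<in> J"
    then have "fst p \<in> paths E k" "snd p \<in> paths E k" using J(1) by auto
    then show "T (fst p) \<otimes> (T (snd p))\<^sup>\<star> \<in> natural k" using natural_mu unfolding mu_def by blast
  qed
  then show "u \<in> Natural" unfolding J(3) by (rule natural_Natural)
qed

lemma GR_localized: "carrier (GR E A P S) \<subseteq> localized"
  unfolding GR_def carrier_subgroup_generated
proof (rule group.generate_subgroup_incl[OF group_aut_group _ subgroup_localized], rule subsetI)
  fix f assume f: "f \<in> carrier (aut_group A) \<inter> (lam_inv E A P S ((\<Union>k. perm_unitaries E A P S k) \<inter> U_group E A P)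
      \<union> Gamma E A P S)"
  then have fa: "f \<in> cstar_auto A" by (simp add: carrier_aut_group)
  from f consider (lam) u k where "f = lam E A P S u" "u \<in> perm_unitaries E A P S k" "u \<in> U_group E A P"
    | (Gamma) a b where "f = graph_endo E A P S (P \<circ> a) (S \<circ> b)" "(a, b) \<in> graph_auto E"
    by (auto simp: lam_inv_def Gamma_def)
  then show "f \<in> localized"
  proof cases
    case lam
    have ck: "ck_family E A P (\<lambda>e. u \<otimes> S e)"
      by (rule ck_family_twisted[OF id_graph_auto lam(3)]) simp_all
    show ?thesis
      by (rule twisted_automorphism_localized[OF fa id_graph_auto lam(3) perm_unitaries_Natural[OF lam(2)]])
        (simp_all add: lam(1) lam_def graph_endo[OF ck])
  next
    case Gamma
    have one: "\<one> \<in> U_group E A P" using unitaries_closed(3) by (simp add: U_group_def)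
    have be: "b e \<in> arcs E" if "e \<in> arcs E" for e
      using Gamma(2) that by (auto simp: graph_auto_def dest: bij_betw_apply)
    have ck: "ck_family E A (P \<circ> a) (S \<circ> b)"
      by (rule ck_family_twisted[OF Gamma(2) one]) (simp_all add: be)
    show ?thesis
      by (rule twisted_automorphism_localized[OF fa Gamma(2) one natural_Natural[OF natural_one[of 0]]])
        (simp_all add: Gamma(1) graph_endo[OF ck] be)
  qed
qed

end

theorem corollary4p7:
  fixes E :: "('v, 'e) pre_digraph" and A :: "'a cstar"
    and P :: "'v \<Rightarrow> 'a" and S :: "'e \<Rightarrow> 'a" and \<alpha> :: "'a \<Rightarrow> 'a"
  assumes "fin_digraph E"
    and "no_sinks E" and "no_sources E" and "every_loop_has_exit E"
    and "graph_cstar_algebra E A P S" and "unital_cstar_algebra A"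
    and "relative_commutant A (core E A P S) = {c \<odot>\<^bsub>A\<^esub> \<one>\<^bsub>A\<^esub> | c. True}"
    and "\<alpha> \<in> carrier (GR E A P S)" and "group.ord (GR E A P S) \<alpha> = 0"
  shows "group.ord (out_group A) (inn A #>\<^bsub>aut_group A\<^esub> \<alpha>) = 0"
proof -
  interpret finite_graph_algebra E A P S
    using assms by (intro finite_graph_algebra.intro finite_graph_algebra_axioms.intro)
  let ?G = "aut_group A" and ?H = "inn A"
  interpret G: group ?G by (rule group_aut_group)
  interpret H: normal ?H ?G by (rule inn_normal)
  interpret O: group "out_group A" by (rule group_out_group)
  interpret R: group "GR E A P S" unfolding GR_def by (rule G.group_subgroup_generated)
  have \<alpha>: "\<alpha> \<in> localized" using assms(8) GR_localized by blast
  then have \<alpha>G: "\<alpha> \<in> carrier ?G" by (simp add: localized_def carrier_aut_group)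
  have hom: "(\<lambda>a. ?H #>\<^bsub>?G\<^esub> a) \<in> hom ?G (out_group A)"
    unfolding out_group_def by (rule H.r_coset_hom_Mod)
  have GR_pow: "\<alpha> [^]\<^bsub>GR E A P S\<^esub> n = \<alpha> [^]\<^bsub>?G\<^esub> n" for n :: nat
    by (induct n) (simp_all add: GR_def nat_pow_def)
  have "(?H #>\<^bsub>?G\<^esub> \<alpha>) [^]\<^bsub>out_group A\<^esub> n \<noteq> \<one>\<^bsub>out_group A\<^esub>" if n: "n \<noteq> 0" for n :: nat
  proof
    assume 1: "(?H #>\<^bsub>?G\<^esub> \<alpha>) [^]\<^bsub>out_group A\<^esub> n = \<one>\<^bsub>out_group A\<^esub>"
    let ?\<beta> = "\<alpha> [^]\<^bsub>?G\<^esub> n"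
    have \<beta>G: "?\<beta> \<in> carrier ?G" using \<alpha>G by simp
    have "?H #>\<^bsub>?G\<^esub> ?\<beta> = ?H"
      using hom_nat_pow[OF hom \<alpha>G group_aut_group group_out_group, of n] 1 by (simp add: out_group_def FactGroup_def)
    then have "?\<beta> \<in> ?H" using \<beta>G by (rule G.coset_join1) (rule H.subgroup_axioms)
    then obtain w where w: "w \<in> unitaries A" "?\<beta> = Ad A w" by (auto simp: inn_def)
    have "\<alpha> [^]\<^bsub>?G\<^esub> m \<in> localized" for m :: nat
      by (induct m) (simp_all add: \<alpha> subgroup.one_closed[OF subgroup_localized] subgroup.m_closed[OF subgroup_localized])
    then have "Ad A w \<in> localized" unfolding w(2)[symmetric] .
    then obtain M where M: "M > 0" "\<forall>x\<in>carrier A. (Ad A w ^^ M) x = x"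
      using inner_localized_periodic[OF w(1) _ assms(7)] by blast
    have "?\<beta> [^]\<^bsub>?G\<^esub> M = \<one>\<^bsub>?G\<^esub>"
    proof (rule extensionalityI)
      show "?\<beta> [^]\<^bsub>?G\<^esub> M \<in> extensional (carrier A)"
        using G.nat_pow_closed[OF \<beta>G, of M] cstar_auto_extensional by (simp add: carrier_aut_group)
      show "\<one>\<^bsub>?G\<^esub> \<in> extensional (carrier A)" by (simp add: one_aut_group)
      fix x assume x: "x \<in> carrier A"
      show "(?\<beta> [^]\<^bsub>?G\<^esub> M) x = \<one>\<^bsub>?G\<^esub> x"
        using aut_group_pow[of ?\<beta> x M] \<beta>G x M(2) w(2) by (simp add: carrier_aut_group one_aut_group)
    qed
    then have "\<alpha> [^]\<^bsub>?G\<^esub> (n * M) = \<one>\<^bsub>?G\<^esub>" using G.nat_pow_pow[OF \<alpha>G] by simp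
    then have "\<alpha> [^]\<^bsub>GR E A P S\<^esub> (n * M) = \<one>\<^bsub>GR E A P S\<^esub>" unfolding GR_pow by (simp add: GR_def)
    moreover have "n * M \<noteq> 0" using n M(1) by simp
    ultimately show False using R.ord_eq_0[OF assms(8)] assms(9) by blast
  qed
  moreover have "?H #>\<^bsub>?G\<^esub> \<alpha> \<in> carrier (out_group A)" using hom \<alpha>G by (auto simp: hom_def)
  ultimately show ?thesis using O.ord_eq_0 by blast
qed

end
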